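(* For $n\ge1$ let $V(s,k,n)$ ($s\in\mathbb N$, $k\in\{1,\dots,d\}$) be a family of independent random matrices such that for all $s,k$, $V(s,k,n)$ is uniform on $\mathbb U_k(n)$. Let $(B(j,n))_{j\in\mathbb N}$ be a family of elements of $\mathfrak M_n$, stable under multiplication and adjunction, which contains $p_1(n),\dots,p_d(n)$, such that for every $j$ the sequence $(\|E(B(j,n))\|)_n$ is bounded, and which converges in $\mathcal D$-distribution as $n\to\infty$. Then the family $(\{B(j,n):j\in\mathbb N\},(\{V(s,k,n)\})_{s,k})$ is asymptotically free with amalgamation over $\mathcal D$ as $n\to\infty$.
   Context: $(\mathcal A,\varphi)$ is a tracial $*$-noncommutative probability space with self-adjoint nonzero pairwise orthogonal projections $p_1,\dots,p_d$ with sum $1$; $\rho_i=\varphi(p_i)\ne0$; $\mathcal D=\mathrm{Span}\{p_1,\dots,p_d\}$; $E(x)=\sum_i\rho_i^{-1}\varphi(p_ixp_i)p_i$ is the conditional expectation $\mathcal A\to\mathcal D$. For $n\ge1$, $q_1(n),\dots,q_d(n)$ are positive integers with sum $n$ and $q_i(n)/n\to\rho_i$. $\mathfrak M_n$ is the algebra of (constant) complex $n\times n$ matrices, $\mathrm{tr}$ the normalized trace. $\mathcal D$ is identified with a $*$-subalgebra of $\mathfrak M_n$ by $\sum\lambda_ip_i\mapsto\mathrm{diag}(\lambda_1I_{q_1(n)},\dots,\lambda_dI_{q_d(n)})$; $p_k(n)$ is the image of $p_k$. Random $n\times n$ matrices (with entries having all moments) form an algebra $M_n$ with state $\mathbb E\,\mathrm{tr}$,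 and $E:M_n\to\mathcal D$ is $E(X)=\sum_k\frac{\mathbb E\,\mathrm{Tr}(p_k(n)Xp_k(n))}{q_k(n)}p_k$. $\|\cdot\|$ on $\mathcal D$ is the operator norm. $\mathbb U_k(n)$ is the compact group of matrices $U\in p_k(n)\mathfrak M_np_k(n)$ with $UU^*=U^*U=p_k(n)$ (isomorphic to the group of $q_k(n)\times q_k(n)$ unitary matrices); "uniform" means distributed according to its Haar probability measure. The $\mathcal D$-distribution of a family $(a_i)$ is the map sending each word $X_{i_0}^{\epsilon_0}d_0\cdots X_{i_m}^{\epsilon_m}d_m$ ($d_j\in\mathcal D$, $\epsilon_j\in\{1,*\}$) to $E(a_{i_0}^{\epsilon_0}d_0\cdots a_{i_m}^{\epsilon_m}d_m)$; convergence in $\mathcal D$-distribution is pointwise convergence of $\mathcal D$-distributions to that of a family in $\mathcal A$ (possibly after enlarging $(\mathcal A,\varphi)$). $*$-subalgebras $(\mathcal A_i)_{i\in I}$ containing $\mathcal D$ are free with amalgamation over $\mathcal D$ if $E(x(1)\cdots x(m))=0$ whenever $i_1\neq\cdots\neq i_m$ (consecutive indices distinct) and $x(j)\in\mathcal A_{i_j}\cap\ker E$; subsets are free with amalgamation over $\mathcal D$ if they are contained in such $*$-subalgebras. A family of sets of matrices is asymptotically free with amalgamation over $\mathcal D$ if the whole collection of matrices converges jointly in $\mathcal D$-distribution and the corresponding sets of limit elements are free with amalgamation over $\mathcal D$. *)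

theory Defs
  imports
    "HOL-Probability.Probability"
    "Jordan_Normal_Form.VS_Connect"
    "Jordan_Normal_Form.Schur_Decomposition"
begin

section \<open>Noncommutative probability spaces over the diagonal algebra\<close>

text \<open>Algebras are records with an explicit carrier, since a limit space has to be
  existentially quantified. Elements $\sum_k c_k p_k$ of $\mathcal D$ are represented by their
  coordinates \<open>c :: nat \<Rightarrow> complex\<close>, of which only \<open>c 1, \<dots>, c d\<close> matter.\<close>

record 'a star_algebra = "(complex, 'a) module" +
  star :: "'a \<Rightarrow> 'a"

locale tracial_ncps = ring A + Module.module "class_ring :: complex ring" A
  for A :: "'a star_algebra" (structure) +
  fixes \<phi> :: "'a \<Rightarrow> complex"
  assumes smult_mult_left: "\<lbrakk>x \<in> carrier A; y \<in> carrier A\<rbrakk> \<Longrightarrow> (c \<odot> x) \<otimes> y = c \<odot> (x \<otimes> y)"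
    and smult_mult_right: "\<lbrakk>x \<in> carrier A; y \<in> carrier A\<rbrakk> \<Longrightarrow> x \<otimes> (c \<odot> y) = c \<odot> (x \<otimes> y)"
    and star_closed: "x \<in> carrier A \<Longrightarrow> star A x \<in> carrier A"
    and star_star: "x \<in> carrier A \<Longrightarrow> star A (star A x) = x"
    and star_add: "\<lbrakk>x \<in> carrier A; y \<in> carrier A\<rbrakk> \<Longrightarrow> star A (x \<oplus> y) = star A x \<oplus> star A y"
    and star_smult: "x \<in> carrier A \<Longrightarrow> star A (c \<odot> x) = cnj c \<odot> star A x"
    and star_mult: "\<lbrakk>x \<in> carrier A; y \<in> carrier A\<rbrakk> \<Longrightarrow> star A (x \<otimes> y) = star A y \<otimes> star A x"
    and state_add: "\<lbrakk>x \<in> carrier A; y \<in> carrier A\<rbrakk> \<Longrightarrow> \<phi> (x \<oplus> y) = \<phi> x + \<phi> y"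
    and state_smult: "x \<in> carrier A \<Longrightarrow> \<phi> (c \<odot> x) = c * \<phi> x"
    and state_one: "\<phi> \<one> = 1"
    and state_positive: "x \<in> carrier A \<Longrightarrow> \<phi> (star A x \<otimes> x) \<in> \<real> \<and> 0 \<le> Re (\<phi> (star A x \<otimes> x))"
    and state_tracial: "\<lbrakk>x \<in> carrier A; y \<in> carrier A\<rbrakk> \<Longrightarrow> \<phi> (x \<otimes> y) = \<phi> (y \<otimes> x)"

locale tracial_ncps_over = tracial_ncps +
  fixes d :: nat and p :: "nat \<Rightarrow> 'a"
  assumes proj_closed: "k \<in> {1..d} \<Longrightarrow> p k \<in> carrier A"
    and proj_nonzero: "k \<in> {1..d} \<Longrightarrow> p k \<noteq> \<zero>"
    and proj_self_adjoint: "k \<in> {1..d} \<Longrightarrow> star A (p k) = p k"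
    and proj_idempotent: "k \<in> {1..d} \<Longrightarrow> p k \<otimes> p k = p k"
    and proj_orthogonal: "\<lbrakk>k \<in> {1..d}; l \<in> {1..d}; k \<noteq> l\<rbrakk> \<Longrightarrow> p k \<otimes> p l = \<zero>"
    and proj_sum: "(\<Oplus>k\<in>{1..d}. p k) = \<one>"
    and state_proj: "k \<in> {1..d} \<Longrightarrow> \<phi> (p k) \<noteq> 0"

definition D_elem :: "'a star_algebra \<Rightarrow> nat \<Rightarrow> (nat \<Rightarrow> 'a) \<Rightarrow> (nat \<Rightarrow> complex) \<Rightarrow> 'a" where
  "D_elem A d p c = (\<Oplus>\<^bsub>A\<^esub>k\<in>{1..d}. c k \<odot>\<^bsub>A\<^esub> p k)"

definition E_coord :: "'a star_algebra \<Rightarrow> ('a \<Rightarrow> complex) \<Rightarrow> (nat \<Rightarrow> 'a) \<Rightarrow> 'a \<Rightarrow> nat \<Rightarrow> complex" where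
  "E_coord A \<phi> p x k = \<phi> (p k \<otimes>\<^bsub>A\<^esub> x \<otimes>\<^bsub>A\<^esub> p k) / \<phi> (p k)"

definition cond_exp_D :: "'a star_algebra \<Rightarrow> ('a \<Rightarrow> complex) \<Rightarrow> nat \<Rightarrow> (nat \<Rightarrow> 'a) \<Rightarrow> 'a \<Rightarrow> 'a" where
  "cond_exp_D A \<phi> d p x = D_elem A d p (E_coord A \<phi> p x)"

subsection \<open>Freeness with amalgamation\<close>

definition star_subalgebra_over_D :: "'a star_algebra \<Rightarrow> nat \<Rightarrow> (nat \<Rightarrow> 'a) \<Rightarrow> 'a set \<Rightarrow> bool" where
  "star_subalgebra_over_D A d p S \<longleftrightarrow>
     S \<subseteq> carrier A \<and> range (D_elem A d p) \<subseteq> S \<and>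
     (\<forall>x\<in>S. \<forall>y\<in>S. x \<oplus>\<^bsub>A\<^esub> y \<in> S \<and> x \<otimes>\<^bsub>A\<^esub> y \<in> S) \<and>
     (\<forall>x\<in>S. star A x \<in> S \<and> (\<forall>c. c \<odot>\<^bsub>A\<^esub> x \<in> S))"

definition free_subalgebras_over_D ::
  "'a star_algebra \<Rightarrow> ('a \<Rightarrow> complex) \<Rightarrow> nat \<Rightarrow> (nat \<Rightarrow> 'a) \<Rightarrow> 'g set \<Rightarrow> ('g \<Rightarrow> 'a set) \<Rightarrow> bool" where
  "free_subalgebras_over_D A \<phi> d p G S \<longleftrightarrow>
     (\<forall>gs xs. gs \<noteq> [] \<and> set gs \<subseteq> G \<and> successively (\<noteq>) gs \<and>
        list_all2 (\<lambda>g x. x \<in> S g \<and> cond_exp_D A \<phi> d p x = \<zero>\<^bsub>A\<^esub>) gs xs \<longrightarrow>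
        cond_exp_D A \<phi> d p (foldr (\<otimes>\<^bsub>A\<^esub>) xs \<one>\<^bsub>A\<^esub>) = \<zero>\<^bsub>A\<^esub>)"

definition free_over_D ::
  "'a star_algebra \<Rightarrow> ('a \<Rightarrow> complex) \<Rightarrow> nat \<Rightarrow> (nat \<Rightarrow> 'a) \<Rightarrow> 'g set \<Rightarrow> ('g \<Rightarrow> 'a set) \<Rightarrow> bool" where
  "free_over_D A \<phi> d p G X \<longleftrightarrow>
     (\<exists>S. (\<forall>g\<in>G. star_subalgebra_over_D A d p (S g) \<and> X g \<subseteq> S g) \<and>
          free_subalgebras_over_D A \<phi> d p G S)"

subsection \<open>Words\<close>

text \<open>The list $[(i_0,\epsilon_0,c_0),\dots,(i_m,\epsilon_m,c_m)]$ stands for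
  $X_{i_0}^{\epsilon_0} c_0 \cdots X_{i_m}^{\epsilon_m} c_m$, with \<open>True\<close> for the
  exponent $*$; \<open>\<iota>\<close> is the inclusion of $\mathcal D$ into the algebra.\<close>

type_synonym 'i D_word = "('i \<times> bool \<times> (nat \<Rightarrow> complex)) list"

fun word_val ::
  "'a star_algebra \<Rightarrow> ((nat \<Rightarrow> complex) \<Rightarrow> 'a) \<Rightarrow> ('i \<Rightarrow> 'a) \<Rightarrow> 'i D_word \<Rightarrow> 'a" where
  "word_val A \<iota> a [] = \<one>\<^bsub>A\<^esub>"
| "word_val A \<iota> a ((i, adj, c) # w) =
     (if adj then star A (a i) else a i) \<otimes>\<^bsub>A\<^esub> \<iota> c \<otimes>\<^bsub>A\<^esub> word_val A \<iota> a w"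

section \<open>Matrices\<close>

definition mat_alg :: "nat \<Rightarrow> complex mat star_algebra" where
  "mat_alg n = \<lparr>carrier = carrier_mat n n, mult = (*), one = 1\<^sub>m n, zero = 0\<^sub>m n n, add = (+),
     smult = (\<cdot>\<^sub>m), star = mat_adjoint\<rparr>"

definition mat_trace :: "complex mat \<Rightarrow> complex" where
  "mat_trace X = (\<Sum>i<dim_row X. X $$ (i, i))"

definition vec_l2norm :: "complex Matrix.vec \<Rightarrow> real" where
  "vec_l2norm x = sqrt (\<Sum>i<dim_vec x. (cmod (vec_index x i))\<^sup>2)"

definition mat_opnorm :: "complex mat \<Rightarrow> real" where
  "mat_opnorm X = Sup {vec_l2norm (X *\<^sub>v x) | x. x \<in> carrier_vec (dim_col X) \<and> vec_l2norm x \<le> 1}"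

text \<open>In the following, \<open>q 1, \<dots>, q d\<close> are the block sizes. \<open>D_mat d q\<close> is the inclusion of
  $\mathcal D$ into the matrices, \<open>block_proj d q k\<close> the image of $p_k$.\<close>

definition D_mat :: "nat \<Rightarrow> (nat \<Rightarrow> nat) \<Rightarrow> (nat \<Rightarrow> complex) \<Rightarrow> complex mat" where
  "D_mat d q c = diag_block_mat (map (\<lambda>k. c k \<cdot>\<^sub>m 1\<^sub>m (q k)) [1..<Suc d])"

definition block_proj :: "nat \<Rightarrow> (nat \<Rightarrow> nat) \<Rightarrow> nat \<Rightarrow> complex mat" where
  "block_proj d q k = D_mat d q (\<lambda>l. if l = k then 1 else 0)"

definition E_mat ::
  "'w measure \<Rightarrow> nat \<Rightarrow> (nat \<Rightarrow> nat) \<Rightarrow> ('w \<Rightarrow> complex mat) \<Rightarrow> nat \<Rightarrow> complex" where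
  "E_mat M d q X k =
     (\<integral>\<omega>. mat_trace (block_proj d q k * X \<omega> * block_proj d q k) \<partial>M) / of_nat (q k)"

subsection \<open>Haar measure on the unitary groups of the blocks\<close>

definition block_unitary :: "nat \<Rightarrow> (nat \<Rightarrow> nat) \<Rightarrow> nat \<Rightarrow> nat \<Rightarrow> complex mat set" where
  "block_unitary d q n k =
     {U. (\<exists>X\<in>carrier_mat n n. U = block_proj d q k * X * block_proj d q k) \<and>
         U * mat_adjoint U = block_proj d q k \<and> mat_adjoint U * U = block_proj d q k}"

text \<open>The Borel $\sigma$-algebra of the space of \<open>n \<times> n\<close> matrices, generated by the entries.\<close>

definition mat_borel :: "nat \<Rightarrow> complex mat measure" where
  "mat_borel n = sigma (carrier_mat n n)
     {{X \<in> carrier_mat n n. X $$ (i, j) \<in> S} | i j S. i < n \<and> j < n \<and> S \<in> sets borel}"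

text \<open>The Haar probability measure of a compact group \<open>G\<close> of matrices, viewed as a measure on
  all matrices that is carried by \<open>G\<close>.\<close>

definition haar_prob :: "nat \<Rightarrow> complex mat set \<Rightarrow> complex mat measure \<Rightarrow> bool" where
  "haar_prob n G \<mu> \<longleftrightarrow> prob_space \<mu> \<and> sets \<mu> = sets (mat_borel n) \<and> (AE U in \<mu>. U \<in> G) \<and>
     (\<forall>W\<in>G. distr \<mu> (mat_borel n) (\<lambda>U. W * U) = \<mu> \<and> distr \<mu> (mat_borel n) (\<lambda>U. U * W) = \<mu>)"

definition uniform_on :: "'w measure \<Rightarrow> nat \<Rightarrow> complex mat set \<Rightarrow> ('w \<Rightarrow> complex mat) \<Rightarrow> bool" where
  "uniform_on M n G V \<longleftrightarrow>
     V \<in> measurable M (mat_borel n) \<and> haar_prob n G (distr M (mat_borel n) V)"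

section \<open>Convergence and asymptotic freeness\<close>

text \<open>\<open>X i n\<close> is the \<open>n \<times> n\<close> random matrix of index \<open>i\<close>, on the probability space \<open>\<Omega> n\<close>.
  Convergence in the finite-dimensional space $\mathcal D$ is convergence of the coordinates.\<close>

definition converges_in_D_distribution ::
  "nat \<Rightarrow> (nat \<Rightarrow> nat \<Rightarrow> nat) \<Rightarrow> (nat \<Rightarrow> 'w measure) \<Rightarrow> 'i set \<Rightarrow>
   ('i \<Rightarrow> nat \<Rightarrow> 'w \<Rightarrow> complex mat) \<Rightarrow>
   'a star_algebra \<Rightarrow> ('a \<Rightarrow> complex) \<Rightarrow> (nat \<Rightarrow> 'a) \<Rightarrow> ('i \<Rightarrow> 'a) \<Rightarrow> bool" where
  "converges_in_D_distribution d q \<Omega> I X A \<phi> p a \<longleftrightarrow>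
     (\<forall>w. w \<noteq> [] \<and> fst ` set w \<subseteq> I \<longrightarrow>
       (\<forall>k\<in>{1..d}.
         (\<lambda>n. E_mat (\<Omega> n) d (q n)
                (\<lambda>\<omega>. word_val (mat_alg n) (D_mat d (q n)) (\<lambda>i. X i n \<omega>) w) k)
         \<longlonglongrightarrow> E_coord A \<phi> p (word_val A (D_elem A d p) a w) k))"

text \<open>The sets of the family are \<open>{X i n | i \<in> C g}\<close>, \<open>g \<in> G\<close>. The limit family lives in some
  tracial space containing a copy of $\mathcal D$ on which the state has the prescribed values
  \<open>\<rho> k\<close> at the projections. Its elements are taken in the type \<open>nat \<Rightarrow> complex\<close>, which
  serves only as a set with enough elements for any algebra generated by countably many ones;
  the algebra structure on it is arbitrary.\<close>

definition asymptotically_free_over_D ::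
  "nat \<Rightarrow> (nat \<Rightarrow> complex) \<Rightarrow> (nat \<Rightarrow> nat \<Rightarrow> nat) \<Rightarrow> (nat \<Rightarrow> 'w measure) \<Rightarrow>
   'g set \<Rightarrow> ('g \<Rightarrow> 'i set) \<Rightarrow> ('i \<Rightarrow> nat \<Rightarrow> 'w \<Rightarrow> complex mat) \<Rightarrow> bool" where
  "asymptotically_free_over_D d \<rho> q \<Omega> G C X \<longleftrightarrow>
     (\<exists>(A :: (nat \<Rightarrow> complex) star_algebra) \<phi> p a.
        tracial_ncps_over A \<phi> d p \<and> (\<forall>k\<in>{1..d}. \<phi> (p k) = \<rho> k) \<and>
        (\<forall>i\<in>(\<Union>g\<in>G. C g). a i \<in> carrier A) \<and>
        converges_in_D_distribution d q \<Omega> (\<Union>g\<in>G. C g) X A \<phi> p a \<and>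
        free_over_D A \<phi> d p G (\<lambda>g. a ` C g))"

subsection \<open>The matrices \<open>B(j,n)\<close> and \<open>V(s,k,n)\<close> as one family\<close>

datatype mat_index = B_index nat | V_index nat nat

datatype mat_group = B_group | V_group nat nat

definition joint_family ::
  "(nat \<Rightarrow> nat \<Rightarrow> complex mat) \<Rightarrow> (nat \<Rightarrow> nat \<Rightarrow> nat \<Rightarrow> 'w \<Rightarrow> complex mat) \<Rightarrow>
   mat_index \<Rightarrow> nat \<Rightarrow> 'w \<Rightarrow> complex mat" where
  "joint_family B V i n \<omega> = (case i of B_index j \<Rightarrow> B j n | V_index s k \<Rightarrow> V s k n \<omega>)"

definition group_indices :: "mat_group \<Rightarrow> mat_index set" where
  "group_indices g = (case g of B_group \<Rightarrow> range B_index | V_group s k \<Rightarrow> {V_index s k})"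

end

theory Submission
  imports Defs "HOL-Library.Function_Algebras"
begin

text \<open>Applying Cauchy-Schwarz to the two halves of a cyclic word and reflecting (a chessboard estimate)
  bounds its trace by traces of words $(aa^*)^m$ in a single letter. As the letters are partial
  unitaries and constant matrices whose traces converge, all normalized traces are bounded, although
  no bound on the operator norms of the constant matrices is available.

  Left multiplication of a Haar unitary by $e^{tK}$, with $K$ anti-Hermitian and $K^3=-K$, leaves the
  joint law unchanged; differentiating at $t=0$ gives a Schwinger-Dyson equation, which holds for
  every matrix unit of the block in place of $K$ by linearity. Call a word reduced if each constant
  between mutually inverse letters has asymptotically vanishing trace on their block. Summing the
  equation over matrix units expresses $\mathbb E\,|\mathrm{tr}|^2$ of a reduced word by products of
  traces, each of which contains a factor that is shorter and reduced, up to terms of order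
  $n^{-2}$; induction on the length shows that it tends to $0$. Splitting each constant into a
  centered part and a multiple of the projection, one gets convergence in probability of the traces of
  all words.

  The limit of the normalized traces is a tracial functional on sequences of random matrices, and the
  limit space is the quotient by its kernel. Centered elements of the subalgebras are combinations of
  centered constants and of nontrivial powers of the unitaries, so an alternating product is a
  combination of reduced words, for which the limit is $0$.\<close>

section \<open>Finitely supported matrices\<close>

text \<open>Convergence in probability has to be controlled, not only convergence of means: each
  term of the Schwinger-Dyson equation is the mean of a product of normalized traces, and smallness
  of the mean of one factor says nothing about the product. If one factor is small in L^1 and the
  others are bounded almost surely, uniformly in n, then the product is small. This is why the bound
  on all traces precedes the induction, and why the induction runs on second moments, with the
  adjoint word in the second trace. Directions with K^3 = -K are chosen because e^{tK} is then a
  polynomial in K with coefficients sin t and 1 - cos t: no matrix exponential has to be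
  constructed, and remainders are explicitly of order t^2. Relations between the unitaries hold only
  almost surely and for n \<ge> d. Algebraic identities are therefore asserted on the event
  \<open>good\<close> for these n, and become equalities in the quotient.\<close>

definition mat_bounded :: "nat \<Rightarrow> (nat \<Rightarrow> nat \<Rightarrow> complex) \<Rightarrow> bool" where
  "mat_bounded n A \<longleftrightarrow> (\<forall>i j. A i j \<noteq> 0 \<longrightarrow> i < n \<and> j < n)"

lemma mat_bounded_mono: "mat_bounded m A \<Longrightarrow> m \<le> n \<Longrightarrow> mat_bounded n A"
  unfolding mat_bounded_def by (meson less_le_trans)

text \<open>One type contains the square matrices of all sizes, so that products are governed by a
  ring class without carriers. The price is the absence of a unit: the identity of size n becomes
  \<open>dproj {..<n}\<close>, and \<open>dimb n\<close> records that a matrix lives in the upper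
  left n by n corner.\<close>

typedef fmat = "{A. \<exists>n. mat_bounded n A}"
  morphisms ent Fmat
  by (rule exI[of _ "\<lambda>_ _. 0"]) (auto simp: mat_bounded_def)

setup_lifting type_definition_fmat

definition dimb :: "nat \<Rightarrow> fmat \<Rightarrow> bool" where
  "dimb n A \<longleftrightarrow> mat_bounded n (ent A)"

lemma dimbD: "dimb n A \<Longrightarrow> ent A i j \<noteq> 0 \<Longrightarrow> i < n \<and> j < n"
  by (auto simp: dimb_def mat_bounded_def)

lemma dimb_zero: "dimb n A \<Longrightarrow> \<not> (i < n \<and> j < n) \<Longrightarrow> ent A i j = 0"
  using dimbD by blast

lemma dimbI: "(\<And>i j. \<not> (i < n \<and> j < n) \<Longrightarrow> ent A i j = 0) \<Longrightarrow> dimb n A"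
  by (auto simp: dimb_def mat_bounded_def)

lemma dimb_ex: "\<exists>n. dimb n A"
  using ent[of A] by (auto simp: dimb_def)

lemma dimb_mono: "dimb m A \<Longrightarrow> m \<le> n \<Longrightarrow> dimb n A"
  unfolding dimb_def by (rule mat_bounded_mono)

lemma dimb_ex2: obtains n where "dimb n A" "dimb n B"
proof -
  obtain m k where "dimb m A" "dimb k B" using dimb_ex by blast
  then show ?thesis using that[of "max m k"] by (meson dimb_mono max.cobounded1 max.cobounded2)
qed

lemma dimb_ex3: obtains n where "dimb n A" "dimb n B" "dimb n C"
proof -
  obtain m where m: "dimb m A" "dimb m B" by (rule dimb_ex2)
  obtain k where k: "dimb k C" using dimb_ex by blast
  show ?thesis using that[of "max m k"] m k
    by (meson dimb_mono max.cobounded1 max.cobounded2)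
qed

lemma fmat_eqI: "(\<And>i j. ent A i j = ent B i j) \<Longrightarrow> A = B"
  by (metis ent_inject ext)

instantiation fmat :: ab_group_add
begin

lift_definition zero_fmat :: fmat is "\<lambda>_ _. 0"
  by (auto simp: mat_bounded_def)

lift_definition plus_fmat :: "fmat \<Rightarrow> fmat \<Rightarrow> fmat" is "\<lambda>A B i j. A i j + B i j"
proof -
  fix A B :: "nat \<Rightarrow> nat \<Rightarrow> complex"
  assume "\<exists>n. mat_bounded n A" "\<exists>n. mat_bounded n B"
  then obtain m n where "mat_bounded m A" "mat_bounded n B" by blast
  then have "mat_bounded (max m n) A" "mat_bounded (max m n) B"
    by (auto intro: mat_bounded_mono)
  then have "mat_bounded (max m n) (\<lambda>i j. A i j + B i j)"
    unfolding mat_bounded_def by (metis add.right_neutral add_0)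
  then show "\<exists>n. mat_bounded n (\<lambda>i j. A i j + B i j)" by blast
qed

lift_definition uminus_fmat :: "fmat \<Rightarrow> fmat" is "\<lambda>A i j. - A i j"
  by (auto simp: mat_bounded_def)

definition minus_fmat :: "fmat \<Rightarrow> fmat \<Rightarrow> fmat" where "minus_fmat A B = A + - B"

instance
  by standard (transfer; auto simp: fun_eq_iff minus_fmat_def)+

end

lemma ent_0 [simp]: "ent 0 i j = 0"
  by transfer simp

lemma ent_add [simp]: "ent (A + B) i j = ent A i j + ent B i j"
  by transfer simp

lemma ent_uminus [simp]: "ent (- A) i j = - ent A i j"
  by transfer simp

lemma ent_diff [simp]: "ent (A - B) i j = ent A i j - ent B i j"
  by (simp only: minus_fmat_def ent_add ent_uminus) simp

lemma ent_sum [simp]: "ent (sum f S) i j = (\<Sum>x\<in>S. ent (f x) i j)"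
  by (induction S rule: infinite_finite_induct) auto

instantiation fmat :: ring
begin

text \<open>Summing over the support of row i makes the product independent of any chosen size; for
  finitely supported matrices this set is finite, so the sum is the ordinary one.\<close>

lift_definition times_fmat :: "fmat \<Rightarrow> fmat \<Rightarrow> fmat"
  is "\<lambda>A B i j. \<Sum>l\<in>{l. A i l \<noteq> 0}. A i l * B l j"
proof -
  fix A B :: "nat \<Rightarrow> nat \<Rightarrow> complex"
  assume "\<exists>n. mat_bounded n A" "\<exists>n. mat_bounded n B"
  then obtain m n where "mat_bounded m A" "mat_bounded n B" by blast
  then have "mat_bounded (max m n) A" "mat_bounded (max m n) B"
    by (auto intro: mat_bounded_mono)
  then have "mat_bounded (max m n) (\<lambda>i j. \<Sum>l\<in>{l. A i l \<noteq> 0}. A i l * B l j)"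
    unfolding mat_bounded_def
    by (smt (verit) mem_Collect_eq mult_not_zero sum.not_neutral_contains_not_neutral)
  then show "\<exists>n. mat_bounded n (\<lambda>i j. \<Sum>l\<in>{l. A i l \<noteq> 0}. A i l * B l j)" by blast
qed

lemma ent_mult_left:
  assumes "dimb n A" shows "ent (A * B) i j = (\<Sum>l<n. ent A i l * ent B l j)"
  unfolding times_fmat.rep_eq
  by (rule sum.mono_neutral_left) (use dimbD[OF assms] in auto)

lemma ent_mult_right:
  assumes "dimb n B" shows "ent (A * B) i j = (\<Sum>l<n. ent A i l * ent B l j)"
proof -
  obtain m where m: "dimb m A" using dimb_ex by blast
  have "ent (A * B) i j = (\<Sum>l<max m n. ent A i l * ent B l j)"
    by (rule ent_mult_left) (use m dimb_mono in auto)
  also have "\<dots> = (\<Sum>l<n. ent A i l * ent B l j)"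
    by (rule sum.mono_neutral_right) (use dimb_zero[OF assms] in auto)
  finally show ?thesis .
qed

instance
proof
  fix A B C :: fmat
  obtain n where n: "dimb n A" "dimb n B" "dimb n C" by (rule dimb_ex3)
  show "A * B * C = A * (B * C)"
  proof (rule fmat_eqI)
    fix i j
    have "ent (A * B * C) i j = (\<Sum>k<n. (\<Sum>l<n. ent A i l * ent B l k) * ent C k j)"
      by (simp add: ent_mult_right[OF n(3)] ent_mult_left[OF n(1)])
    also have "\<dots> = (\<Sum>l<n. ent A i l * (\<Sum>k<n. ent B l k * ent C k j))"
      unfolding sum_distrib_right sum_distrib_left
      by (subst sum.swap) (simp add: mult.assoc)
    also have "\<dots> = ent (A * (B * C)) i j"
      by (simp add: ent_mult_right[OF n(3)] ent_mult_left[OF n(1)])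
    finally show "ent (A * B * C) i j = ent (A * (B * C)) i j" .
  qed
  show "(A + B) * C = A * C + B * C"
    by (rule fmat_eqI) (simp add: ent_mult_right[OF n(3)] algebra_simps sum.distrib)
  show "A * (B + C) = A * B + A * C"
    by (rule fmat_eqI) (simp add: ent_mult_left[OF n(1)] algebra_simps sum.distrib)
qed

end

section \<open>Involution, scalar multiples and size bounds\<close>

lift_definition star_fmat :: "fmat \<Rightarrow> fmat" is "\<lambda>A i j. cnj (A j i)"
  unfolding mat_bounded_def by (metis complex_cnj_zero)

lift_definition sc :: "complex \<Rightarrow> fmat \<Rightarrow> fmat" is "\<lambda>c A i j. c * A i j"
  unfolding mat_bounded_def by (metis mult_zero_right)

lift_definition fm :: "nat \<Rightarrow> (nat \<Rightarrow> nat \<Rightarrow> complex) \<Rightarrow> fmat" is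
  "\<lambda>n f i j. if i < n \<and> j < n then f i j else 0"
  by (auto simp: mat_bounded_def)

lemma ent_star [simp]: "ent (star_fmat A) i j = cnj (ent A j i)"
  by transfer simp

lemma ent_sc [simp]: "ent (sc c A) i j = c * ent A i j"
  by transfer simp

lemma ent_fm [simp]: "ent (fm n f) i j = (if i < n \<and> j < n then f i j else 0)"
  by transfer simp

lemma dimb_simps [simp]:
  "dimb n 0" "dimb n A \<Longrightarrow> dimb n B \<Longrightarrow> dimb n (A + B)" "dimb n A \<Longrightarrow> dimb n (- A)"
  "dimb n A \<Longrightarrow> dimb n B \<Longrightarrow> dimb n (A - B)" "dimb n A \<Longrightarrow> dimb n (star_fmat A)"
  "dimb n A \<Longrightarrow> dimb n (sc c A)" "dimb n (fm n f)"
  by (rule dimbI; auto simp: dimb_zero)+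

lemma dimb_mult [simp]:
  assumes "dimb n A" "dimb n B" shows "dimb n (A * B)"
  by (rule dimbI) (auto simp: ent_mult_left[OF assms(1)] dimb_zero[OF assms(1)] dimb_zero[OF assms(2)])

lemma dimb_sum: "(\<And>x. x \<in> S \<Longrightarrow> dimb n (f x)) \<Longrightarrow> dimb n (sum f S)"
  by (induction S rule: infinite_finite_induct) auto

lemma star_star_fmat [simp]: "star_fmat (star_fmat A) = A"
  by (rule fmat_eqI) simp

lemma star_add_fmat: "star_fmat (A + B) = star_fmat A + star_fmat B"
  by (rule fmat_eqI) simp

lemma star_sc: "star_fmat (sc c A) = sc (cnj c) (star_fmat A)"
  by (rule fmat_eqI) simp

lemma star_mult_fmat: "star_fmat (A * B) = star_fmat B * star_fmat A"
proof (rule fmat_eqI)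
  fix i j
  obtain n where n: "dimb n A" "dimb n B" by (rule dimb_ex2)
  show "ent (star_fmat (A * B)) i j = ent (star_fmat B * star_fmat A) i j"
    by (simp add: ent_mult_left[OF n(1)] ent_mult_right[of n "star_fmat A"] n mult.commute)
qed

lemma star_zero_fmat [simp]: "star_fmat 0 = 0"
  by (rule fmat_eqI) simp

lemma star_minus_fmat: "star_fmat (A - B) = star_fmat A - star_fmat B"
  by (rule fmat_eqI) simp

lemma sc_mult_left: "sc c A * B = sc c (A * B)"
proof (rule fmat_eqI)
  fix i j
  obtain n where n: "dimb n A" "dimb n B" by (rule dimb_ex2)
  show "ent (sc c A * B) i j = ent (sc c (A * B)) i j"
    by (simp add: ent_mult_right[OF n(2)] sum_distrib_left mult.assoc)
qed

lemma sc_mult_right: "A * sc c B = sc c (A * B)"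
proof (rule fmat_eqI)
  fix i j
  obtain n where n: "dimb n A" "dimb n B" by (rule dimb_ex2)
  show "ent (A * sc c B) i j = ent (sc c (A * B)) i j"
    by (simp add: ent_mult_left[OF n(1)] sum_distrib_left algebra_simps)
qed

lemma sc_add_right: "sc c (A + B) = sc c A + sc c B"
  and sc_add_left: "sc (a + b) A = sc a A + sc b A"
  and sc_sc: "sc a (sc b A) = sc (a * b) A"
  and sc_one [simp]: "sc 1 A = A"
  and sc_zero_left [simp]: "sc 0 A = 0"
  and sc_zero_right [simp]: "sc c 0 = 0"
  and sc_uminus: "sc (- 1) A = - A"
  by (rule fmat_eqI; simp add: algebra_simps)+

subsection \<open>The trace\<close>

definition Tr :: "fmat \<Rightarrow> complex" where
  "Tr A = (\<Sum>i\<in>{i. ent A i i \<noteq> 0}. ent A i i)"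

lemma Tr_eq: assumes "dimb n A" shows "Tr A = (\<Sum>i<n. ent A i i)"
  unfolding Tr_def by (rule sum.mono_neutral_left) (use dimbD[OF assms] in auto)

lemma Tr_add: "Tr (A + B) = Tr A + Tr B"
proof -
  obtain n where n: "dimb n A" "dimb n B" by (rule dimb_ex2)
  show ?thesis by (simp add: Tr_eq[of n] n sum.distrib)
qed

lemma Tr_zero [simp]: "Tr 0 = 0"
  by (simp add: Tr_def)

lemma Tr_sc: "Tr (sc c A) = c * Tr A"
proof -
  obtain n where n: "dimb n A" using dimb_ex by blast
  show ?thesis by (simp add: Tr_eq[of n] n sum_distrib_left)
qed

lemma Tr_uminus: "Tr (- A) = - Tr A"
  using Tr_sc[of "-1" A] by (simp add: sc_uminus)

lemma Tr_sum: "Tr (sum f S) = (\<Sum>x\<in>S. Tr (f x))"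
  by (induction S rule: infinite_finite_induct) (auto simp: Tr_add)

lemma Tr_star: "Tr (star_fmat A) = cnj (Tr A)"
proof -
  obtain n where n: "dimb n A" using dimb_ex by blast
  show ?thesis by (simp add: Tr_eq[of n] n)
qed

lemma Tr_mult_eq:
  assumes "dimb n A" "dimb n B"
  shows "Tr (A * B) = (\<Sum>i<n. \<Sum>l<n. ent A i l * ent B l i)"
  by (simp add: Tr_eq[of n] assms ent_mult_left[OF assms(1)])

lemma Tr_commute: "Tr (A * B) = Tr (B * A)"
proof -
  obtain n where n: "dimb n A" "dimb n B" by (rule dimb_ex2)
  show ?thesis
    unfolding Tr_mult_eq[OF n] Tr_mult_eq[OF n(2,1)]
    by (subst sum.swap) (simp add: mult.commute)
qed

text \<open>This is the squared Hilbert-Schmidt norm, the source both of Cauchy-Schwarz and of the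
  positivity of the limit functional.\<close>

lemma Tr_mult_star:
  assumes "dimb n A"
  shows "Tr (A * star_fmat A) = of_real (\<Sum>(i, l)\<in>{..<n} \<times> {..<n}. (cmod (ent A i l))\<^sup>2)"
  unfolding Tr_mult_eq[OF assms dimb_simps(5)[OF assms]] of_real_sum sum.cartesian_product
  by (auto intro!: sum.cong simp: complex_norm_square simp del: of_real_power)

lemma Tr_mult_star_nonneg:
  "Tr (A * star_fmat A) = of_real (Re (Tr (A * star_fmat A)))" "0 \<le> Re (Tr (A * star_fmat A))"
proof -
  obtain n where n: "dimb n A" using dimb_ex by blast
  show "Tr (A * star_fmat A) = of_real (Re (Tr (A * star_fmat A)))"
    unfolding Tr_mult_star[OF n] by simp
  show "0 \<le> Re (Tr (A * star_fmat A))"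
    unfolding Tr_mult_star[OF n] Re_complex_of_real by (rule sum_nonneg) auto
qed

text \<open>Cauchy-Schwarz for the Hilbert-Schmidt inner product of A with the adjoint of B. The
  entries of B appear transposed in \<open>?g\<close> because of the way B enters the trace.\<close>

lemma Tr_Cauchy_Schwarz:
  "(cmod (Tr (A * B)))\<^sup>2 \<le> cmod (Tr (A * star_fmat A)) * cmod (Tr (star_fmat B * B))"
proof -
  obtain n where n: "dimb n A" "dimb n B" by (rule dimb_ex2)
  let ?S = "{..<n} \<times> {..<n}"
  let ?f = "\<lambda>(i, l). cmod (ent A i l)" and ?g = "\<lambda>(i, l). cmod (ent B l i)"
  have "cmod (Tr (A * B)) = cmod (\<Sum>(i, l)\<in>?S. ent A i l * ent B l i)"
    by (simp add: Tr_mult_eq[OF n] sum.cartesian_product)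
  also have "\<dots> \<le> (\<Sum>x\<in>?S. \<bar>?f x\<bar> * \<bar>?g x\<bar>)"
    by (rule sum_norm_le) (auto simp: norm_mult)
  also have "\<dots> \<le> L2_set ?f ?S * L2_set ?g ?S"
    by (rule L2_set_mult_ineq)
  finally have "(cmod (Tr (A * B)))\<^sup>2 \<le> (L2_set ?f ?S * L2_set ?g ?S)\<^sup>2"
    by (rule power_mono) simp
  also have "\<dots> = (\<Sum>x\<in>?S. (?f x)\<^sup>2) * (\<Sum>x\<in>?S. (?g x)\<^sup>2)"
    by (simp add: power_mult_distrib L2_set_def sum_nonneg)
  also have "(\<Sum>x\<in>?S. (?f x)\<^sup>2) = cmod (Tr (A * star_fmat A))"
    by (simp add: Tr_mult_star[OF n(1)] case_prod_beta sum_nonneg del: of_real_sum)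
  also have "(\<Sum>x\<in>?S. (?g x)\<^sup>2) = cmod (Tr (star_fmat B * B))"
  proof -
    have "(\<Sum>x\<in>?S. (?g x)\<^sup>2) = (\<Sum>x\<in>?S. (cmod (ent (star_fmat B) (fst x) (snd x)))\<^sup>2)"
      by (simp add: case_prod_beta)
    also have "\<dots> = cmod (Tr (star_fmat B * star_fmat (star_fmat B)))"
      by (simp only: Tr_mult_star[OF dimb_simps(5)[OF n(2)]] case_prod_beta norm_of_real)
         (subst abs_of_nonneg, auto intro!: sum_nonneg simp: case_prod_beta)
    finally show ?thesis by simp
  qed
  finally show ?thesis .
qed

subsection \<open>Matrix units\<close>

definition mu :: "nat \<Rightarrow> nat \<Rightarrow> fmat" where
  "mu a b = fm (Suc (max a b)) (\<lambda>i j. if i = a \<and> j = b then 1 else 0)"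

lemma ent_mu [simp]: "ent (mu a b) i j = (if i = a \<and> j = b then 1 else 0)"
  by (auto simp: mu_def)

lemma dimb_mu: "a < n \<Longrightarrow> b < n \<Longrightarrow> dimb n (mu a b)"
  by (rule dimbI) auto

lemma ent_mu_mult: "ent (mu a b * A) i j = (if i = a then ent A b j else 0)"
proof -
  have d: "dimb (Suc (max a b)) (mu a b)" by (rule dimb_mu) auto
  have "(\<Sum>l<Suc (max a b). ent (mu a b) i l * ent A l j)
      = (\<Sum>l<Suc (max a b). if l = b then if i = a then ent A l j else 0 else 0)"
    by (rule sum.cong) auto
  also have "\<dots> = (if i = a then ent A b j else 0)"
    by (subst sum.delta) (auto simp: less_Suc_eq_le)
  finally show ?thesis by (simp add: ent_mult_left[OF d])
qed

lemma star_mu: "star_fmat (mu a b) = mu b a"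
  by (rule fmat_eqI) auto

lemma mu_mult_mu: "mu a b * mu c d = (if b = c then mu a d else 0)"
  by (rule fmat_eqI) (auto simp: ent_mu_mult)

lemma ent_mult_mu: "ent (A * mu a b) i j = (if j = b then ent A i a else 0)"
proof -
  have "ent (A * mu a b) i j = cnj (ent (star_fmat (A * mu a b)) j i)" by simp
  also have "\<dots> = cnj (ent (mu b a * star_fmat A) j i)" by (simp add: star_mult_fmat star_mu)
  finally show ?thesis by (simp add: ent_mu_mult)
qed

lemma ent_mult_mu_mult: "ent (A * (mu a b * B)) i j = ent A i a * ent B b j"
proof -
  obtain n where n: "dimb n A" "dimb n (mu a b)" by (rule dimb_ex2)
  then have a: "a < n" using dimbD[of n "mu a b" a b] by simp
  have "ent (A * (mu a b * B)) i j = (\<Sum>l<n. if l = a then ent A i l * ent B b j else 0)"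
    by (simp add: ent_mult_left[OF n(1)] ent_mu_mult if_distrib cong: if_cong)
  then show ?thesis using a by simp
qed

lemma Tr_mu_mult: "Tr (mu a b * A) = ent A b a"
proof -
  obtain n where n: "dimb n (mu a b)" "dimb n A" by (rule dimb_ex2)
  then have ab: "a < n" using dimbD[of n "mu a b" a b] by simp
  have "Tr (mu a b * A) = (\<Sum>i<n. if i = a then ent A b i else 0)"
    by (simp add: Tr_eq[of n] n ent_mu_mult)
  also have "\<dots> = ent A b a" using ab by simp
  finally show ?thesis .
qed

section \<open>Coordinate projections and contractions over matrix units\<close>

definition dproj :: "nat set \<Rightarrow> fmat" where
  "dproj S = (\<Sum>i\<in>S. mu i i)"

lemma ent_dproj: "finite S \<Longrightarrow> ent (dproj S) i j = (if i = j \<and> i \<in> S then 1 else 0)"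
  by (auto simp: dproj_def intro!: sum.neutral)

lemma dproj_mult: 
  assumes "finite S" shows "ent (dproj S * A) i j = (if i \<in> S then ent A i j else 0)"
  using assms by (simp add: dproj_def sum_distrib_right ent_mu_mult)

lemma mult_dproj: 
  assumes "finite S" shows "ent (A * dproj S) i j = (if j \<in> S then ent A i j else 0)"
  using assms by (simp add: dproj_def sum_distrib_left ent_mult_mu)

lemma dproj_dproj: "finite S \<Longrightarrow> finite T \<Longrightarrow> dproj S * dproj T = dproj (S \<inter> T)"
  by (rule fmat_eqI) (auto simp: dproj_mult ent_dproj)

lemma star_dproj: "finite S \<Longrightarrow> star_fmat (dproj S) = dproj S"
  by (rule fmat_eqI) (auto simp: ent_dproj)

lemma dimb_dproj: "S \<subseteq> {..<n} \<Longrightarrow> dimb n (dproj S)"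
  unfolding dproj_def by (rule dimb_sum) (auto intro!: dimb_mu)

lemma dproj_mult_id: "dimb n A \<Longrightarrow> dproj {..<n} * A = A" "dimb n A \<Longrightarrow> A * dproj {..<n} = A"
  by (rule fmat_eqI; auto simp: dproj_mult mult_dproj dimb_zero)+

lemma Tr_dproj: "Tr (dproj S) = of_nat (card S)"
proof -
  have "Tr (mu i i) = 1" for i
    using Tr_mu_mult[of i i "mu i i"] by (simp add: mu_mult_mu)
  then show ?thesis by (simp add: dproj_def Tr_sum)
qed

lemma Tr_dproj_mult: assumes "finite S" shows "Tr (dproj S * A) = (\<Sum>i\<in>S. ent A i i)"
  by (simp add: dproj_def sum_distrib_right Tr_sum Tr_mu_mult)

text \<open>The sum over i, j in S of E_ji X E_ij equals Tr(PX) P with P = \<open>dproj S\<close>.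
  Two matrix units in one trace therefore break it into two traces.\<close>

lemma sum_mu_split:
  assumes "finite S"
  shows "(\<Sum>i\<in>S. \<Sum>j\<in>S. Tr (mu j i * X * mu i j * Y)) = Tr (dproj S * X) * Tr (dproj S * Y)"
proof -
  have "Tr (mu j i * X * mu i j * Y) = ent X i i * ent Y j j" for i j
    by (simp add: mult.assoc Tr_mu_mult ent_mult_mu_mult)
  then show ?thesis
    by (simp add: Tr_dproj_mult assms sum_product)
qed

text \<open>The dual contraction: since Tr(E_ji X) = X_ij and Tr(E_ij Y) = Y_ji, matrix units in two
  different traces glue these into one. Such terms have fewer traces and turn out to be
  negligible.\<close>

lemma sum_mu_merge:
  assumes "finite S"
  shows "(\<Sum>i\<in>S. \<Sum>j\<in>S. Tr (mu j i * X) * Tr (mu i j * Y)) = Tr (dproj S * X * dproj S * Y)"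
proof -
  have "Tr (dproj S * X * dproj S * Y) = (\<Sum>i\<in>S. \<Sum>j\<in>S. Tr (mu i i * X * mu j j * Y))"
    by (simp add: dproj_def sum_distrib_left sum_distrib_right Tr_sum) (rule sum.swap)
  moreover have "Tr (mu i i * X * mu j j * Y) = ent X i j * ent Y j i" for i j
    by (simp add: mult.assoc Tr_mu_mult ent_mult_mu_mult)
  ultimately show ?thesis by (simp add: Tr_mu_mult)
qed

section \<open>A chessboard estimate for traces of words\<close>

text \<open>Products of nonempty lists only, as the rings used here have no unit; the value on the
  empty list is left unspecified.\<close>

fun nprod :: "'a::semigroup_mult list \<Rightarrow> 'a" where
  "nprod [x] = x"
| "nprod (x # y # r) = x * nprod (y # r)"

lemma nprod_Cons: "r \<noteq> [] \<Longrightarrow> nprod (x # r) = x * nprod r"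
  by (cases r) auto

lemma nprod_append: "u \<noteq> [] \<Longrightarrow> v \<noteq> [] \<Longrightarrow> nprod (u @ v) = nprod u * nprod v"
proof (induction u)
  case (Cons x u)
  then show ?case by (cases u) (auto simp: nprod_Cons mult.assoc)
qed simp

text \<open>Repeated reflection: each stage appends the reversed word with every letter
  starred.\<close>

fun doubled :: "('x \<Rightarrow> 'x) \<Rightarrow> nat \<Rightarrow> 'x \<Rightarrow> 'x list" where
  "doubled st 0 x = [x]"
| "doubled st (Suc k) x = doubled st k x @ rev (map st (doubled st k x))"

lemma length_doubled [simp]: "length (doubled st k x) = 2 ^ k"
  by (induction k) auto

text \<open>Only cyclicity and Cauchy-Schwarz for a cut into two pieces are assumed of
  \<open>f\<close>. Of the two reflected halves of a maximal word one is bounded by the same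
  maximum, which can be divided out, so the other is maximal again. Each reflection doubles the
  prefix built from a single letter; after k of them this prefix is the whole word.\<close>

lemma chessboard:
  fixes f :: "'x list \<Rightarrow> complex"
  assumes fin: "finite S" and st: "\<And>x. x \<in> S \<Longrightarrow> st x \<in> S"
    and rot: "\<And>u v. set u \<subseteq> S \<Longrightarrow> set v \<subseteq> S \<Longrightarrow> f (u @ v) = f (v @ u)"
    and cs: "\<And>u v. u \<noteq> [] \<Longrightarrow> v \<noteq> [] \<Longrightarrow> set u \<subseteq> S \<Longrightarrow> set v \<subseteq> S \<Longrightarrow>
      (cmod (f (u @ v)))\<^sup>2 \<le> cmod (f (u @ rev (map st u))) * cmod (f (rev (map st v) @ v))"
    and xs: "set xs \<subseteq> S" "length xs = 2 ^ k"
  shows "\<exists>x\<in>S. cmod (f xs) \<le> cmod (f (doubled st k x))"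
proof -
  define W where "W = {ys. set ys \<subseteq> S \<and> length ys = 2 ^ k}"
  define M where "M = Max ((\<lambda>ys. cmod (f ys)) ` W)"
  have finW: "finite W" unfolding W_def by (rule finite_lists_length_eq[OF fin])
  have xsW: "xs \<in> W" using xs by (simp add: W_def)
  have le_M: "cmod (f ys) \<le> M" if "ys \<in> W" for ys
    unfolding M_def using that finW by simp
  have "M \<in> (\<lambda>ys. cmod (f ys)) ` W"
    unfolding M_def using finW xsW by (intro Max_in) auto
  then obtain y0 where y0: "y0 \<in> W" "cmod (f y0) = M" by auto
  \<comment> \<open>a maximal word stays maximal when it is reflected about the end of its first half\<close>
  have "\<exists>x\<in>S. \<exists>r. doubled st j x @ r \<in> W \<and> M \<le> cmod (f (doubled st j x @ r))" if "j \<le> k" for j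
    using that
  proof (induction j)
    case 0
    obtain x r where "y0 = x # r" using y0(1) by (cases y0) (auto simp: W_def)
    then show ?case using y0 by (auto simp: W_def intro!: bexI[of _ x] exI[of _ r])
  next
    case (Suc j)
    then obtain x r where x: "x \<in> S" and w: "doubled st j x @ r \<in> W"
      and ge: "M \<le> cmod (f (doubled st j x @ r))" by auto
    let ?a = "doubled st j x" and ?h = "2 ^ (k - 1) :: nat"
    have k: "k = Suc (k - 1)" using Suc.prems by simp
    have twok: "(2::nat) ^ k = ?h + ?h" by (subst k) simp
    have jh: "(2::nat) ^ j \<le> ?h" using Suc.prems by (intro power_increasing) auto
    have len: "length r = ?h + ?h - 2 ^ j" using w twok by (simp add: W_def) linarith
    define m where "m = ?h"
    define y where "y = drop m r"
    define v where "v = take m r"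
    have r: "r = v @ y" by (simp add: v_def y_def)
    have "?h \<le> length r" using len jh by linarith
    then have lv: "length v = ?h" and ly: "length y = ?h - 2 ^ j"
      using len jh by (simp_all add: v_def y_def m_def del: power_increasing_iff)
    have sets: "set ?a \<subseteq> S" "set v \<subseteq> S" "set y \<subseteq> S"
      using w by (auto simp: W_def r)
    have sst: "set (rev (map st u)) \<subseteq> S" if "set u \<subseteq> S" for u
      using that st by auto
    \<comment> \<open>After rotation the word is cut into \<open>y @ ?a\<close> and
      \<open>v\<close>, both of length \<open>?h\<close>. The doubled prefix stands at the end of
      the first half and so meets its own mirror image.\<close>
    let ?u = "y @ ?a"
    have eq: "f (?a @ r) = f (?u @ v)"
      using rot[of "?a @ v" y] sets by (simp add: r)
    have "M\<^sup>2 \<le> (cmod (f (?u @ v)))\<^sup>2"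
      using ge y0(2) eq by (intro power_mono) auto
    also have "\<dots> \<le> cmod (f (?u @ rev (map st ?u))) * cmod (f (rev (map st v) @ v))"
    proof (rule cs)
      show "v \<noteq> []" using lv by auto
      show "?u \<noteq> []" using length_doubled[of st j x] by (metis append_is_Nil_conv list.size(3) power_not_zero zero_neq_numeral)
    qed (use sets in auto)
    also have "\<dots> \<le> cmod (f (?u @ rev (map st ?u))) * M"
      by (intro mult_left_mono le_M) (use sst[OF sets(2)] sets(2) lv twok in \<open>auto simp: W_def\<close>)
    finally have "M * M \<le> cmod (f (?u @ rev (map st ?u))) * M" by (simp add: power2_eq_square)
    moreover have "M \<ge> 0" using y0(2) norm_ge_zero by metis
    ultimately have ge': "M \<le> cmod (f (?u @ rev (map st ?u)))"
      by (cases "M = 0") auto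
    let ?r' = "rev (map st y) @ y"
    have "f (?u @ rev (map st ?u)) = f (doubled st (Suc j) x @ ?r')"
      using rot[of y "doubled st (Suc j) x @ rev (map st y)"] sets sst[OF sets(3)] sst[OF sets(1)]
      by simp
    moreover have "doubled st (Suc j) x @ ?r' \<in> W"
      using sets sst[OF sets(3)] sst[OF sets(1)] ly jh twok
      by (auto simp: W_def simp del: power_increasing_iff)
    ultimately show ?case using ge' x by metis
  qed
  from this[of k] obtain x r where x: "x \<in> S" and w: "doubled st k x @ r \<in> W"
    and ge: "M \<le> cmod (f (doubled st k x @ r))" by auto
  have "r = []" using w by (simp add: W_def)
  then have "cmod (f xs) \<le> cmod (f (doubled st k x))" using ge le_M[OF xsW] by simp
  then show ?thesis using x by blast
qed

text \<open>For positive k this is x times its adjoint, raised to the power 2^(k-1) by repeated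
  squaring.\<close>

fun starpow :: "nat \<Rightarrow> fmat \<Rightarrow> fmat" where
  "starpow 0 x = x"
| "starpow (Suc k) x = starpow k x * star_fmat (starpow k x)"

lemma nprod_rev_star:
  "u \<noteq> [] \<Longrightarrow> nprod (rev (map star_fmat u)) = star_fmat (nprod u)"
proof (induction u)
  case (Cons x u)
  then show ?case
    by (cases "u = []") (auto simp: nprod_append nprod_Cons star_mult_fmat)
qed simp

lemma nprod_doubled: "nprod (doubled star_fmat k x) = starpow k x"
proof (induction k)
  case (Suc k)
  have ne: "doubled star_fmat k x \<noteq> []"
    by (metis length_doubled list.size(3) power_not_zero zero_neq_numeral)
  then show ?case using Suc by (simp add: nprod_append nprod_rev_star)
qed simp

lemma Tr_word_bound:
  assumes "finite S" "\<And>x. x \<in> S \<Longrightarrow> star_fmat x \<in> S" "set xs \<subseteq> S" "length xs = 2 ^ k"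
  shows "\<exists>x\<in>S. cmod (Tr (nprod xs)) \<le> cmod (Tr (starpow k x))"
proof -
  define f where "f u = Tr (nprod u)" for u
  have "\<exists>x\<in>S. cmod (f xs) \<le> cmod (f (doubled star_fmat k x))"
  proof (rule chessboard[OF assms(1,2) _ _ assms(3,4)])
    fix u v :: "fmat list"
    show "f (u @ v) = f (v @ u)"
      by (cases "u = [] \<or> v = []") (auto simp: f_def nprod_append Tr_commute)
    assume "u \<noteq> []" "v \<noteq> []"
    then show "(cmod (f (u @ v)))\<^sup>2
        \<le> cmod (f (u @ rev (map star_fmat u))) * cmod (f (rev (map star_fmat v) @ v))"
      using Tr_Cauchy_Schwarz[of "nprod u" "nprod v"]
      by (simp add: f_def nprod_append nprod_rev_star)
  qed
  then show ?thesis by (simp add: f_def nprod_doubled)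
qed

section \<open>Bounded and asymptotically vanishing random variables\<close>

text \<open>Only the indices \<open>n \<ge> d\<close> matter, as the probability spaces are unconstrained for the
  other ones.\<close>

locale prob_sequence =
  fixes \<Omega> :: "nat \<Rightarrow> 'w measure" and d :: nat
  assumes prob_space_n: "n \<ge> d \<Longrightarrow> prob_space (\<Omega> n)"
begin

definition bdd :: "(nat \<Rightarrow> 'w \<Rightarrow> complex) \<Rightarrow> bool" where
  "bdd X \<longleftrightarrow> (\<forall>n\<ge>d. X n \<in> borel_measurable (\<Omega> n)) \<and>
     (\<exists>C. \<forall>n\<ge>d. AE \<omega> in \<Omega> n. cmod (X n \<omega>) \<le> C)"

text \<open>For sequences with a uniform almost sure bound, convergence to 0 in L^1 and in
  probability are the same. The bound is part of the definition, so that null sequences form an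
  ideal among the bounded ones.\<close>

definition null :: "(nat \<Rightarrow> 'w \<Rightarrow> complex) \<Rightarrow> bool" where
  "null X \<longleftrightarrow> bdd X \<and> (\<lambda>n. \<integral>\<omega>. cmod (X n \<omega>) \<partial>\<Omega> n) \<longlonglongrightarrow> 0"

definition converges_to :: "(nat \<Rightarrow> 'w \<Rightarrow> complex) \<Rightarrow> complex \<Rightarrow> bool" where
  "converges_to X c \<longleftrightarrow> null (\<lambda>n \<omega>. X n \<omega> - c)"

lemma bddE:
  assumes "bdd X"
  obtains C where "C \<ge> 0" "\<And>n. n \<ge> d \<Longrightarrow> X n \<in> borel_measurable (\<Omega> n)"
    "\<And>n. n \<ge> d \<Longrightarrow> AE \<omega> in \<Omega> n. cmod (X n \<omega>) \<le> C"
proof -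
  obtain C where C: "\<And>n. n \<ge> d \<Longrightarrow> AE \<omega> in \<Omega> n. cmod (X n \<omega>) \<le> C"
    using assms by (auto simp: bdd_def)
  have "AE \<omega> in \<Omega> n. cmod (X n \<omega>) \<le> max C 0" if "n \<ge> d" for n
    using C[OF that] by (auto elim!: eventually_mono)
  then show ?thesis using that[of "max C 0"] assms by (auto simp: bdd_def)
qed

lemma bddI:
  assumes "\<And>n. n \<ge> d \<Longrightarrow> X n \<in> borel_measurable (\<Omega> n)"
    "\<And>n. n \<ge> d \<Longrightarrow> AE \<omega> in \<Omega> n. cmod (X n \<omega>) \<le> C"
  shows "bdd X"
  using assms by (auto simp: bdd_def)

lemma bdd_integrable: "bdd X \<Longrightarrow> n \<ge> d \<Longrightarrow> integrable (\<Omega> n) (X n)"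
  by (elim bddE)
     (rule finite_measure.integrable_const_bound, auto intro: prob_space.finite_measure prob_space_n)

lemma bdd_cong:
  assumes "bdd X" "\<And>n. n \<ge> d \<Longrightarrow> Y n \<in> borel_measurable (\<Omega> n)"
    "\<And>n. n \<ge> d \<Longrightarrow> AE \<omega> in \<Omega> n. X n \<omega> = Y n \<omega>"
  shows "bdd Y"
proof (rule bddE[OF assms(1)])
  fix C assume C: "\<And>n. n \<ge> d \<Longrightarrow> AE \<omega> in \<Omega> n. cmod (X n \<omega>) \<le> C"
  show ?thesis
  proof (rule bddI[OF assms(2)])
    fix n assume n: "n \<ge> d"
    show "AE \<omega> in \<Omega> n. cmod (Y n \<omega>) \<le> C" using C[OF n] assms(3)[OF n] by eventually_elim simp
  qed
qed

lemma bdd_const: "bdd (\<lambda>n \<omega>. c)"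
  by (rule bddI[where C = "cmod c"]) auto

lemma bdd_convergent_const: 
  assumes "convergent c" shows "bdd (\<lambda>n \<omega>. c n)"
proof -
  obtain K where "\<forall>n. cmod (c n) \<le> K"
    using convergent_imp_Bseq[OF assms] by (auto simp: Bseq_def)
  then show ?thesis by (intro bddI[where C = K]) auto
qed

lemma bdd_add: assumes "bdd X" "bdd Y" shows "bdd (\<lambda>n \<omega>. X n \<omega> + Y n \<omega>)"
proof -
  obtain C where C: "C \<ge> 0" "\<And>n. n \<ge> d \<Longrightarrow> X n \<in> borel_measurable (\<Omega> n)"
    "\<And>n. n \<ge> d \<Longrightarrow> AE \<omega> in \<Omega> n. cmod (X n \<omega>) \<le> C" using bddE[OF assms(1)] by blast
  obtain D where D: "D \<ge> 0" "\<And>n. n \<ge> d \<Longrightarrow> Y n \<in> borel_measurable (\<Omega> n)"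
    "\<And>n. n \<ge> d \<Longrightarrow> AE \<omega> in \<Omega> n. cmod (Y n \<omega>) \<le> D" using bddE[OF assms(2)] by blast
  show ?thesis
  proof (rule bddI[where C = "C + D"])
    fix n assume n: "n \<ge> d"
    show "(\<lambda>\<omega>. X n \<omega> + Y n \<omega>) \<in> borel_measurable (\<Omega> n)"
      using C(2)[OF n] D(2)[OF n] by simp
    show "AE \<omega> in \<Omega> n. cmod (X n \<omega> + Y n \<omega>) \<le> C + D"
      using C(3)[OF n] D(3)[OF n] by eventually_elim (rule norm_triangle_le, simp)
  qed
qed

lemma bdd_mult: assumes "bdd X" "bdd Y" shows "bdd (\<lambda>n \<omega>. X n \<omega> * Y n \<omega>)"
proof -
  obtain C where C: "C \<ge> 0" "\<And>n. n \<ge> d \<Longrightarrow> X n \<in> borel_measurable (\<Omega> n)"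
    "\<And>n. n \<ge> d \<Longrightarrow> AE \<omega> in \<Omega> n. cmod (X n \<omega>) \<le> C" using bddE[OF assms(1)] by blast
  obtain D where D: "D \<ge> 0" "\<And>n. n \<ge> d \<Longrightarrow> Y n \<in> borel_measurable (\<Omega> n)"
    "\<And>n. n \<ge> d \<Longrightarrow> AE \<omega> in \<Omega> n. cmod (Y n \<omega>) \<le> D" using bddE[OF assms(2)] by blast
  show ?thesis
  proof (rule bddI[where C = "C * D"])
    fix n assume n: "n \<ge> d"
    show "(\<lambda>\<omega>. X n \<omega> * Y n \<omega>) \<in> borel_measurable (\<Omega> n)"
      using C(2)[OF n] D(2)[OF n] by simp
    show "AE \<omega> in \<Omega> n. cmod (X n \<omega> * Y n \<omega>) \<le> C * D"
      using C(3)[OF n] D(3)[OF n]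
      by eventually_elim (use C(1) in \<open>auto simp: norm_mult intro!: mult_mono\<close>)
  qed
qed

lemma bdd_cnj: assumes "bdd X" shows "bdd (\<lambda>n \<omega>. cnj (X n \<omega>))"
proof (rule bddE[OF assms])
  fix C assume C: "\<And>n. n \<ge> d \<Longrightarrow> X n \<in> borel_measurable (\<Omega> n)"
    "\<And>n. n \<ge> d \<Longrightarrow> AE \<omega> in \<Omega> n. cmod (X n \<omega>) \<le> C"
  have "(\<lambda>\<omega>. cnj (X n \<omega>)) \<in> borel_measurable (\<Omega> n)" if "n \<ge> d" for n
    by (rule measurable_compose[OF C(1)[OF that]])
       (auto intro!: borel_measurable_continuous_onI continuous_intros)
  then show ?thesis using C(2) by (intro bddI[where C = C]) auto
qed

lemma null_bdd: "null X \<Longrightarrow> bdd X"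
  by (simp add: null_def)

lemma null_dominated:
  assumes "null X" "bdd Y" "C \<ge> 0" "\<And>n. n \<ge> d \<Longrightarrow> AE \<omega> in \<Omega> n. cmod (Y n \<omega>) \<le> C * cmod (X n \<omega>)"
  shows "null Y"
proof -
  have "(\<lambda>n. C * (\<integral>\<omega>. cmod (X n \<omega>) \<partial>\<Omega> n)) \<longlonglongrightarrow> C * 0"
    using assms(1) by (intro tendsto_mult tendsto_const) (auto simp: null_def)
  then have lim: "(\<lambda>n. C * (\<integral>\<omega>. cmod (X n \<omega>) \<partial>\<Omega> n)) \<longlonglongrightarrow> 0" by simp
  have "(\<lambda>n. \<integral>\<omega>. cmod (Y n \<omega>) \<partial>\<Omega> n) \<longlonglongrightarrow> 0"
  proof (rule tendsto_sandwich[OF _ _ tendsto_const lim])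
    show "\<forall>\<^sub>F n in sequentially. 0 \<le> (\<integral>\<omega>. cmod (Y n \<omega>) \<partial>\<Omega> n)" by simp
    show "\<forall>\<^sub>F n in sequentially. (\<integral>\<omega>. cmod (Y n \<omega>) \<partial>\<Omega> n) \<le> C * (\<integral>\<omega>. cmod (X n \<omega>) \<partial>\<Omega> n)"
      using eventually_ge_at_top[of d]
    proof eventually_elim
      case (elim n)
      have "(\<integral>\<omega>. cmod (Y n \<omega>) \<partial>\<Omega> n) \<le> (\<integral>\<omega>. C * cmod (X n \<omega>) \<partial>\<Omega> n)"
        using bdd_integrable[OF assms(2) elim] bdd_integrable[OF null_bdd[OF assms(1)] elim] assms(4)[OF elim]
        by (intro integral_mono_AE) auto
      then show ?case by simp
    qed
  qed
  then show ?thesis using assms(2) by (simp add: null_def)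
qed

lemma null_cong:
  assumes "null X" "\<And>n. n \<ge> d \<Longrightarrow> Y n \<in> borel_measurable (\<Omega> n)"
    "\<And>n. n \<ge> d \<Longrightarrow> AE \<omega> in \<Omega> n. X n \<omega> = Y n \<omega>"
  shows "null Y"
proof (rule null_dominated[OF assms(1) bdd_cong[OF null_bdd[OF assms(1)] assms(2,3)], of 1])
  fix n assume "d \<le> n"
  from assms(3)[OF this] show "AE \<omega> in \<Omega> n. cmod (Y n \<omega>) \<le> 1 * cmod (X n \<omega>)"
    by eventually_elim simp
qed simp_all

lemma null_add: assumes "null X" "null Y" shows "null (\<lambda>n \<omega>. X n \<omega> + Y n \<omega>)"
proof -
  have b: "bdd (\<lambda>n \<omega>. X n \<omega> + Y n \<omega>)" using assms by (intro bdd_add null_bdd)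
  have lim: "(\<lambda>n. (\<integral>\<omega>. cmod (X n \<omega>) \<partial>\<Omega> n) + (\<integral>\<omega>. cmod (Y n \<omega>) \<partial>\<Omega> n)) \<longlonglongrightarrow> 0"
    using assms tendsto_add[of _ 0 _ _ 0] by (fastforce simp: null_def)
  have "(\<lambda>n. \<integral>\<omega>. cmod (X n \<omega> + Y n \<omega>) \<partial>\<Omega> n) \<longlonglongrightarrow> 0"
  proof (rule tendsto_sandwich[OF _ _ tendsto_const lim])
    show "\<forall>\<^sub>F n in sequentially. 0 \<le> (\<integral>\<omega>. cmod (X n \<omega> + Y n \<omega>) \<partial>\<Omega> n)" by simp
    show "\<forall>\<^sub>F n in sequentially. (\<integral>\<omega>. cmod (X n \<omega> + Y n \<omega>) \<partial>\<Omega> n)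
        \<le> (\<integral>\<omega>. cmod (X n \<omega>) \<partial>\<Omega> n) + (\<integral>\<omega>. cmod (Y n \<omega>) \<partial>\<Omega> n)"
      using eventually_ge_at_top[of d]
    proof eventually_elim
      case (elim n)
      note i = bdd_integrable[OF null_bdd[OF assms(1)] elim] bdd_integrable[OF null_bdd[OF assms(2)] elim]
      have "(\<integral>\<omega>. cmod (X n \<omega> + Y n \<omega>) \<partial>\<Omega> n) \<le> (\<integral>\<omega>. cmod (X n \<omega>) + cmod (Y n \<omega>) \<partial>\<Omega> n)"
        using i by (intro integral_mono norm_triangle_ineq) auto
      then show ?case using i by simp
    qed
  qed
  then show ?thesis using b by (simp add: null_def)
qed

lemma null_mult: assumes "null X" "bdd Y" shows "null (\<lambda>n \<omega>. X n \<omega> * Y n \<omega>)"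
proof (rule bddE[OF assms(2)])
  fix C assume C: "0 \<le> C" "\<And>n. n \<ge> d \<Longrightarrow> AE \<omega> in \<Omega> n. cmod (Y n \<omega>) \<le> C"
  show ?thesis
  proof (rule null_dominated[OF assms(1) bdd_mult[OF null_bdd[OF assms(1)] assms(2)] C(1)])
    fix n assume "d \<le> n"
    from C(2)[OF this] show "AE \<omega> in \<Omega> n. cmod (X n \<omega> * Y n \<omega>) \<le> C * cmod (X n \<omega>)"
      by eventually_elim (simp add: norm_mult mult_right_mono mult.commute[of C] mult_left_mono)
  qed
qed

lemma null_const_mult: "null X \<Longrightarrow> null (\<lambda>n \<omega>. c * X n \<omega>)"
  using null_mult[OF _ bdd_const[of c]] by (simp add: mult.commute)

lemma null_sum: "(\<And>i. i \<in> I \<Longrightarrow> null (X i)) \<Longrightarrow> null (\<lambda>n \<omega>. \<Sum>i\<in>I. X i n \<omega>)"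
proof (induction I rule: infinite_finite_induct)
  case empty
  show ?case using bdd_const[of 0] by (simp add: null_def)
next
  case (infinite A)
  show ?case using bdd_const[of 0] infinite by (simp add: null_def)
next
  case (insert x F)
  then show ?case using null_add[of "X x"] by simp
qed

lemma null_const: assumes "c \<longlonglongrightarrow> 0" shows "null (\<lambda>n \<omega>. c n)"
proof -
  have "(\<lambda>n. cmod (c n)) \<longlonglongrightarrow> 0" using assms by (simp add: tendsto_norm_zero)
  then have "(\<lambda>n. \<integral>\<omega>. cmod (c n) \<partial>\<Omega> n) \<longlonglongrightarrow> 0"
  proof (rule Lim_transform_eventually)
    show "\<forall>\<^sub>F n in sequentially. cmod (c n) = (\<integral>\<omega>. cmod (c n) \<partial>\<Omega> n)"
      using eventually_ge_at_top[of d] by eventually_elim (simp add: prob_space.prob_space prob_space_n)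
  qed
  then show ?thesis using bdd_convergent_const[of c] assms by (auto simp: null_def convergent_def)
qed

lemma null_integral: assumes "null X" shows "(\<lambda>n. \<integral>\<omega>. X n \<omega> \<partial>\<Omega> n) \<longlonglongrightarrow> 0"
proof (rule Lim_null_comparison)
  show "\<forall>\<^sub>F n in sequentially. norm (\<integral>\<omega>. X n \<omega> \<partial>\<Omega> n) \<le> (\<integral>\<omega>. cmod (X n \<omega>) \<partial>\<Omega> n)" by simp
qed (use assms in \<open>simp add: null_def\<close>)

text \<open>Nonnegativity of the variance of |X| bounds the mean of |X| by the root of the second
  moment, and the second moment is what the Schwinger-Dyson equation computes.\<close>

lemma null_square:
  assumes b: "bdd X" and lim: "(\<lambda>n. \<integral>\<omega>. X n \<omega> * cnj (X n \<omega>) \<partial>\<Omega> n) \<longlonglongrightarrow> 0"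
  shows "null X"
proof -
  have b2: "bdd (\<lambda>n \<omega>. X n \<omega> * cnj (X n \<omega>))" by (intro bdd_mult bdd_cnj b)
  have "(\<lambda>n. sqrt (cmod (\<integral>\<omega>. X n \<omega> * cnj (X n \<omega>) \<partial>\<Omega> n))) \<longlonglongrightarrow> sqrt 0"
    by (intro tendsto_real_sqrt tendsto_norm_zero lim)
  then have l: "(\<lambda>n. sqrt (cmod (\<integral>\<omega>. X n \<omega> * cnj (X n \<omega>) \<partial>\<Omega> n))) \<longlonglongrightarrow> 0" by simp
  have "(\<lambda>n. \<integral>\<omega>. cmod (X n \<omega>) \<partial>\<Omega> n) \<longlonglongrightarrow> 0"
  proof (rule tendsto_sandwich[OF _ _ tendsto_const l])
    show "\<forall>\<^sub>F n in sequentially. 0 \<le> (\<integral>\<omega>. cmod (X n \<omega>) \<partial>\<Omega> n)" by simp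
    show "\<forall>\<^sub>F n in sequentially. (\<integral>\<omega>. cmod (X n \<omega>) \<partial>\<Omega> n)
        \<le> sqrt (cmod (\<integral>\<omega>. X n \<omega> * cnj (X n \<omega>) \<partial>\<Omega> n))"
      using eventually_ge_at_top[of d]
    proof eventually_elim
      case (elim n)
      interpret prob_space "\<Omega> n" by (rule prob_space_n[OF elim])
      have i: "integrable (\<Omega> n) (\<lambda>\<omega>. cmod (X n \<omega>))" using bdd_integrable[OF b elim] by simp
      have i2: "integrable (\<Omega> n) (\<lambda>\<omega>. (cmod (X n \<omega>))\<^sup>2)"
        using integrable_norm[OF bdd_integrable[OF b2 elim]] by (simp add: norm_mult power2_eq_square)
      have eq: "(\<integral>\<omega>. X n \<omega> * cnj (X n \<omega>) \<partial>\<Omega> n) = of_real (\<integral>\<omega>. (cmod (X n \<omega>))\<^sup>2 \<partial>\<Omega> n)"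
        by (simp add: complex_norm_square[symmetric] del: of_real_power)
      have "(\<integral>\<omega>. cmod (X n \<omega>) \<partial>\<Omega> n)\<^sup>2 \<le> (\<integral>\<omega>. (cmod (X n \<omega>))\<^sup>2 \<partial>\<Omega> n)"
        using variance_positive[of "\<lambda>\<omega>. cmod (X n \<omega>)"] variance_eq[OF i i2] by simp
      then show ?case
        unfolding eq norm_of_real by (intro real_le_rsqrt) auto
    qed
  qed
  then show ?thesis using b by (simp add: null_def)
qed

lemma converges_to_bdd: assumes "converges_to X c" shows "bdd X"
  using bdd_add[OF null_bdd bdd_const[of c]] assms by (fastforce simp: converges_to_def)

lemma converges_to_integral:
  assumes "converges_to X c" shows "(\<lambda>n. \<integral>\<omega>. X n \<omega> \<partial>\<Omega> n) \<longlonglongrightarrow> c"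
proof -
  have "(\<lambda>n. (\<integral>\<omega>. X n \<omega> - c \<partial>\<Omega> n) + c) \<longlonglongrightarrow> 0 + c"
    by (intro tendsto_add tendsto_const null_integral) (use assms in \<open>simp add: converges_to_def\<close>)
  then have "(\<lambda>n. (\<integral>\<omega>. X n \<omega> - c \<partial>\<Omega> n) + c) \<longlonglongrightarrow> c" by simp
  then show ?thesis
  proof (rule Lim_transform_eventually)
    show "\<forall>\<^sub>F n in sequentially. (\<integral>\<omega>. X n \<omega> - c \<partial>\<Omega> n) + c = (\<integral>\<omega>. X n \<omega> \<partial>\<Omega> n)"
      using eventually_ge_at_top[of d]
    proof eventually_elim
      case (elim n)
      interpret prob_space "\<Omega> n" by (rule prob_space_n[OF elim])
      show ?case using bdd_integrable[OF converges_to_bdd[OF assms] elim] by (simp add: prob_space)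
    qed
  qed
qed

lemma converges_to_unique: "converges_to X c \<Longrightarrow> converges_to X c' \<Longrightarrow> c = c'"
  using converges_to_integral LIMSEQ_unique by blast

lemma converges_to_cong:
  assumes "converges_to X c" "\<And>n. n \<ge> d \<Longrightarrow> Y n \<in> borel_measurable (\<Omega> n)"
    "\<And>n. n \<ge> d \<Longrightarrow> AE \<omega> in \<Omega> n. X n \<omega> = Y n \<omega>"
  shows "converges_to Y c"
  unfolding converges_to_def
proof (rule null_cong)
  show "null (\<lambda>n \<omega>. X n \<omega> - c)" using assms(1) by (simp add: converges_to_def)
  fix n assume n: "d \<le> n"
  show "(\<lambda>\<omega>. Y n \<omega> - c) \<in> borel_measurable (\<Omega> n)" using assms(2)[OF n] by simp
  show "AE \<omega> in \<Omega> n. X n \<omega> - c = Y n \<omega> - c" using assms(3)[OF n] by eventually_elim simp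
qed

lemma converges_to_const: "c \<longlonglongrightarrow> l \<Longrightarrow> converges_to (\<lambda>n \<omega>. c n) l"
  unfolding converges_to_def by (rule null_const) (use LIM_zero in blast)

lemma null_converges_to: "null X \<Longrightarrow> converges_to X 0"
  by (simp add: converges_to_def)

lemma converges_to_add:
  "converges_to X a \<Longrightarrow> converges_to Y b \<Longrightarrow> converges_to (\<lambda>n \<omega>. X n \<omega> + Y n \<omega>) (a + b)"
  unfolding converges_to_def using null_add[of "\<lambda>n \<omega>. X n \<omega> - a" "\<lambda>n \<omega>. Y n \<omega> - b"]
  by (simp add: algebra_simps)

lemma converges_to_const_mult:
  "converges_to X a \<Longrightarrow> converges_to (\<lambda>n \<omega>. c * X n \<omega>) (c * a)"
  unfolding converges_to_def using null_const_mult[of "\<lambda>n \<omega>. X n \<omega> - a" c]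
  by (simp add: algebra_simps)

lemma converges_to_cnj:
  assumes "converges_to X a" shows "converges_to (\<lambda>n \<omega>. cnj (X n \<omega>)) (cnj a)"
proof -
  have n: "null (\<lambda>n \<omega>. X n \<omega> - a)" using assms by (simp add: converges_to_def)
  have "null (\<lambda>n \<omega>. cnj (X n \<omega> - a))"
    by (rule null_dominated[OF n bdd_cnj[OF null_bdd[OF n]], of 1]) (auto simp del: complex_cnj_diff)
  then show ?thesis by (simp add: converges_to_def)
qed

end

section \<open>Words in Haar unitaries\<close>

lemma sum_rotate: "(\<Sum>i\<in>A. \<Sum>j\<in>B. \<Sum>m\<in>C. f i j m) = (\<Sum>m\<in>C. \<Sum>i\<in>A. \<Sum>j\<in>B. f i j m)"
proof -
  have "(\<Sum>i\<in>A. \<Sum>j\<in>B. \<Sum>m\<in>C. f i j m) = (\<Sum>i\<in>A. \<Sum>m\<in>C. \<Sum>j\<in>B. f i j m)"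
    by (intro sum.cong refl sum.swap)
  also have "\<dots> = (\<Sum>m\<in>C. \<Sum>i\<in>A. \<Sum>j\<in>B. f i j m)" by (rule sum.swap)
  finally show ?thesis .
qed

text \<open>\<open>wv L b [(v\<^sub>1, c\<^sub>1), \<dots>]\<close> is the alternating product $b\,L(v_1)\,c_1\,L(v_2)\,c_2\cdots$,
  and \<open>dwv L D\<close> its image under the derivation which sends \<open>L v\<close> to \<open>D v\<close> and kills the coefficients.\<close>

fun wv :: "('v \<Rightarrow> fmat) \<Rightarrow> fmat \<Rightarrow> ('v \<times> fmat) list \<Rightarrow> fmat" where
  "wv L b [] = b"
| "wv L b ((v, c) # w) = b * L v * wv L c w"

fun dwv :: "('v \<Rightarrow> fmat) \<Rightarrow> ('v \<Rightarrow> fmat) \<Rightarrow> fmat \<Rightarrow> ('v \<times> fmat) list \<Rightarrow> fmat" where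
  "dwv L D b [] = 0"
| "dwv L D b ((v, c) # w) = b * D v * wv L c w + b * L v * dwv L D c w"

lemma wv_mult_left: "wv L (a * b) w = a * wv L b w"
  by (cases w) (auto simp: mult.assoc)

lemma wv_append: "wv L b (u @ (v, c) # w) = wv L b u * L v * wv L c w"
  by (induction u arbitrary: b) (auto simp: mult.assoc)

lemma dwv_sum:
  "dwv L D b w = (\<Sum>m<length w. wv L b (take m w) * D (fst (w ! m)) * wv L (snd (w ! m)) (drop (Suc m) w))"
proof (induction w arbitrary: b)
  case (Cons x w)
  show ?case
    by (cases x) (simp add: Cons.IH sum.lessThan_Suc_shift sum_distrib_left mult.assoc del: sum.lessThan_Suc)
qed simp

lemma dwv_linear:
  assumes "\<And>v. D v = sc x (D1 v) + sc y (D2 v)"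
  shows "dwv L D b w = sc x (dwv L D1 b w) + sc y (dwv L D2 b w)"
proof (induction w arbitrary: b)
  case (Cons a w)
  then show ?case
    by (cases a) (simp add: assms algebra_simps sc_mult_left sc_mult_right sc_add_right)
qed simp

type_synonym 'i letter = "'i \<times> bool"

fun lett :: "('i \<Rightarrow> fmat) \<Rightarrow> 'i letter \<Rightarrow> fmat" where
  "lett u (i, adj) = (if adj then star_fmat (u i) else u i)"

fun flip :: "'i letter \<Rightarrow> 'i letter" where
  "flip (i, adj) = (i, \<not> adj)"

lemma flip_flip [simp]: "flip (flip v) = v" and flip_neq [simp]: "flip v \<noteq> v" "v \<noteq> flip v"
  and fst_flip [simp]: "fst (flip v) = fst v"
  by (cases v; simp)+

lemma lett_flip: "lett u (flip v) = star_fmat (lett u v)"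
  by (cases v) auto

text \<open>Derivative at t = 0 of a letter when \<open>v0\<close> is multiplied by e^{tK} from the
  left: the inverse letter is then multiplied by e^{-tK} from the right, hence the minus sign. The
  formula is linear in K and is also used for matrix units, which are not tangent to curves of
  unitaries themselves.\<close>

definition del :: "'i letter \<Rightarrow> fmat \<Rightarrow> ('i \<Rightarrow> fmat) \<Rightarrow> 'i letter \<Rightarrow> fmat" where
  "del v0 K u v = (if v = v0 then K * lett u v else if v = flip v0 then - (lett u v * K) else 0)"

text \<open>The curve $t \mapsto e^{tK}$ for an anti-Hermitian matrix with $K^3 = -K$.\<close>

definition rotation :: "fmat \<Rightarrow> fmat \<Rightarrow> real \<Rightarrow> fmat" where
  "rotation P K t = P + sc (of_real (sin t)) K + sc (of_real (1 - cos t)) (K * K)"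

lemma rotation_star:
  assumes "star_fmat P = P" "star_fmat K = - K"
  shows "star_fmat (rotation P K t) = rotation P K (- t)"
  by (rule fmat_eqI)
     (simp add: rotation_def star_add_fmat star_sc assms star_mult_fmat del: ent_star)

text \<open>Everything is polynomial in K, and K^4 = -K^2. The odd terms of the product cancel, and
  the coefficient of K^2 is 2(1 - cos t) - sin^2 t - (1 - cos t)^2 = 0.\<close>

lemma rotation_unitary:
  assumes P: "star_fmat P = P" "P * P = P" and K: "star_fmat K = - K" "K * K * K = - K"
    and PK: "P * K = K" "K * P = K"
  shows "rotation P K t * star_fmat (rotation P K t) = P"
    and "star_fmat (rotation P K t) * rotation P K t = P"
    and "P * rotation P K t = rotation P K t" "rotation P K t * P = rotation P K t"
proof -
  have r: "P * (K * K) = K * K" "K * (K * P) = K * K" "K * K * P = K * K" "K * (K * K) = - K" "K * K * (K * K) = - (K * K)"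
    using PK K(2) by (metis mult.assoc minus_mult_right mult_minus_left)+
  have *: "rotation P K t * rotation P K (- t) = P" for t
  proof (rule fmat_eqI)
    fix i j
    have s: "of_real (sin t) * of_real (sin t) = (1 - of_real (cos t) * of_real (cos t) :: complex)"
      using sin_cos_squared_add[of t]
      by (metis add_diff_cancel_right' of_real_1 of_real_diff of_real_mult power2_eq_square)
    have "ent (rotation P K t * rotation P K (- t)) i j =
      ent P i j + (2 * (1 - of_real (cos t)) - of_real (sin t) * of_real (sin t)
        - (1 - of_real (cos t)) * (1 - of_real (cos t))) * ent (K * K) i j"
      by (simp add: rotation_def distrib_left distrib_right sc_mult_left sc_mult_right sc_sc P PK r
          sc_uminus[symmetric] K(2) del: mult_minus_left) (simp add: algebra_simps)
    then show "ent (rotation P K t * rotation P K (- t)) i j = ent P i j"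
      unfolding s by (simp add: algebra_simps)
  qed
  show "rotation P K t * star_fmat (rotation P K t) = P"
    unfolding rotation_star[OF P(1) K(1)] by (rule *)
  show "star_fmat (rotation P K t) * rotation P K t = P"
    unfolding rotation_star[OF P(1) K(1)] using *[of "- t"] by simp
  show "P * rotation P K t = rotation P K t" "rotation P K t * P = rotation P K t"
    by (simp_all add: rotation_def distrib_left distrib_right sc_mult_left sc_mult_right P PK r)
qed

text \<open>The underlying matrix is changed so that the letter itself, plain or adjoint, is
  multiplied by W from the left. For an adjoint letter this means multiplying the matrix by the
  adjoint of W from the right.\<close>

fun translate :: "'i letter \<Rightarrow> fmat \<Rightarrow> ('i \<Rightarrow> fmat) \<Rightarrow> 'i \<Rightarrow> fmat" where
  "translate (i, adj) W u = u(i := (if adj then u i * star_fmat W else W * u i))"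

lemma lett_translate:
  "lett (translate v0 W u) v =
     (if v = v0 then W * lett u v else if v = flip v0 then lett u v * star_fmat W else lett u v)"
  by (cases v0; cases v) (auto simp: star_mult_fmat)

section \<open>Measurability of random matrices and of words in them\<close>

locale random_matrix =
  fixes M :: "'w measure" and n :: nat
begin

definition rmat :: "('w \<Rightarrow> fmat) \<Rightarrow> bool" where
  "rmat X \<longleftrightarrow> (\<forall>i j. (\<lambda>\<omega>. ent (X \<omega>) i j) \<in> borel_measurable M) \<and> (\<forall>\<omega>\<in>space M. dimb n (X \<omega>))"

lemma rmat_const: "dimb n b \<Longrightarrow> rmat (\<lambda>_. b)"
  by (simp add: rmat_def)

lemma rmat_add: "rmat X \<Longrightarrow> rmat Y \<Longrightarrow> rmat (\<lambda>\<omega>. X \<omega> + Y \<omega>)"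
  by (auto simp: rmat_def intro!: borel_measurable_add)

lemma rmat_uminus: "rmat X \<Longrightarrow> rmat (\<lambda>\<omega>. - X \<omega>)"
  by (auto simp: rmat_def)

lemma rmat_star: "rmat X \<Longrightarrow> rmat (\<lambda>\<omega>. star_fmat (X \<omega>))"
  by (auto simp: rmat_def intro!: measurable_compose[of _ M borel cnj borel] borel_measurable_continuous_onI continuous_intros)

lemma rmat_mult: assumes "rmat X" "rmat Y" shows "rmat (\<lambda>\<omega>. X \<omega> * Y \<omega>)"
  unfolding rmat_def
proof (intro conjI allI ballI)
  fix i j
  have "(\<lambda>\<omega>. \<Sum>l<n. ent (X \<omega>) i l * ent (Y \<omega>) l j) \<in> borel_measurable M"
    using assms by (auto simp: rmat_def intro!: borel_measurable_sum borel_measurable_times)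
  then show "(\<lambda>\<omega>. ent (X \<omega> * Y \<omega>) i j) \<in> borel_measurable M"
    by (rule measurable_cong[THEN iffD1, rotated])
       (use assms in \<open>auto simp: rmat_def ent_mult_left\<close>)
qed (use assms in \<open>auto simp: rmat_def\<close>)

lemma rmat_Tr: assumes "rmat X" shows "(\<lambda>\<omega>. Tr (X \<omega>)) \<in> borel_measurable M"
proof -
  have "(\<lambda>\<omega>. \<Sum>l<n. ent (X \<omega>) l l) \<in> borel_measurable M"
    using assms by (auto simp: rmat_def intro!: borel_measurable_sum)
  then show ?thesis
    by (rule measurable_cong[THEN iffD1, rotated]) (use assms in \<open>auto simp: rmat_def Tr_eq\<close>)
qed

lemma rmat_lett: "(\<And>i. i \<in> I \<Longrightarrow> rmat (u i)) \<Longrightarrow> fst v \<in> I \<Longrightarrow> rmat (\<lambda>\<omega>. lett (\<lambda>i. u i \<omega>) v)"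
  by (cases v, cases "snd v") (auto intro: rmat_star)

lemma rmat_wv:
  "(\<And>v. fst v \<in> I \<Longrightarrow> rmat (\<lambda>\<omega>. L \<omega> v)) \<Longrightarrow> dimb n b \<Longrightarrow>
   \<forall>x\<in>set w. fst (fst x) \<in> I \<and> dimb n (snd x) \<Longrightarrow> rmat (\<lambda>\<omega>. wv (L \<omega>) b w)"
proof (induction w arbitrary: b)
  case (Cons x w)
  then show ?case by (cases x) (auto intro!: rmat_mult rmat_const)
qed (auto intro: rmat_const)

lemma rmat_dwv:
  "(\<And>v. fst v \<in> I \<Longrightarrow> rmat (\<lambda>\<omega>. L \<omega> v)) \<Longrightarrow> (\<And>v. fst v \<in> I \<Longrightarrow> rmat (\<lambda>\<omega>. D \<omega> v)) \<Longrightarrow> dimb n b \<Longrightarrow>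
   \<forall>x\<in>set w. fst (fst x) \<in> I \<and> dimb n (snd x) \<Longrightarrow> rmat (\<lambda>\<omega>. dwv (L \<omega>) (D \<omega>) b w)"
proof (induction w arbitrary: b)
  case (Cons x w)
  then show ?case by (cases x) (auto intro!: rmat_mult rmat_const rmat_add rmat_wv[where I = I])
qed (auto intro: rmat_const)

end

text \<open>Haar measure enters through two facts: the unitary relations hold almost surely, and
  means of products of two word traces are unchanged by translation. Two traces occur because the
  equation is applied to a trace times its conjugate. The letter \<open>v\<close> may be an adjoint,
  which covers translation from the right.\<close>

locale haar_family = random_matrix M n
  for M :: "'w measure" and n :: nat +
  fixes I :: "'i set" and blk :: "'i \<Rightarrow> nat set"
    and U :: "'i \<Rightarrow> 'w \<Rightarrow> fmat"
  assumes prob: "prob_space M"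
    and blk: "i \<in> I \<Longrightarrow> blk i \<subseteq> {..<n}"
    and U_meas: "i \<in> I \<Longrightarrow> (\<lambda>\<omega>. ent (U i \<omega>) k l) \<in> borel_measurable M"
    and U_dim: "i \<in> I \<Longrightarrow> \<omega> \<in> space M \<Longrightarrow> dimb n (U i \<omega>)"
    and U_unitary: "AE \<omega> in M. \<forall>i\<in>I. U i \<omega> * star_fmat (U i \<omega>) = dproj (blk i) \<and>
      star_fmat (U i \<omega>) * U i \<omega> = dproj (blk i) \<and>
      dproj (blk i) * U i \<omega> = U i \<omega> \<and> U i \<omega> * dproj (blk i) = U i \<omega>"
    and U_invariant: "\<lbrakk>fst v \<in> I; W * star_fmat W = dproj (blk (fst v)); star_fmat W * W = dproj (blk (fst v));
      dproj (blk (fst v)) * W = W; W * dproj (blk (fst v)) = W;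
      dimb n b; dimb n b'; \<forall>x\<in>set w \<union> set w'. fst (fst x) \<in> I \<and> dimb n (snd x)\<rbrakk> \<Longrightarrow>
      (\<integral>\<omega>. Tr (wv (lett (translate v W (\<lambda>i. U i \<omega>))) b w) *
            Tr (wv (lett (translate v W (\<lambda>i. U i \<omega>))) b' w') \<partial>M)
      = (\<integral>\<omega>. Tr (wv (lett (\<lambda>i. U i \<omega>)) b w) * Tr (wv (lett (\<lambda>i. U i \<omega>)) b' w') \<partial>M)"
begin

abbreviation "LU \<omega> \<equiv> lett (\<lambda>i. U i \<omega>)"

text \<open>The relations hold here for all indices simultaneously; pointwise identities and bounds
  are stated for these outcomes.\<close>

definition good :: "'w set" where
  "good = {\<omega> \<in> space M. \<forall>i\<in>I. U i \<omega> * star_fmat (U i \<omega>) = dproj (blk i) \<and>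
      star_fmat (U i \<omega>) * U i \<omega> = dproj (blk i) \<and>
      dproj (blk i) * U i \<omega> = U i \<omega> \<and> U i \<omega> * dproj (blk i) = U i \<omega>}"

lemma AE_good: "AE \<omega> in M. \<omega> \<in> good"
  using U_unitary AE_space by eventually_elim (auto simp: good_def)

lemma finite_blk: "i \<in> I \<Longrightarrow> finite (blk i)"
  using blk finite_subset by blast

lemma dimb_blk: "i \<in> I \<Longrightarrow> dimb n (dproj (blk i))"
  by (intro dimb_dproj blk)

lemma goodD:
  assumes "\<omega> \<in> good" "fst v \<in> I"
  shows "dimb n (LU \<omega> v)" "LU \<omega> v * LU \<omega> (flip v) = dproj (blk (fst v))"
    "dproj (blk (fst v)) * LU \<omega> v = LU \<omega> v" "LU \<omega> v * dproj (blk (fst v)) = LU \<omega> v"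
proof -
  obtain i adj where v: "v = (i, adj)" by (cases v)
  have i: "i \<in> I" using assms v by simp
  have g: "U i \<omega> * star_fmat (U i \<omega>) = dproj (blk i)" "star_fmat (U i \<omega>) * U i \<omega> = dproj (blk i)"
      "dproj (blk i) * U i \<omega> = U i \<omega>" "U i \<omega> * dproj (blk i) = U i \<omega>" "\<omega> \<in> space M"
    using assms(1) i by (auto simp: good_def)
  have s: "star_fmat (dproj (blk i)) = dproj (blk i)" by (rule star_dproj[OF finite_blk[OF i]])
  have g': "dproj (blk i) * star_fmat (U i \<omega>) = star_fmat (U i \<omega>)" 
    "star_fmat (U i \<omega>) * dproj (blk i) = star_fmat (U i \<omega>)"
    using g(3,4) s by (metis star_mult_fmat)+
  show "dimb n (LU \<omega> v)" "LU \<omega> v * LU \<omega> (flip v) = dproj (blk (fst v))"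
    "dproj (blk (fst v)) * LU \<omega> v = LU \<omega> v" "LU \<omega> v * dproj (blk (fst v)) = LU \<omega> v"
    using g g' U_dim[OF i g(5)] by (auto simp: v)
qed

text \<open>A row of a unitary of the corner has norm 0 or 1. Hence entries have bounds independent
  of \<omega>, as the uniform expansions below require.\<close>

lemma good_entry_le: 
  assumes "\<omega> \<in> good" "fst v \<in> I" shows "cmod (ent (LU \<omega> v) i j) \<le> 1"
proof (cases "i < n \<and> j < n")
  case True
  note g = goodD[OF assms]
  have "ent (LU \<omega> v * star_fmat (LU \<omega> v)) i i = (\<Sum>l<n. of_real ((cmod (ent (LU \<omega> v) i l))\<^sup>2))"
    by (simp only: ent_mult_left[OF g(1)] ent_star complex_norm_square)
  moreover have "ent (LU \<omega> v * star_fmat (LU \<omega> v)) i i = of_real (if i \<in> blk (fst v) then 1 else 0)"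
    using g(2) finite_blk[OF assms(2)] by (simp add: lett_flip ent_dproj)
  ultimately have "of_real (\<Sum>l<n. (cmod (ent (LU \<omega> v) i l))\<^sup>2) = (of_real (if i \<in> blk (fst v) then 1 else 0) :: complex)"
    by (simp only: of_real_sum)
  then have "(\<Sum>l<n. (cmod (ent (LU \<omega> v) i l))\<^sup>2) = (if i \<in> blk (fst v) then 1 else 0)"
    by (simp only: of_real_eq_iff)
  moreover have "(cmod (ent (LU \<omega> v) i j))\<^sup>2 \<le> (\<Sum>l<n. (cmod (ent (LU \<omega> v) i l))\<^sup>2)"
    by (rule member_le_sum) (use True in auto)
  ultimately have "(cmod (ent (LU \<omega> v) i j))\<^sup>2 \<le> 1\<^sup>2" by (auto split: if_splits)
  then show ?thesis by (rule power2_le_imp_le) simp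
next
  case False
  then show ?thesis using dimb_zero[OF goodD(1)[OF assms]] by simp
qed

lemmas rmat_wvI = rmat_wv[where I = I]
lemmas rmat_dwvI = rmat_dwv[where I = I]

lemma rmat_LU: "fst v \<in> I \<Longrightarrow> rmat (\<lambda>\<omega>. LU \<omega> v)"
  by (rule rmat_lett[where I = I]) (auto simp: rmat_def U_meas U_dim)

subsection \<open>First-order expansions\<close>

text \<open>First-order Taylor expansion at t = 0 with a remainder constant uniform in \<omega>. The
  uniformity lets the derivative pass the integral by an elementary estimate. The same constant
  bounds both coefficients, so that expansions can be multiplied.\<close>

definition expands :: "(real \<Rightarrow> 'w \<Rightarrow> complex) \<Rightarrow> ('w \<Rightarrow> complex) \<Rightarrow> ('w \<Rightarrow> complex) \<Rightarrow> bool" where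
  "expands F F0 F1 \<longleftrightarrow> (\<exists>C\<ge>0. \<forall>\<omega>\<in>good. \<forall>t. \<bar>t\<bar> \<le> 1 \<longrightarrow>
     cmod (F t \<omega> - F0 \<omega> - of_real t * F1 \<omega>) \<le> C * t\<^sup>2 \<and> cmod (F0 \<omega>) \<le> C \<and> cmod (F1 \<omega>) \<le> C)"

lemma expandsE:
  assumes "expands F F0 F1"
  obtains C where "C \<ge> 0"
    "\<And>\<omega> t. \<omega> \<in> good \<Longrightarrow> \<bar>t\<bar> \<le> 1 \<Longrightarrow> cmod (F t \<omega> - F0 \<omega> - of_real t * F1 \<omega>) \<le> C * t\<^sup>2"
    "\<And>\<omega>. \<omega> \<in> good \<Longrightarrow> cmod (F0 \<omega>) \<le> C" "\<And>\<omega>. \<omega> \<in> good \<Longrightarrow> cmod (F1 \<omega>) \<le> C"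
proof -
  obtain C where C: "C \<ge> 0" "\<forall>\<omega>\<in>good. \<forall>t. \<bar>t\<bar> \<le> 1 \<longrightarrow>
     cmod (F t \<omega> - F0 \<omega> - of_real t * F1 \<omega>) \<le> C * t\<^sup>2 \<and> cmod (F0 \<omega>) \<le> C \<and> cmod (F1 \<omega>) \<le> C"
    using assms by (auto simp: expands_def)
  have "cmod (F0 \<omega>) \<le> C" "cmod (F1 \<omega>) \<le> C" if "\<omega> \<in> good" for \<omega>
    using C(2)[rule_format, OF that, of 0] by auto
  then show ?thesis using that C by blast
qed

lemma expands_const: "expands (\<lambda>_ _. c) (\<lambda>_. c) (\<lambda>_. 0)"
  unfolding expands_def by (rule exI[of _ "cmod c"]) auto

lemma expands_add:
  assumes "expands F F0 F1" "expands G G0 G1"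
  shows "expands (\<lambda>t \<omega>. F t \<omega> + G t \<omega>) (\<lambda>\<omega>. F0 \<omega> + G0 \<omega>) (\<lambda>\<omega>. F1 \<omega> + G1 \<omega>)"
proof -
  obtain C where C: "C \<ge> 0"
    "\<And>\<omega> t. \<omega> \<in> good \<Longrightarrow> \<bar>t\<bar> \<le> 1 \<Longrightarrow> cmod (F t \<omega> - F0 \<omega> - of_real t * F1 \<omega>) \<le> C * t\<^sup>2"
    "\<And>\<omega>. \<omega> \<in> good \<Longrightarrow> cmod (F0 \<omega>) \<le> C" "\<And>\<omega>. \<omega> \<in> good \<Longrightarrow> cmod (F1 \<omega>) \<le> C"
    using expandsE[OF assms(1)] by blast
  obtain D where D: "D \<ge> 0"
    "\<And>\<omega> t. \<omega> \<in> good \<Longrightarrow> \<bar>t\<bar> \<le> 1 \<Longrightarrow> cmod (G t \<omega> - G0 \<omega> - of_real t * G1 \<omega>) \<le> D * t\<^sup>2"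
    "\<And>\<omega>. \<omega> \<in> good \<Longrightarrow> cmod (G0 \<omega>) \<le> D" "\<And>\<omega>. \<omega> \<in> good \<Longrightarrow> cmod (G1 \<omega>) \<le> D"
    using expandsE[OF assms(2)] by blast
  have "cmod (F t \<omega> + G t \<omega> - (F0 \<omega> + G0 \<omega>) - of_real t * (F1 \<omega> + G1 \<omega>)) \<le> (C + D) * t\<^sup>2"
    if "\<omega> \<in> good" "\<bar>t\<bar> \<le> 1" for t \<omega>
  proof -
    have "F t \<omega> + G t \<omega> - (F0 \<omega> + G0 \<omega>) - of_real t * (F1 \<omega> + G1 \<omega>)
      = (F t \<omega> - F0 \<omega> - of_real t * F1 \<omega>) + (G t \<omega> - G0 \<omega> - of_real t * G1 \<omega>)"
      by (simp add: algebra_simps)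
    then show ?thesis
      using norm_add_rule_thm[OF C(2)[OF that] D(2)[OF that]] by (simp only: distrib_right)
  qed
  moreover have "cmod (F0 \<omega> + G0 \<omega>) \<le> C + D" "cmod (F1 \<omega> + G1 \<omega>) \<le> C + D" if "\<omega> \<in> good" for \<omega>
    using C(3,4)[OF that] D(3,4)[OF that] by (auto intro: norm_add_rule_thm)
  ultimately show ?thesis
    unfolding expands_def using C(1) D(1) by (intro exI[of _ "C + D"]) auto
qed

lemma expands_mult:
  assumes "expands F F0 F1" "expands G G0 G1"
  shows "expands (\<lambda>t \<omega>. F t \<omega> * G t \<omega>) (\<lambda>\<omega>. F0 \<omega> * G0 \<omega>) (\<lambda>\<omega>. F0 \<omega> * G1 \<omega> + F1 \<omega> * G0 \<omega>)"
proof -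
  obtain C where C: "C \<ge> 0"
    "\<And>\<omega> t. \<omega> \<in> good \<Longrightarrow> \<bar>t\<bar> \<le> 1 \<Longrightarrow> cmod (F t \<omega> - F0 \<omega> - of_real t * F1 \<omega>) \<le> C * t\<^sup>2"
    "\<And>\<omega>. \<omega> \<in> good \<Longrightarrow> cmod (F0 \<omega>) \<le> C" "\<And>\<omega>. \<omega> \<in> good \<Longrightarrow> cmod (F1 \<omega>) \<le> C"
    using expandsE[OF assms(1)] by blast
  obtain D where D: "D \<ge> 0"
    "\<And>\<omega> t. \<omega> \<in> good \<Longrightarrow> \<bar>t\<bar> \<le> 1 \<Longrightarrow> cmod (G t \<omega> - G0 \<omega> - of_real t * G1 \<omega>) \<le> D * t\<^sup>2"
    "\<And>\<omega>. \<omega> \<in> good \<Longrightarrow> cmod (G0 \<omega>) \<le> D" "\<And>\<omega>. \<omega> \<in> good \<Longrightarrow> cmod (G1 \<omega>) \<le> D"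
    using expandsE[OF assms(2)] by blast
  have cd: "0 \<le> C * D" using C D by simp
  \<comment> \<open>The factor 6 is 1 + 3 + 2: the bounds \<open>n1\<close>, \<open>n2\<close> and
    \<open>n3\<close> of the three remainder terms, in units of C D t^2.\<close>
  have "cmod (F t \<omega> * G t \<omega> - F0 \<omega> * G0 \<omega> - of_real t * (F0 \<omega> * G1 \<omega> + F1 \<omega> * G0 \<omega>)) \<le> (6 * (C * D)) * t\<^sup>2"
    if w: "\<omega> \<in> good" and t: "\<bar>t\<bar> \<le> 1" for t \<omega>
  proof -
    let ?r = "F t \<omega> - F0 \<omega> - of_real t * F1 \<omega>" and ?s = "G t \<omega> - G0 \<omega> - of_real t * G1 \<omega>"
    note c = C(2)[OF w t] C(3,4)[OF w] and d = D(2)[OF w t] D(3,4)[OF w]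
    have t2: "t\<^sup>2 \<le> 1" using t by (simp add: abs_square_le_1)
    have eq: "F t \<omega> * G t \<omega> - F0 \<omega> * G0 \<omega> - of_real t * (F0 \<omega> * G1 \<omega> + F1 \<omega> * G0 \<omega>) =
      of_real (t\<^sup>2) * (F1 \<omega> * G1 \<omega>) + ?r * (G0 \<omega> + of_real t * G1 \<omega> + ?s) + (F0 \<omega> + of_real t * F1 \<omega>) * ?s"
      by (simp add: algebra_simps power2_eq_square)
    have tn: "cmod (of_real t * x) \<le> B" if "cmod x \<le> B" for x B
      using that t mult_mono[of "\<bar>t\<bar>" 1 "cmod x" B] by (simp add: norm_mult)
    have n1: "cmod (of_real (t\<^sup>2) * (F1 \<omega> * G1 \<omega>)) \<le> t\<^sup>2 * (C * D)"
      unfolding norm_mult norm_of_real using c d C(1) by (intro mult_mono) auto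
    have "cmod ?s \<le> D" using d(1) mult_left_mono[OF t2 D(1)] by simp
    then have "cmod (G0 \<omega> + of_real t * G1 \<omega> + ?s) \<le> D + D + D"
      by (intro norm_add_rule_thm d(2) tn[OF d(3)])
    then have n2: "cmod (?r * (G0 \<omega> + of_real t * G1 \<omega> + ?s)) \<le> (C * t\<^sup>2) * (D + D + D)"
      unfolding norm_mult using c(1) C(1) by (intro mult_mono) auto
    have "cmod (F0 \<omega> + of_real t * F1 \<omega>) \<le> C + C"
      by (intro norm_add_rule_thm c(2) tn[OF c(3)])
    then have n3: "cmod ((F0 \<omega> + of_real t * F1 \<omega>) * ?s) \<le> (C + C) * (D * t\<^sup>2)"
      unfolding norm_mult using d(1) C(1) by (intro mult_mono) auto
    show ?thesis unfolding eq
      using norm_add_rule_thm[OF norm_add_rule_thm[OF n1 n2] n3] by (simp add: algebra_simps)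
  qed
  moreover have "cmod (F0 \<omega> * G0 \<omega>) \<le> 6 * (C * D)"
      "cmod (F0 \<omega> * G1 \<omega> + F1 \<omega> * G0 \<omega>) \<le> 6 * (C * D)" if w: "\<omega> \<in> good" for \<omega>
  proof -
    note c = C(3,4)[OF w] and d = D(3,4)[OF w]
    have "cmod (F0 \<omega> * G0 \<omega>) \<le> C * D" "cmod (F0 \<omega> * G1 \<omega>) \<le> C * D" "cmod (F1 \<omega> * G0 \<omega>) \<le> C * D"
      unfolding norm_mult using c d C(1) by (auto intro: mult_mono)
    then show "cmod (F0 \<omega> * G0 \<omega>) \<le> 6 * (C * D)"
      "cmod (F0 \<omega> * G1 \<omega> + F1 \<omega> * G0 \<omega>) \<le> 6 * (C * D)"
      using cd norm_triangle_ineq[of "F0 \<omega> * G1 \<omega>" "F1 \<omega> * G0 \<omega>"] by linarith+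
  qed
  ultimately show ?thesis
    unfolding expands_def using cd by (intro exI[of _ "6 * (C * D)"]) auto
qed

lemma expands_sum:
  "(\<And>i. i \<in> S \<Longrightarrow> expands (F i) (F0 i) (F1 i)) \<Longrightarrow>
   expands (\<lambda>t \<omega>. \<Sum>i\<in>S. F i t \<omega>) (\<lambda>\<omega>. \<Sum>i\<in>S. F0 i \<omega>) (\<lambda>\<omega>. \<Sum>i\<in>S. F1 i \<omega>)"
  using expands_const[of 0]
  by (induction S rule: infinite_finite_induct) (auto intro: expands_add)

lemma expands_cong:
  "expands F F0 F1 \<Longrightarrow> (\<And>t \<omega>. \<omega> \<in> good \<Longrightarrow> F t \<omega> = G t \<omega>) \<Longrightarrow> (\<And>\<omega>. \<omega> \<in> good \<Longrightarrow> F0 \<omega> = G0 \<omega>) \<Longrightarrow>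
   (\<And>\<omega>. \<omega> \<in> good \<Longrightarrow> F1 \<omega> = G1 \<omega>) \<Longrightarrow> expands G G0 G1"
  unfolding expands_def by simp

text \<open>As the mean does not depend on t, t times the mean of the first-order coefficient
  equals, up to sign, the mean of the remainder and is at most C t^2. Division by t and t
  \<rightarrow> 0 give the claim.\<close>

lemma expands_integral_zero:
  assumes ex: "expands F F0 F1" and "\<And>t. F t \<in> borel_measurable M" "F0 \<in> borel_measurable M"
    "F1 \<in> borel_measurable M" and const: "\<And>t. (\<integral>\<omega>. F t \<omega> \<partial>M) = (\<integral>\<omega>. F0 \<omega> \<partial>M)"
  shows "integrable M F1" "(\<integral>\<omega>. F1 \<omega> \<partial>M) = 0"
proof -
  interpret prob_space M by (rule prob)
  obtain C where C: "C \<ge> 0"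
    "\<And>\<omega> t. \<omega> \<in> good \<Longrightarrow> \<bar>t\<bar> \<le> 1 \<Longrightarrow> cmod (F t \<omega> - F0 \<omega> - of_real t * F1 \<omega>) \<le> C * t\<^sup>2"
    "\<And>\<omega>. \<omega> \<in> good \<Longrightarrow> cmod (F0 \<omega>) \<le> C" "\<And>\<omega>. \<omega> \<in> good \<Longrightarrow> cmod (F1 \<omega>) \<le> C"
    using expandsE[OF assms(1)] by blast
  have i0: "integrable M F0" 
    by (rule integrable_const_bound[where B = C]) (use C(3) AE_good assms in \<open>auto elim!: eventually_mono\<close>)
  show i1: "integrable M F1" 
    by (rule integrable_const_bound[where B = C]) (use C(4) AE_good assms in \<open>auto elim!: eventually_mono\<close>)
  have "cmod (\<integral>\<omega>. F1 \<omega> \<partial>M) \<le> C * t" if t: "0 < t" "t \<le> 1" for t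
  proof -
    let ?R = "\<lambda>\<omega>. F t \<omega> - F0 \<omega> - of_real t * F1 \<omega>"
    have ae: "AE \<omega> in M. cmod (?R \<omega>) \<le> C * t\<^sup>2" using AE_good C(2) t by (auto elim!: eventually_mono)
    have iR: "integrable M ?R"
      by (rule integrable_const_bound[OF ae]) (use assms in auto)
    have it: "integrable M (F t)"
    proof -
      have "integrable M (\<lambda>\<omega>. ?R \<omega> + (F0 \<omega> + of_real t * F1 \<omega>))" 
        by (intro Bochner_Integration.integrable_add integrable_mult_right iR i0 i1)
      moreover have "(\<lambda>\<omega>. ?R \<omega> + (F0 \<omega> + of_real t * F1 \<omega>)) = F t" by (rule ext) simp
      ultimately show ?thesis by simp
    qed
    have "(\<integral>\<omega>. ?R \<omega> \<partial>M) = - (of_real t * (\<integral>\<omega>. F1 \<omega> \<partial>M))"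
      using it i0 i1 by (simp add: const)
    then have "t * cmod (\<integral>\<omega>. F1 \<omega> \<partial>M) = cmod (\<integral>\<omega>. ?R \<omega> \<partial>M)"
      using t by (simp add: norm_mult)
    also have "\<dots> \<le> (\<integral>\<omega>. cmod (?R \<omega>) \<partial>M)" by simp
    also have "\<dots> \<le> (\<integral>\<omega>. C * t\<^sup>2 \<partial>M)" using iR ae by (intro integral_mono_AE) auto
    also have "\<dots> = t * (C * t)" by (simp add: prob_space power2_eq_square)
    finally show ?thesis using t by simp
  qed
  then have "cmod (\<integral>\<omega>. F1 \<omega> \<partial>M) \<le> 0 + e" if "0 < e" for e
  proof (cases "C = 0")
    case False
    then have "C > 0" using C(1) by simp
    then have "C * min 1 (e / C) \<le> e" by (simp add: min_def field_simps)
    then show ?thesis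
      using \<open>\<And>t. 0 < t \<Longrightarrow> t \<le> 1 \<Longrightarrow> cmod (\<integral>\<omega>. F1 \<omega> \<partial>M) \<le> C * t\<close>[of "min 1 (e / C)"] \<open>C > 0\<close> that
      by simp
  next
    case True
    then show ?thesis
      using \<open>\<And>t. 0 < t \<Longrightarrow> t \<le> 1 \<Longrightarrow> cmod (\<integral>\<omega>. F1 \<omega> \<partial>M) \<le> C * t\<close>[of 1] that by simp
  qed
  then have "cmod (\<integral>\<omega>. F1 \<omega> \<partial>M) \<le> 0" by (rule field_le_epsilon)
  then show "(\<integral>\<omega>. F1 \<omega> \<partial>M) = 0" by simp
qed

definition mexpands :: "(real \<Rightarrow> 'w \<Rightarrow> fmat) \<Rightarrow> ('w \<Rightarrow> fmat) \<Rightarrow> ('w \<Rightarrow> fmat) \<Rightarrow> bool" where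
  "mexpands X X0 X1 \<longleftrightarrow> (\<forall>\<omega>\<in>good. dimb n (X0 \<omega>) \<and> dimb n (X1 \<omega>) \<and> (\<forall>t. dimb n (X t \<omega>))) \<and>
     (\<forall>i j. expands (\<lambda>t \<omega>. ent (X t \<omega>) i j) (\<lambda>\<omega>. ent (X0 \<omega>) i j) (\<lambda>\<omega>. ent (X1 \<omega>) i j))"

lemma mexpands_const: "dimb n b \<Longrightarrow> mexpands (\<lambda>_ _. b) (\<lambda>_. b) (\<lambda>_. 0)"
  by (simp add: mexpands_def expands_const)

lemma mexpands_mult:
  assumes "mexpands X X0 X1" "mexpands Y Y0 Y1"
  shows "mexpands (\<lambda>t \<omega>. X t \<omega> * Y t \<omega>) (\<lambda>\<omega>. X0 \<omega> * Y0 \<omega>) (\<lambda>\<omega>. X0 \<omega> * Y1 \<omega> + X1 \<omega> * Y0 \<omega>)"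
  unfolding mexpands_def
proof (intro conjI allI ballI)
  fix i j
  show "expands (\<lambda>t \<omega>. ent (X t \<omega> * Y t \<omega>) i j) (\<lambda>\<omega>. ent (X0 \<omega> * Y0 \<omega>) i j)
     (\<lambda>\<omega>. ent (X0 \<omega> * Y1 \<omega> + X1 \<omega> * Y0 \<omega>) i j)"
  proof (rule expands_cong[OF expands_sum])
    show "expands (\<lambda>t \<omega>. ent (X t \<omega>) i l * ent (Y t \<omega>) l j) (\<lambda>\<omega>. ent (X0 \<omega>) i l * ent (Y0 \<omega>) l j)
       (\<lambda>\<omega>. ent (X0 \<omega>) i l * ent (Y1 \<omega>) l j + ent (X1 \<omega>) i l * ent (Y0 \<omega>) l j)" if "l \<in> {..<n}" for l
      using assms by (intro expands_mult) (auto simp: mexpands_def)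
  qed (use assms in \<open>auto simp: mexpands_def ent_mult_left[of n] sum.distrib\<close>)
qed (use assms in \<open>auto simp: mexpands_def\<close>)

lemma mexpands_Tr:
  assumes "mexpands X X0 X1"
  shows "expands (\<lambda>t \<omega>. Tr (X t \<omega>)) (\<lambda>\<omega>. Tr (X0 \<omega>)) (\<lambda>\<omega>. Tr (X1 \<omega>))"
proof (rule expands_cong[OF expands_sum])
  show "expands (\<lambda>t \<omega>. ent (X t \<omega>) i i) (\<lambda>\<omega>. ent (X0 \<omega>) i i) (\<lambda>\<omega>. ent (X1 \<omega>) i i)" if "i \<in> {..<n}" for i
    using assms by (simp add: mexpands_def)
qed (use assms in \<open>auto simp: mexpands_def Tr_eq[of n]\<close>)

lemma mexpands_wv:
  "(\<And>v. fst v \<in> I \<Longrightarrow> mexpands (\<lambda>t \<omega>. L t \<omega> v) (\<lambda>\<omega>. L0 \<omega> v) (\<lambda>\<omega>. L1 \<omega> v)) \<Longrightarrow> dimb n b \<Longrightarrow>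
   \<forall>x\<in>set w. fst (fst x) \<in> I \<and> dimb n (snd x) \<Longrightarrow>
   mexpands (\<lambda>t \<omega>. wv (L t \<omega>) b w) (\<lambda>\<omega>. wv (L0 \<omega>) b w) (\<lambda>\<omega>. dwv (L0 \<omega>) (L1 \<omega>) b w)"
proof (induction w arbitrary: b)
  case (Cons x w)
  obtain v c where x: "x = (v, c)" by (cases x)
  have "mexpands (\<lambda>t \<omega>. b * L t \<omega> v * wv (L t \<omega>) c w) (\<lambda>\<omega>. b * L0 \<omega> v * wv (L0 \<omega>) c w)
     (\<lambda>\<omega>. b * L0 \<omega> v * dwv (L0 \<omega>) (L1 \<omega>) c w + (b * L1 \<omega> v + 0 * L0 \<omega> v) * wv (L0 \<omega>) c w)"
    using Cons.prems x by (intro mexpands_mult mexpands_const Cons) auto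
  then show ?case by (simp add: x add.commute)
qed (auto intro: mexpands_const)

text \<open>For |t| \<le> 1 both |sin t - t| and 1 - cos t are at most t^2, by Taylor's formula and
  by the half-angle identity; the coefficient of sin t is thus the derivative.\<close>

lemma expands_rotation:
  assumes "\<And>\<omega>. \<omega> \<in> good \<Longrightarrow> cmod (A \<omega>) \<le> c" "\<And>\<omega>. \<omega> \<in> good \<Longrightarrow> cmod (B \<omega>) \<le> c"
    "\<And>\<omega>. \<omega> \<in> good \<Longrightarrow> cmod (D \<omega>) \<le> c"
  shows "expands (\<lambda>t \<omega>. A \<omega> + of_real (sin t) * B \<omega> + of_real (1 - cos t) * D \<omega>) A B"
proof -
  have "cmod (A \<omega> + of_real (sin t) * B \<omega> + of_real (1 - cos t) * D \<omega> - A \<omega> - of_real t * B \<omega>) \<le> (2 * \<bar>c\<bar>) * t\<^sup>2"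
    if w: "\<omega> \<in> good" and t: "\<bar>t\<bar> \<le> 1" for \<omega> t
  proof -
    have "\<bar>sin t - t\<bar> \<le> t\<^sup>2"
    proof -
      have "\<bar>sin t - (\<Sum>m<3. sin_coeff m * t ^ m)\<bar> \<le> inverse (fact 3) * \<bar>t\<bar> ^ 3"
        by (rule Maclaurin_sin_bound)
      moreover have "(\<Sum>m<3. sin_coeff m * t ^ m) = t"
        by (simp add: numeral_eq_Suc sin_coeff_def)
      moreover have "inverse (fact 3) * \<bar>t\<bar> ^ 3 \<le> 1 * \<bar>t\<bar> ^ 2"
        using t by (intro mult_mono power_decreasing) (auto simp: field_simps fact_numeral)
      ultimately show ?thesis by simp
    qed
    moreover have "\<bar>1 - cos t\<bar> \<le> t\<^sup>2"
    proof -
      have "1 - cos t = 2 * (sin (t / 2))\<^sup>2" using cos_double_sin[of "t / 2"] by simp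
      moreover have "(sin (t / 2))\<^sup>2 \<le> (t / 2)\<^sup>2"
        using abs_sin_x_le_abs_x[of "t / 2"] by (simp only: abs_le_square_iff)
      then have "(sin (t / 2))\<^sup>2 \<le> t\<^sup>2 / 4" by (simp add: power_divide)
      ultimately show ?thesis
        using zero_le_power2[of "sin (t / 2)"] zero_le_power2[of t] by linarith
    qed
    ultimately have "cmod (of_real (sin t - t) * B \<omega> + of_real (1 - cos t) * D \<omega>) \<le> t\<^sup>2 * \<bar>c\<bar> + t\<^sup>2 * \<bar>c\<bar>"
      using assms(2,3)[OF w]
      by (intro norm_add_rule_thm) (auto simp: norm_mult simp del: of_real_diff intro!: mult_mono)
    then show ?thesis by (simp add: algebra_simps)
  qed
  moreover have "cmod (A \<omega>) \<le> 2 * \<bar>c\<bar>" "cmod (B \<omega>) \<le> 2 * \<bar>c\<bar>" if "\<omega> \<in> good" for \<omega>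
    using assms(1,2)[OF that] by linarith+
  ultimately show ?thesis unfolding expands_def by (intro exI[of _ "2 * \<bar>c\<bar>"]) auto
qed

subsection \<open>The Schwinger-Dyson equation\<close>

abbreviation "wordI w \<equiv> \<forall>x\<in>set w. fst (fst x) \<in> I \<and> dimb n (snd x)"

text \<open>Leibniz rule for a product of two word traces, differentiated at the letter
  \<open>v0\<close> in the direction K.\<close>

definition sd_term :: "'i letter \<Rightarrow> fmat \<Rightarrow> fmat \<Rightarrow> ('i letter \<times> fmat) list \<Rightarrow> fmat \<Rightarrow> ('i letter \<times> fmat) list \<Rightarrow> 'w \<Rightarrow> complex"
  where "sd_term v0 K b w b' w' \<omega> =
    Tr (wv (LU \<omega>) b w) * Tr (dwv (LU \<omega>) (del v0 K (\<lambda>i. U i \<omega>)) b' w') +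
    Tr (dwv (LU \<omega>) (del v0 K (\<lambda>i. U i \<omega>)) b w) * Tr (wv (LU \<omega>) b' w')"

text \<open>The matrices \<open>rotation ?P K t\<close> are unitaries of the block, so by invariance
  the mean of the translated product of traces is constant in t; its first-order coefficient has
  mean zero.\<close>

lemma sd_special:
  assumes v0: "fst v0 \<in> I" and K: "star_fmat K = - K" "K * K * K = - K"
    "dproj (blk (fst v0)) * K = K" "K * dproj (blk (fst v0)) = K" "dimb n K"
    and b: "dimb n b" "dimb n b'" and w: "wordI w" "wordI w'"
  shows "integrable M (sd_term v0 K b w b' w')" "(\<integral>\<omega>. sd_term v0 K b w b' w' \<omega> \<partial>M) = 0"
proof -
  let ?P = "dproj (blk (fst v0))"
  let ?T = "\<lambda>t \<omega>. lett (translate v0 (rotation ?P K t) (\<lambda>i. U i \<omega>))"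
  let ?D = "\<lambda>\<omega>. del v0 K (\<lambda>i. U i \<omega>)"
  note fin = finite_blk[OF v0]
  have sP: "star_fmat ?P = ?P" "?P * ?P = ?P" using fin by (auto simp: star_dproj dproj_dproj)
  note rot = rotation_unitary[OF sP K(1-4)]
  have dK: "dimb n (rotation ?P K t)" for t
    using K(5) dimb_blk[OF v0] by (simp add: rotation_def)
  \<comment> \<open>The block projection fixes the letters concerned, so every translated letter has
    the form A + (sin t) B + (1 - cos t) D, for which a uniform expansion is available.\<close>
  have lT: "?T t \<omega> v = LU \<omega> v + sc (of_real (sin t)) (?D \<omega> v) + sc (of_real (1 - cos t)) 
      (if v = v0 then K * K * LU \<omega> v else if v = flip v0 then LU \<omega> v * K * K else 0)"
    if "\<omega> \<in> good" "fst v \<in> I" for t \<omega> v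
  proof -
    have st: "star_fmat (rotation ?P K t) = ?P - sc (of_real (sin t)) K + sc (of_real (1 - cos t)) (K * K)"
      by (simp only: rotation_star[OF sP(1) K(1)]) (rule fmat_eqI, simp add: rotation_def)
    show ?thesis
      unfolding lett_translate st using goodD(3,4)[OF that]
      by (auto simp: del_def rotation_def distrib_left distrib_right sc_mult_left
          sc_mult_right right_diff_distrib mult.assoc[symmetric] fmat_eqI)
  qed
  have bd: "\<exists>c. \<forall>\<omega>\<in>good. cmod (ent (K1 * LU \<omega> v) i j) \<le> c" if "fst v \<in> I" "dimb n K1" for K1 v i j
  proof (intro exI ballI)
    fix \<omega> assume "\<omega> \<in> good"
    show "cmod (ent (K1 * LU \<omega> v) i j) \<le> (\<Sum>l<n. cmod (ent K1 i l) * 1)"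
      unfolding ent_mult_left[OF that(2)]
      by (rule sum_norm_le)
         (use good_entry_le[OF \<open>\<omega> \<in> good\<close> that(1)] in \<open>auto simp: norm_mult intro!: mult_left_le\<close>)
  qed
  have bd': "\<exists>c. \<forall>\<omega>\<in>good. cmod (ent (LU \<omega> v * K1) i j) \<le> c" if "fst v \<in> I" "dimb n K1" for K1 v i j
  proof (intro exI ballI)
    fix \<omega> assume "\<omega> \<in> good"
    show "cmod (ent (LU \<omega> v * K1) i j) \<le> (\<Sum>l<n. 1 * cmod (ent K1 l j))"
      unfolding ent_mult_right[OF that(2)]
      by (rule sum_norm_le)
         (use good_entry_le[OF \<open>\<omega> \<in> good\<close> that(1)] in \<open>auto simp: norm_mult intro!: mult_left_le_one_le\<close>)
  qed
  have me: "mexpands (\<lambda>t \<omega>. ?T t \<omega> v) (\<lambda>\<omega>. LU \<omega> v) (\<lambda>\<omega>. ?D \<omega> v)" if v: "fst v \<in> I" for v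
    unfolding mexpands_def
  proof (intro conjI ballI allI)
    fix \<omega> assume g: "\<omega> \<in> good"
    show "dimb n (LU \<omega> v)" "dimb n (?D \<omega> v)" "dimb n (?T t \<omega> v)" for t
      using goodD(1)[OF g v] K(5) dK by (auto simp: del_def lett_translate)
  next
    fix i j
    let ?Q = "\<lambda>\<omega>. if v = v0 then K * K * LU \<omega> v else if v = flip v0 then LU \<omega> v * K * K else 0"
    obtain c1 where c1: "\<forall>\<omega>\<in>good. cmod (ent (?D \<omega> v) i j) \<le> c1"
    proof -
      have "\<exists>c. \<forall>\<omega>\<in>good. cmod (ent (?D \<omega> v) i j) \<le> c"
        using bd[OF v K(5), of i j] bd'[OF v K(5), of i j]
        by (cases "v = v0"; cases "v = flip v0") (auto simp: del_def)
      then show ?thesis using that by blast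
    qed
    obtain c2 where c2: "\<forall>\<omega>\<in>good. cmod (ent (?Q \<omega>) i j) \<le> c2"
    proof -
      have "dimb n (K * K)" using K(5) by simp
      then have "\<exists>c. \<forall>\<omega>\<in>good. cmod (ent (?Q \<omega>) i j) \<le> c"
        using bd[OF v, of "K * K" i j] bd'[OF v, of "K * K" i j]
        by (cases "v = v0"; cases "v = flip v0") (auto simp: mult.assoc)
      then show ?thesis using that by blast
    qed
    let ?c = "max 1 (max c1 c2)"
    have "expands (\<lambda>t \<omega>. ent (LU \<omega> v) i j + of_real (sin t) * ent (?D \<omega> v) i j + of_real (1 - cos t) * ent (?Q \<omega>) i j)
      (\<lambda>\<omega>. ent (LU \<omega> v) i j) (\<lambda>\<omega>. ent (?D \<omega> v) i j)"
      by (rule expands_rotation[where c = ?c])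
         (use good_entry_le[OF _ v] c1 c2 in \<open>simp_all add: le_max_iff_disj\<close>)
    then show "expands (\<lambda>t \<omega>. ent (?T t \<omega> v) i j) (\<lambda>\<omega>. ent (LU \<omega> v) i j) (\<lambda>\<omega>. ent (?D \<omega> v) i j)"
      by (rule expands_cong) (use lT[OF _ v] in simp_all)
  qed
  define F where "F t \<omega> = Tr (wv (?T t \<omega>) b w) * Tr (wv (?T t \<omega>) b' w')" for t \<omega>
  define F0 where "F0 \<omega> = Tr (wv (LU \<omega>) b w) * Tr (wv (LU \<omega>) b' w')" for \<omega>
  have ex: "expands F F0 (sd_term v0 K b w b' w')"
  proof (rule expands_cong)
    show "expands (\<lambda>t \<omega>. Tr (wv (?T t \<omega>) b w) * Tr (wv (?T t \<omega>) b' w'))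
       (\<lambda>\<omega>. Tr (wv (LU \<omega>) b w) * Tr (wv (LU \<omega>) b' w'))
       (\<lambda>\<omega>. Tr (wv (LU \<omega>) b w) * Tr (dwv (LU \<omega>) (?D \<omega>) b' w') + Tr (dwv (LU \<omega>) (?D \<omega>) b w) * Tr (wv (LU \<omega>) b' w'))"
      by (intro expands_mult mexpands_Tr mexpands_wv me b w)
  qed (simp_all add: F_def F0_def sd_term_def)
  have rT: "rmat (\<lambda>\<omega>. ?T t \<omega> v)" if "fst v \<in> I" for t v
    unfolding lett_translate using dK rmat_LU[OF that]
    by (cases "v = v0"; cases "v = flip v0") (auto intro!: rmat_mult rmat_const)
  have rD: "rmat (\<lambda>\<omega>. ?D \<omega> v)" if "fst v \<in> I" for v
    unfolding del_def using K(5) rmat_LU[OF that]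
    by (cases "v = v0"; cases "v = flip v0") (auto intro!: rmat_mult rmat_const rmat_uminus)
  have mF: "F t \<in> borel_measurable M" for t
    unfolding F_def by (intro borel_measurable_times rmat_Tr rmat_wvI rT b w)
  have mF0: "F0 \<in> borel_measurable M"
    unfolding F0_def by (intro borel_measurable_times rmat_Tr rmat_wvI rmat_LU b w)
  have mS: "sd_term v0 K b w b' w' \<in> borel_measurable M"
    unfolding sd_term_def
    by (intro borel_measurable_times borel_measurable_add rmat_Tr rmat_wvI rmat_dwvI rmat_LU rD b w)
  have const: "(\<integral>\<omega>. F t \<omega> \<partial>M) = (\<integral>\<omega>. F0 \<omega> \<partial>M)" for t
    unfolding F_def F0_def by (rule U_invariant) (use v0 rot b w in auto)
  show "integrable M (sd_term v0 K b w b' w')" "(\<integral>\<omega>. sd_term v0 K b w b' w' \<omega> \<partial>M) = 0"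
    using expands_integral_zero[OF ex mF mF0 mS const] by auto
qed

lemma sd_term_linear:
  "sd_term v0 (sc x K1 + sc y K2) b w b' w' \<omega> = x * sd_term v0 K1 b w b' w' \<omega> + y * sd_term v0 K2 b w b' w' \<omega>"
proof -
  have "del v0 (sc x K1 + sc y K2) u v = sc x (del v0 K1 u v) + sc y (del v0 K2 u v)" for u v
    by (rule fmat_eqI)
       (auto simp: del_def distrib_left distrib_right sc_mult_left sc_mult_right algebra_simps)
  then have *: "dwv L (del v0 (sc x K1 + sc y K2) u) b w = sc x (dwv L (del v0 K1 u) b w) + sc y (dwv L (del v0 K2 u) b w)"
    for L b w u by (rule dwv_linear)
  show ?thesis by (simp add: sd_term_def * Tr_add Tr_sc algebra_simps)
qed

text \<open>The matrix units are complex combinations of the directions covered by \<open>sd_special\<close>.\<close>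

lemma sd_mu:
  assumes v0: "fst v0 \<in> I" and ij: "i \<in> blk (fst v0)" "j \<in> blk (fst v0)"
    and b: "dimb n b" "dimb n b'" and w: "wordI w" "wordI w'"
  shows "integrable M (sd_term v0 (mu i j) b w b' w')" "(\<integral>\<omega>. sd_term v0 (mu i j) b w b' w' \<omega> \<partial>M) = 0"
proof -
  let ?P = "dproj (blk (fst v0))"
  note fin = finite_blk[OF v0]
  have n: "i < n" "j < n" using blk[OF v0] ij by auto
  have P: "?P * mu k l = mu k l" "mu k l * ?P = mu k l" if "k \<in> blk (fst v0)" "l \<in> blk (fst v0)" for k l
    using that by (auto intro!: fmat_eqI simp: dproj_mult[OF fin] mult_dproj[OF fin])
  define sp where "sp K \<longleftrightarrow> star_fmat K = - K \<and> K * K * K = - K \<and> ?P * K = K \<and> K * ?P = K \<and> dimb n K" for K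
  define R where "R K \<longleftrightarrow> integrable M (sd_term v0 K b w b' w') \<and> (\<integral>\<omega>. sd_term v0 K b w b' w' \<omega> \<partial>M) = 0" for K
  have lin: "R (mu i j)" if mu: "mu i j = sc x K1 + sc y K2" and K: "sp K1" "sp K2" for x y K1 K2
  proof -
    have s: "integrable M (sd_term v0 K b w b' w')" "(\<integral>\<omega>. sd_term v0 K b w b' w' \<omega> \<partial>M) = 0" if "sp K" for K
      using sd_special[OF v0 _ _ _ _ _ b w, of K] that unfolding sp_def by blast+
    have eq: "sd_term v0 (mu i j) b w b' w' = (\<lambda>\<omega>. x * sd_term v0 K1 b w b' w' \<omega> + y * sd_term v0 K2 b w b' w' \<omega>)"
      unfolding mu by (rule ext) (rule sd_term_linear)
    have "integrable M (sd_term v0 (mu i j) b w b' w')"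
      unfolding eq by (intro Bochner_Integration.integrable_add integrable_mult_right s K)
    moreover have "(\<integral>\<omega>. sd_term v0 (mu i j) b w b' w' \<omega> \<partial>M) = 0"
      unfolding eq using s[OF K(1)] s[OF K(2)] by simp
    ultimately show ?thesis by (simp add: R_def)
  qed
  have "R (mu i j)"
  proof (cases "i = j")
    case True
    let ?K = "sc \<i> (mu i i)"
    \<comment> \<open>The summand with coefficient 0 only brings a single direction into the
      two-term shape of \<open>lin\<close>.\<close>
    have mu: "mu i j = sc (- \<i>) ?K + sc 0 ?K" by (rule fmat_eqI) (auto simp: True)
    have "?K * ?K * ?K = sc (\<i> * \<i> * \<i>) (mu i i)"
      by (simp add: sc_mult_left sc_mult_right mu_mult_mu sc_sc mult.assoc)
    also have "\<dots> = - ?K" by (rule fmat_eqI) simp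
    finally have K3: "?K * ?K * ?K = - ?K" .
    have "star_fmat ?K = - ?K" by (rule fmat_eqI) auto
    then have K: "star_fmat ?K = - ?K \<and> ?K * ?K * ?K = - ?K \<and> ?P * ?K = ?K \<and> ?K * ?P = ?K \<and> dimb n ?K"
      using P[OF ij(1) ij(1)] n K3 by (simp add: sc_mult_left sc_mult_right dimb_mu)
    have s: "sp ?K" unfolding sp_def by (rule K)
    show ?thesis by (rule lin[OF mu s s])
  next
    case False
    \<comment> \<open>Both directions are anti-Hermitian with square -(E_ii + E_jj), whence K^3 =
      -K, and E_ij = (1/2) K1 - (\<i>/2) K2.\<close>
    let ?K1 = "mu i j - mu j i" and ?K2 = "sc \<i> (mu i j + mu j i)"
    have "x = 1 / 2 * (x - y) + (- \<i> / 2) * (\<i> * (x + y))" for x y :: complex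
      by (simp add: algebra_simps) (simp add: field_simps)
    then have mu: "mu i j = sc (1 / 2) ?K1 + sc (- \<i> / 2) ?K2"
      by (intro fmat_eqI) (simp only: ent_add ent_sc ent_diff)
    have "?K1 * ?K1 * ?K1 = - ?K1"
      using False by (simp add: left_diff_distrib right_diff_distrib mu_mult_mu)
    moreover have "star_fmat ?K1 = - ?K1" by (simp add: star_minus_fmat star_mu)
    ultimately have K1: "star_fmat ?K1 = - ?K1 \<and> ?K1 * ?K1 * ?K1 = - ?K1 \<and> ?P * ?K1 = ?K1 \<and> ?K1 * ?P = ?K1 \<and> dimb n ?K1"
      using P[OF ij] P[OF ij(2,1)] n by (simp add: left_diff_distrib right_diff_distrib dimb_mu)
    have "?K2 * ?K2 * ?K2 = sc (\<i> * \<i> * \<i>) (mu i j + mu j i)"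
      using False by (simp add: sc_mult_left sc_mult_right sc_sc mult.assoc distrib_left distrib_right mu_mult_mu)
         (rule fmat_eqI, simp only: ent_sc ent_add ent_uminus, simp add: algebra_simps)
    also have "\<dots> = - ?K2" by (rule fmat_eqI) (simp only: ent_sc ent_add ent_uminus, simp)
    finally have "?K2 * ?K2 * ?K2 = - ?K2" .
    moreover have "star_fmat ?K2 = - ?K2"
      by (rule fmat_eqI) (simp add: star_sc star_add_fmat star_mu algebra_simps del: ent_mu ent_star)
    ultimately have K2: "star_fmat ?K2 = - ?K2 \<and> ?K2 * ?K2 * ?K2 = - ?K2 \<and> ?P * ?K2 = ?K2 \<and> ?K2 * ?P = ?K2 \<and> dimb n ?K2"
      using P[OF ij] P[OF ij(2,1)] n 
      by (simp add: sc_mult_left sc_mult_right distrib_left distrib_right dimb_mu)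
    have s1: "sp ?K1" unfolding sp_def by (rule K1)
    have s2: "sp ?K2" unfolding sp_def by (rule K2)
    show ?thesis by (rule lin[OF mu s1 s2])
  qed
  then show "integrable M (sd_term v0 (mu i j) b w b' w')" "(\<integral>\<omega>. sd_term v0 (mu i j) b w b' w' \<omega> \<partial>M) = 0"
    by (simp_all add: R_def)
qed

text \<open>Contribution of the derivative at position m of the first word: the sum over matrix
  units cuts the trace there, before the letter \<open>v0\<close> but after its inverse. If the word
  starts with \<open>v0\<close>, position 0 produces the trace of the projection times the full
  trace, the leading term.\<close>

definition split_term :: "'i letter \<Rightarrow> ('i letter \<times> fmat) list \<Rightarrow> 'w \<Rightarrow> nat \<Rightarrow> complex" where
  "split_term v0 w \<omega> m = (let P = dproj (blk (fst v0)); v = fst (w ! m); c = snd (w ! m) in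
     if v = v0 then Tr (wv (LU \<omega>) P (take m w)) * Tr (wv (LU \<omega>) P (drop m w))
     else if v = flip v0 then
       - Tr (wv (LU \<omega>) P (take m w) * LU \<omega> v) * Tr (wv (LU \<omega>) (P * c) (drop (Suc m) w))
     else 0)"

text \<open>Contribution of the derivative in the second trace: the two traces are joined, with the
  second word rotated so that the cut falls next to the differentiated letter. One trace remains
  where a split term has three, counting the undifferentiated one.\<close>

definition merge_term ::
  "'i letter \<Rightarrow> ('i letter \<times> fmat) list \<Rightarrow> fmat \<Rightarrow> ('i letter \<times> fmat) list \<Rightarrow> 'w \<Rightarrow> nat \<Rightarrow> complex" where
  "merge_term v0 w b' w' \<omega> m = (let P = dproj (blk (fst v0)); v = fst (w' ! m); c = snd (w' ! m) in
     if v = v0 then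
       Tr (wv (LU \<omega>) P w * P * (LU \<omega> v * wv (LU \<omega>) c (drop (Suc m) w') * wv (LU \<omega>) b' (take m w')))
     else if v = flip v0 then
       - Tr (wv (LU \<omega>) P w * P * (wv (LU \<omega>) c (drop (Suc m) w') * wv (LU \<omega>) b' (take m w') * LU \<omega> v))
     else 0)"

text \<open>The mean-zero identity is taken in direction E_ij with E_ji as leading coefficient of
  the first word, and summed over i and j in the block. The two contraction formulas then remove all
  matrix units.\<close>

theorem schwinger_dyson:
  assumes v0: "fst v0 \<in> I" and b': "dimb n b'" and w: "wordI w" "wordI w'"
  shows "(\<integral>\<omega>. (\<Sum>m<length w. split_term v0 w \<omega> m) * Tr (wv (LU \<omega>) b' w') +
     (\<Sum>m<length w'. merge_term v0 w b' w' \<omega> m) \<partial>M) = 0"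
proof -
  let ?P = "dproj (blk (fst v0))"
  let ?B = "blk (fst v0)"
  note fin = finite_blk[OF v0]
  have PP: "?P * ?P = ?P" using fin by (simp add: dproj_dproj)
  have n: "i < n" if "i \<in> ?B" for i using blk[OF v0] that by auto
  have muP: "mu k l * ?P = mu k l" if "k \<in> ?B" "l \<in> ?B" for k l
    using that by (auto intro!: fmat_eqI simp: mult_dproj[OF fin])
  have wvmu: "wv L (mu k l) u = mu k l * wv L ?P u" if "k \<in> ?B" "l \<in> ?B" for L k l u
    using wv_mult_left[of L "mu k l" ?P u] muP[OF that] by simp
  define D where "D \<omega> i j = del v0 (mu i j) (\<lambda>i. U i \<omega>)" for \<omega> i j
  have split: "(\<Sum>i\<in>?B. \<Sum>j\<in>?B. Tr (dwv (LU \<omega>) (D \<omega> i j) (mu j i) w)) = (\<Sum>m<length w. split_term v0 w \<omega> m)"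
    if g: "\<omega> \<in> good" for \<omega>
  proof -
    have "(\<Sum>i\<in>?B. \<Sum>j\<in>?B. Tr (wv (LU \<omega>) (mu j i) (take m w) * D \<omega> i j (fst (w ! m)) *
        wv (LU \<omega>) (snd (w ! m)) (drop (Suc m) w))) = split_term v0 w \<omega> m" (is "?L = _") if m: "m < length w" for m
    proof -
      let ?v = "fst (w ! m)" and ?c = "snd (w ! m)"
      have dr: "drop m w = (?v, ?c) # drop (Suc m) w" using m by (simp add: Cons_nth_drop_Suc)
      let ?X = "wv (LU \<omega>) ?P (take m w)" and ?Y = "wv (LU \<omega>) ?c (drop (Suc m) w)"
      have PX: "?P * ?X = ?X" using wv_mult_left[of "LU \<omega>" ?P ?P] PP by simp
      consider "?v = v0" | "?v = flip v0" | "?v \<noteq> v0" "?v \<noteq> flip v0" by blast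
      then show ?thesis
      proof cases
        case 1
        have "?L = (\<Sum>i\<in>?B. \<Sum>j\<in>?B. Tr (mu j i * ?X * mu i j * (LU \<omega> v0 * ?Y)))"
          by (intro sum.cong refl) (simp add: wvmu D_def del_def 1 mult.assoc)
        also have "\<dots> = Tr (?P * ?X) * Tr (?P * (LU \<omega> v0 * ?Y))" by (rule sum_mu_split[OF fin])
        finally show ?thesis using 1 PX dr by (simp add: split_term_def Let_def mult.assoc)
      next
        case 2
        have "?L = (\<Sum>i\<in>?B. \<Sum>j\<in>?B. - Tr (mu j i * (?X * LU \<omega> ?v) * mu i j * ?Y))"
          by (intro sum.cong refl) (simp add: wvmu D_def del_def 2 mult.assoc Tr_uminus)
        also have "\<dots> = - (Tr (?P * (?X * LU \<omega> ?v)) * Tr (?P * ?Y))"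
          by (simp only: sum_negf sum_mu_split[OF fin])
        finally show ?thesis using 2 PX by (simp add: split_term_def Let_def mult.assoc[symmetric] wv_mult_left)
      next
        case 3
        then show ?thesis by (simp add: split_term_def Let_def D_def del_def)
      qed
    qed
    then have "(\<Sum>m<length w. \<Sum>i\<in>?B. \<Sum>j\<in>?B. Tr (wv (LU \<omega>) (mu j i) (take m w) * D \<omega> i j (fst (w ! m)) *
        wv (LU \<omega>) (snd (w ! m)) (drop (Suc m) w))) = (\<Sum>m<length w. split_term v0 w \<omega> m)"
      by (intro sum.cong) auto
    moreover have "(\<Sum>i\<in>?B. \<Sum>j\<in>?B. Tr (dwv (LU \<omega>) (D \<omega> i j) (mu j i) w)) = 
       (\<Sum>m<length w. \<Sum>i\<in>?B. \<Sum>j\<in>?B. Tr (wv (LU \<omega>) (mu j i) (take m w) * D \<omega> i j (fst (w ! m)) *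
        wv (LU \<omega>) (snd (w ! m)) (drop (Suc m) w)))"
      unfolding dwv_sum Tr_sum by (rule sum_rotate)
    ultimately show ?thesis by simp
  qed
  have merge: "(\<Sum>i\<in>?B. \<Sum>j\<in>?B. Tr (wv (LU \<omega>) (mu j i) w) * Tr (dwv (LU \<omega>) (D \<omega> i j) b' w')) =
      (\<Sum>m<length w'. merge_term v0 w b' w' \<omega> m)" for \<omega>
  proof -
    let ?W = "wv (LU \<omega>) ?P w"
    have PW: "?P * ?W = ?W" using wv_mult_left[of "LU \<omega>" ?P ?P] PP by simp
    have "(\<Sum>i\<in>?B. \<Sum>j\<in>?B. Tr (wv (LU \<omega>) (mu j i) w) * Tr (wv (LU \<omega>) b' (take m w') * D \<omega> i j (fst (w' ! m)) *
        wv (LU \<omega>) (snd (w' ! m)) (drop (Suc m) w'))) = merge_term v0 w b' w' \<omega> m" (is "?L = _") for m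
    proof -
      let ?v = "fst (w' ! m)" and ?c = "snd (w' ! m)"
      let ?X = "wv (LU \<omega>) b' (take m w')" and ?Y = "wv (LU \<omega>) ?c (drop (Suc m) w')"
      consider "?v = v0" | "?v = flip v0" | "?v \<noteq> v0" "?v \<noteq> flip v0" by blast
      then show ?thesis
      proof cases
        case 1
        have "Tr (?X * D \<omega> i j ?v * ?Y) = Tr (mu i j * (LU \<omega> ?v * ?Y * ?X))" for i j
          using Tr_commute[of ?X "D \<omega> i j ?v * ?Y"] by (simp add: D_def del_def 1 mult.assoc)
        then have "?L = (\<Sum>i\<in>?B. \<Sum>j\<in>?B. Tr (mu j i * ?W) * Tr (mu i j * (LU \<omega> ?v * ?Y * ?X)))"
          by (intro sum.cong refl) (simp only: wvmu)
        then show ?thesis using 1 PW by (simp add: sum_mu_merge[OF fin] merge_term_def Let_def)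
      next
        case 2
        have "Tr (?X * D \<omega> i j ?v * ?Y) = - Tr (mu i j * (?Y * ?X * LU \<omega> ?v))" for i j
          using Tr_commute[of "?X * LU \<omega> ?v" "mu i j * ?Y"] by (simp add: D_def del_def 2 mult.assoc Tr_uminus)
        then have "?L = (\<Sum>i\<in>?B. \<Sum>j\<in>?B. - (Tr (mu j i * ?W) * Tr (mu i j * (?Y * ?X * LU \<omega> ?v))))"
          by (intro sum.cong refl) (simp only: wvmu mult_minus_right)
        then show ?thesis using 2 PW 
          by (simp add: sum_negf sum_mu_merge[OF fin] merge_term_def Let_def)
      next
        case 3
        then show ?thesis by (simp add: merge_term_def Let_def D_def del_def)
      qed
    qed
    then have "(\<Sum>m<length w'. \<Sum>i\<in>?B. \<Sum>j\<in>?B. Tr (wv (LU \<omega>) (mu j i) w) * Tr (wv (LU \<omega>) b' (take m w') * D \<omega> i j (fst (w' ! m)) *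
        wv (LU \<omega>) (snd (w' ! m)) (drop (Suc m) w'))) = (\<Sum>m<length w'. merge_term v0 w b' w' \<omega> m)"
      by (intro sum.cong) auto
    moreover have "(\<Sum>i\<in>?B. \<Sum>j\<in>?B. Tr (wv (LU \<omega>) (mu j i) w) * Tr (dwv (LU \<omega>) (D \<omega> i j) b' w')) = 
       (\<Sum>m<length w'. \<Sum>i\<in>?B. \<Sum>j\<in>?B. Tr (wv (LU \<omega>) (mu j i) w) * Tr (wv (LU \<omega>) b' (take m w') * D \<omega> i j (fst (w' ! m)) *
        wv (LU \<omega>) (snd (w' ! m)) (drop (Suc m) w')))"
      unfolding dwv_sum Tr_sum sum_distrib_left by (rule sum_rotate)
    ultimately show ?thesis by simp
  qed
  have eq: "(\<Sum>i\<in>?B. \<Sum>j\<in>?B. sd_term v0 (mu i j) (mu j i) w b' w' \<omega>) =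
      (\<Sum>m<length w. split_term v0 w \<omega> m) * Tr (wv (LU \<omega>) b' w') +
      (\<Sum>m<length w'. merge_term v0 w b' w' \<omega> m)" if "\<omega> \<in> good" for \<omega>
    unfolding sd_term_def D_def[symmetric] sum.distrib sum_distrib_right[symmetric] split[OF that] merge
    by simp
  note sd = sd_mu[OF v0 _ _ dimb_mu[OF n n] b' w]
  have "(\<integral>\<omega>. (\<Sum>i\<in>?B. \<Sum>j\<in>?B. sd_term v0 (mu i j) (mu j i) w b' w' \<omega>) \<partial>M) = 0"
    using sd by (simp add: Bochner_Integration.integral_sum)
  moreover have "(\<integral>\<omega>. (\<Sum>i\<in>?B. \<Sum>j\<in>?B. sd_term v0 (mu i j) (mu j i) w b' w' \<omega>) \<partial>M) =
     (\<integral>\<omega>. (\<Sum>m<length w. split_term v0 w \<omega> m) * Tr (wv (LU \<omega>) b' w') +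
     (\<Sum>m<length w'. merge_term v0 w b' w' \<omega> m) \<partial>M)"
  proof (rule integral_cong_AE)
    have rP: "rmat (\<lambda>\<omega>. LU \<omega> v)" if "fst v \<in> I" for v by (rule rmat_LU[OF that])
    show "(\<lambda>\<omega>. \<Sum>i\<in>?B. \<Sum>j\<in>?B. sd_term v0 (mu i j) (mu j i) w b' w' \<omega>) \<in> borel_measurable M"
      using sd(1) by (intro borel_measurable_sum borel_measurable_integrable)
    have nth: "fst (fst (u ! m)) \<in> I" "dimb n (snd (u ! m))" if "wordI u" "m < length u" for u m
      using that by auto
    have wI: "wordI (take m u)" "wordI (drop m u)" if "wordI u" for m u
      using that by (meson in_set_takeD in_set_dropD)+
    show "(\<lambda>\<omega>. (\<Sum>m<length w. split_term v0 w \<omega> m) * Tr (wv (LU \<omega>) b' w') +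
     (\<Sum>m<length w'. merge_term v0 w b' w' \<omega> m)) \<in> borel_measurable M"
    proof (intro borel_measurable_add borel_measurable_times borel_measurable_sum rmat_Tr rmat_wvI rP b' w)
      show "(\<lambda>\<omega>. split_term v0 w \<omega> m) \<in> borel_measurable M" if "m \<in> {..<length w}" for m
        unfolding split_term_def Let_def
        using nth[OF w(1)] that dimb_blk[OF v0]
        by (cases "fst (w ! m) = v0"; cases "fst (w ! m) = flip v0")
           (simp_all, (intro borel_measurable_times borel_measurable_uminus rmat_Tr rmat_mult rmat_wvI
              rP wI w dimb_blk v0 dimb_mult; simp)+)
      show "(\<lambda>\<omega>. merge_term v0 w b' w' \<omega> m) \<in> borel_measurable M" if "m \<in> {..<length w'}" for m
        unfolding merge_term_def Let_def
        using nth[OF w(2)] that dimb_blk[OF v0]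
        by (cases "fst (w' ! m) = v0"; cases "fst (w' ! m) = flip v0")
           (simp_all, (intro borel_measurable_times borel_measurable_uminus rmat_Tr rmat_mult rmat_wvI
              rmat_const rP wI w b' dimb_blk v0 dimb_mult; simp)+)
    qed
    show "AE \<omega> in M. (\<Sum>i\<in>?B. \<Sum>j\<in>?B. sd_term v0 (mu i j) (mu j i) w b' w' \<omega>) =
      (\<Sum>m<length w. split_term v0 w \<omega> m) * Tr (wv (LU \<omega>) b' w') +
      (\<Sum>m<length w'. merge_term v0 w b' w' \<omega> m)"
      using AE_good by (rule eventually_mono) (rule eq)
  qed
  ultimately show ?thesis by simp
qed

end

section \<open>Asymptotics of words\<close>

text \<open>\<open>Dt\<close> is a star-algebra of sequences of constant matrices containing the
  block projections and the unit; the only analytic information on it is convergence of normalized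
  traces. A nonzero \<rho> keeps each block proportional to n, which permits division by the trace
  of its projection.\<close>

locale haar_sequence = prob_sequence \<Omega> d
  for \<Omega> :: "nat \<Rightarrow> 'w measure" and d :: nat +
  fixes I :: "'i set" and blk :: "nat \<Rightarrow> 'i \<Rightarrow> nat set" and U :: "'i \<Rightarrow> nat \<Rightarrow> 'w \<Rightarrow> fmat"
    and \<rho> :: "'i \<Rightarrow> complex" and Dt :: "(nat \<Rightarrow> fmat) set"
  assumes d_pos: "d > 0"
    and haar: "n \<ge> d \<Longrightarrow> haar_family (\<Omega> n) n I (blk n) (\<lambda>i. U i n)"
    and ratio: "i \<in> I \<Longrightarrow> (\<lambda>n. of_nat (card (blk n i)) / of_nat n) \<longlonglongrightarrow> \<rho> i"
    and ratio_nonzero: "i \<in> I \<Longrightarrow> \<rho> i \<noteq> 0"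
    and Dt_dim: "\<lbrakk>x \<in> Dt; n \<ge> d\<rbrakk> \<Longrightarrow> dimb n (x n)"
    and Dt_mult: "\<lbrakk>x \<in> Dt; y \<in> Dt\<rbrakk> \<Longrightarrow> (\<lambda>n. x n * y n) \<in> Dt"
    and Dt_add: "\<lbrakk>x \<in> Dt; y \<in> Dt\<rbrakk> \<Longrightarrow> (\<lambda>n. x n + y n) \<in> Dt"
    and Dt_sc: "x \<in> Dt \<Longrightarrow> (\<lambda>n. sc c (x n)) \<in> Dt"
    and Dt_star: "x \<in> Dt \<Longrightarrow> (\<lambda>n. star_fmat (x n)) \<in> Dt"
    and Dt_proj: "i \<in> I \<Longrightarrow> (\<lambda>n. dproj (blk n i)) \<in> Dt"
    and Dt_one: "(\<lambda>n. dproj {..<n}) \<in> Dt"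
    and Dt_conv: "x \<in> Dt \<Longrightarrow> convergent (\<lambda>n. Tr (x n) / of_nat n)"
begin

abbreviation "LUs n \<omega> \<equiv> lett (\<lambda>i. U i n \<omega>)"

definition evl :: "nat \<Rightarrow> ('v \<times> (nat \<Rightarrow> fmat)) list \<Rightarrow> ('v \<times> fmat) list" where
  "evl n = map (\<lambda>(v, c). (v, c n))"

definition WV :: "(nat \<Rightarrow> fmat) \<Rightarrow> ('i letter \<times> (nat \<Rightarrow> fmat)) list \<Rightarrow> nat \<Rightarrow> 'w \<Rightarrow> fmat" where
  "WV b w n \<omega> = wv (LUs n \<omega>) (b n) (evl n w)"

definition ntr :: "(nat \<Rightarrow> 'w \<Rightarrow> fmat) \<Rightarrow> nat \<Rightarrow> 'w \<Rightarrow> complex" where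
  "ntr X n \<omega> = Tr (X n \<omega>) / of_nat n"

abbreviation "sword w \<equiv> \<forall>x\<in>set w. fst (fst x) \<in> I \<and> snd x \<in> Dt"

lemma evl_simps [simp]: "evl n [] = []" "evl n ((v, c) # w) = (v, c n) # evl n w"
  "evl n (u @ w) = evl n u @ evl n w" "length (evl n w) = length w"
  "take m (evl n w) = evl n (take m w)" "drop m (evl n w) = evl n (drop m w)"
  by (simp_all add: evl_def take_map drop_map)

lemma evl_nth: "m < length w \<Longrightarrow> evl n w ! m = (fst (w ! m), snd (w ! m) n)"
  by (simp add: evl_def case_prod_beta)

lemma WV_Nil [simp]: "WV b [] n \<omega> = b n"
  and WV_Cons: "WV b ((v, c) # w) n \<omega> = b n * LUs n \<omega> v * WV c w n \<omega>"
  and WV_append: "WV b (u @ (v, c) # w) n \<omega> = WV b u n \<omega> * LUs n \<omega> v * WV c w n \<omega>"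
  and WV_mult_left: "WV (\<lambda>n. a n * b n) w n \<omega> = a n * WV b w n \<omega>"
  by (simp_all add: WV_def wv_append wv_mult_left)

text \<open>The adjoint reverses the word and flips its letters. The conjugate of a word trace is
  thus a word trace, and a squared modulus fits the two-trace equation.\<close>

lemma WV_star:
  assumes "b \<in> Dt" "sword w"
  shows "\<exists>b'\<in>Dt. \<exists>w'. sword w' \<and> (\<forall>n \<omega>. star_fmat (WV b w n \<omega>) = WV b' w' n \<omega>)"
  using assms
proof (induction w arbitrary: b)
  case Nil
  have "star_fmat (WV b [] n \<omega>) = WV (\<lambda>n. star_fmat (b n)) [] n \<omega>" for n \<omega> by simp
  then show ?case using Dt_star[OF Nil(1)]
    by (intro bexI[of _ "\<lambda>n. star_fmat (b n)"] exI[of _ "[]"]) auto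
next
  case (Cons x w)
  obtain v e where x: "x = (v, e)" by (cases x)
  have "\<exists>b'\<in>Dt. \<exists>w'. sword w' \<and> (\<forall>n \<omega>. star_fmat (WV e w n \<omega>) = WV b' w' n \<omega>)"
    using Cons.prems x by (intro Cons.IH) auto
  then obtain b' w' where b': "b' \<in> Dt" "sword w'"
    and eq: "\<And>n \<omega>. star_fmat (WV e w n \<omega>) = WV b' w' n \<omega>"
    by blast
  have "star_fmat (WV b (x # w) n \<omega>) = WV b' (w' @ [(flip v, \<lambda>n. star_fmat (b n))]) n \<omega>" for n \<omega>
    by (simp add: x WV_Cons star_mult_fmat mult.assoc eq WV_append lett_flip)
  moreover have "sword (w' @ [(flip v, \<lambda>n. star_fmat (b n))])"
    using Cons.prems b' x Dt_star by auto
  ultimately show ?case using b'(1) by blast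
qed

subsection \<open>Uniform bounds\<close>

definition atoms :: "(nat \<Rightarrow> 'w \<Rightarrow> fmat) set" where
  "atoms = (\<lambda>x n \<omega>. x n) ` Dt \<union> (\<lambda>v n \<omega>. LUs n \<omega> v) ` {v. fst v \<in> I}"

definition products :: "(nat \<Rightarrow> 'w \<Rightarrow> fmat) set" where
  "products = {\<lambda>n \<omega>. nprod (map (\<lambda>x. x n \<omega>) xs) | xs. xs \<noteq> [] \<and> set xs \<subseteq> atoms}"

lemma products_atom: "x \<in> atoms \<Longrightarrow> x \<in> products"
  unfolding products_def by (auto intro!: exI[of _ "[x]"])

lemma products_Dt: "x \<in> Dt \<Longrightarrow> (\<lambda>n \<omega>. x n) \<in> products"
  and products_letter: "fst v \<in> I \<Longrightarrow> (\<lambda>n \<omega>. LUs n \<omega> v) \<in> products"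
  by (auto intro!: products_atom simp: atoms_def simp del: lett.simps)

lemma products_mult:
  assumes "X \<in> products" "Y \<in> products" shows "(\<lambda>n \<omega>. X n \<omega> * Y n \<omega>) \<in> products"
proof -
  obtain xs ys where "xs \<noteq> []" "set xs \<subseteq> atoms" "X = (\<lambda>n \<omega>. nprod (map (\<lambda>x. x n \<omega>) xs))"
    "ys \<noteq> []" "set ys \<subseteq> atoms" "Y = (\<lambda>n \<omega>. nprod (map (\<lambda>x. x n \<omega>) ys))"
    using assms by (auto simp: products_def)
  then show ?thesis
    unfolding products_def by (auto intro!: exI[of _ "xs @ ys"] simp: nprod_append)
qed

lemma products_WV: "b \<in> Dt \<Longrightarrow> sword w \<Longrightarrow> WV b w \<in> products"
proof (induction w arbitrary: b)
  case Nil
  then show ?case using products_Dt by (simp add: WV_def)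
next
  case (Cons x w)
  obtain v e where x: "x = (v, e)" by (cases x)
  have "(\<lambda>n \<omega>. b n * LUs n \<omega> v * WV e w n \<omega>) \<in> products"
    using Cons x by (intro products_mult products_Dt products_letter) auto
  then show ?case by (simp add: x WV_Cons[abs_def])
qed

abbreviation "good_event n \<equiv> haar_family.good (\<Omega> n) I (blk n) (\<lambda>i. U i n)"

lemma atoms_Dt: "y \<in> Dt \<Longrightarrow> (\<lambda>n \<omega>. y n) \<in> atoms"
  and atoms_letter: "fst v \<in> I \<Longrightarrow> (\<lambda>n \<omega>. LUs n \<omega> v) \<in> atoms"
  by (simp_all add: atoms_def)

lemma atoms_cases:
  assumes "x \<in> atoms"
  obtains y where "y \<in> Dt" "x = (\<lambda>n \<omega>. y n)" | v where "fst v \<in> I" "x = (\<lambda>n \<omega>. LUs n \<omega> v)"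
  using assms unfolding atoms_def by blast

lemma atoms_star: assumes "x \<in> atoms" shows "(\<lambda>n \<omega>. star_fmat (x n \<omega>)) \<in> atoms"
  using assms
proof (cases rule: atoms_cases)
  case (1 y)
  then show ?thesis using atoms_Dt[OF Dt_star[OF 1(1)]] by simp
next
  case (2 v)
  then show ?thesis using atoms_letter[of "flip v"] by (simp add: lett_flip)
qed

lemma atoms_rmat: "x \<in> atoms \<Longrightarrow> n \<ge> d \<Longrightarrow> random_matrix.rmat (\<Omega> n) n (x n)"
  by (erule atoms_cases) (simp_all add: random_matrix.rmat_const Dt_dim haar_family.rmat_LU[OF haar])

lemma atoms_dim: "x \<in> atoms \<Longrightarrow> n \<ge> d \<Longrightarrow> \<omega> \<in> good_event n \<Longrightarrow> dimb n (x n \<omega>)"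
  by (erule atoms_cases) (simp_all add: Dt_dim haar_family.goodD[OF haar])

text \<open>For a sequence in \<open>Dt\<close> the power stays in \<open>Dt\<close>, so its
  normalized traces converge and are bounded; for a letter the power is the block
  projection.\<close>

lemma atoms_starpow_bound:
  assumes "x \<in> atoms"
  shows "\<exists>C. \<forall>n\<ge>d. \<forall>\<omega>\<in>good_event n. cmod (Tr (starpow (Suc k) (x n \<omega>))) \<le> C * real n"
  using assms
proof (cases rule: atoms_cases)
    case (1 y)
    have "(\<lambda>n. starpow k (y n)) \<in> Dt" for k
      by (induction k) (use 1 Dt_mult Dt_star in auto)
    then have "convergent (\<lambda>n. Tr (starpow (Suc k) (y n)) / of_nat n)" by (rule Dt_conv)
    then obtain K where K: "\<And>n. cmod (Tr (starpow (Suc k) (y n)) / of_nat n) \<le> K"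
      using convergent_imp_Bseq[of "\<lambda>n. Tr (starpow (Suc k) (y n)) / of_nat n"]
      unfolding Bseq_def by blast
    have "cmod (Tr (starpow (Suc k) (y n))) \<le> K * real n" if "n \<ge> d" for n
      using K[of n] that d_pos by (simp add: norm_divide divide_le_eq)
    then show ?thesis using 1 by auto
  next
    case (2 v)
    have "cmod (Tr (starpow (Suc k) (x n \<omega>))) \<le> 1 * real n" if n: "n \<ge> d" and w: "\<omega> \<in> good_event n" for n \<omega>
    proof -
      interpret haar_family "\<Omega> n" n I "blk n" "\<lambda>i. U i n" by (rule haar[OF n])
      have fin: "finite (blk n (fst v))" by (rule finite_blk[OF 2(1)])
      have "starpow (Suc k) (x n \<omega>) = dproj (blk n (fst v))" for k
      proof (induction k)
        case 0
        show ?case using goodD(2)[OF w 2(1)] by (simp add: 2(2) lett_flip)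
      next
        case (Suc k)
        have "starpow (Suc (Suc k)) (x n \<omega>) = starpow (Suc k) (x n \<omega>) * star_fmat (starpow (Suc k) (x n \<omega>))"
          by (rule starpow.simps)
        then show ?case unfolding Suc using fin by (simp add: star_dproj dproj_dproj)
      qed
      moreover have "card (blk n (fst v)) \<le> n"
        using card_mono[OF _ blk[OF 2(1)]] by simp
      ultimately show ?thesis by (simp add: Tr_dproj)
    qed
    then show ?thesis by blast
qed

lemma products_bound:
  assumes "X \<in> products"
  shows "\<exists>C. \<forall>n\<ge>d. \<forall>\<omega>\<in>good_event n. cmod (Tr (X n \<omega>)) \<le> C * real n"
proof -
  obtain xs where xs: "xs \<noteq> []" "set xs \<subseteq> atoms" and X: "X = (\<lambda>n \<omega>. nprod (map (\<lambda>x. x n \<omega>) xs))"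
    using assms by (auto simp: products_def)
  define one :: "nat \<Rightarrow> 'w \<Rightarrow> fmat" where "one = (\<lambda>n \<omega>. dproj {..<n})"
  have one: "one \<in> atoms" using Dt_one by (auto simp: one_def atoms_def)
  obtain k where k: "length xs = Suc k" using xs(1) by (cases xs) auto
  \<comment> \<open>Padding by the identity brings the length to a power of two without changing the
    product. The exponent is the original length, large enough because m < 2^m.\<close>
  define ys where "ys = xs @ replicate (2 ^ Suc k - length xs) one"
  have len: "length ys = 2 ^ Suc k"
    using less_exp[of "Suc k"] k by (simp add: ys_def)
  \<comment> \<open>The alphabet has to be finite and closed under adjoints. The constants
    \<open>C x\<close> do not depend on n, so their maximum over \<open>T\<close> is a uniform
    bound.\<close>
  define T where "T = set ys \<union> (\<lambda>x n \<omega>. star_fmat (x n \<omega>)) ` set ys"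
  have T: "finite T" "T \<subseteq> atoms" using xs(2) one atoms_star by (auto simp: T_def ys_def)
  obtain C where C: "\<And>x n \<omega>. x \<in> T \<Longrightarrow> n \<ge> d \<Longrightarrow> \<omega> \<in> good_event n \<Longrightarrow>
      cmod (Tr (starpow (Suc k) (x n \<omega>))) \<le> C x * real n"
  proof -
    have "\<forall>x\<in>T. \<exists>C. \<forall>n\<ge>d. \<forall>\<omega>\<in>good_event n. cmod (Tr (starpow (Suc k) (x n \<omega>))) \<le> C * real n"
      using atoms_starpow_bound T(2) by blast
    from bchoice[OF this] show ?thesis using that by blast
  qed
  have "cmod (Tr (X n \<omega>)) \<le> Max (C ` T) * real n" if n: "n \<ge> d" and w: "\<omega> \<in> good_event n" for n \<omega>
  proof -
    let ?f = "\<lambda>x. x n \<omega>"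
    have pad: "nprod (map ?f (xs @ replicate m one)) = nprod (map ?f xs)" for m
    proof (induction m)
      case (Suc m)
      have dim: "dimb n (nprod us)" if "us \<noteq> []" "\<forall>u\<in>set us. dimb n u" for us
        using that by (induction us rule: nprod.induct) auto
      have "dimb n (nprod (map ?f (xs @ replicate m one)))"
        using xs one atoms_dim[OF _ n w] by (intro dim) auto
      moreover have "nprod (map ?f (xs @ replicate (Suc m) one)) =
          nprod (map ?f (xs @ replicate m one)) * one n \<omega>"
        using xs(1) nprod_append[of "map ?f (xs @ replicate m one)" "[one n \<omega>]"]
        by (simp add: replicate_append_same[symmetric] del: replicate_append_same replicate.simps)
           (simp add: replicate_append_same[symmetric] flip: replicate_append_same)
      ultimately show ?case using Suc by (simp add: one_def dproj_mult_id)
    qed simp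
    have "\<exists>x\<in>?f ` T. cmod (Tr (nprod (map ?f ys))) \<le> cmod (Tr (starpow (Suc k) x))"
    proof (rule Tr_word_bound)
      show "finite (?f ` T)" using T by simp
      show "set (map ?f ys) \<subseteq> ?f ` T" by (auto simp: T_def)
      show "length (map ?f ys) = 2 ^ Suc k" using len by simp
      show "star_fmat x \<in> ?f ` T" if "x \<in> ?f ` T" for x
      proof -
        from that obtain y where y: "y \<in> T" "x = y n \<omega>" by blast
        show ?thesis
        proof (cases "y \<in> set ys")
          case True
          then have "(\<lambda>n \<omega>. star_fmat (y n \<omega>)) \<in> T" by (auto simp: T_def)
          then show ?thesis using y by (force intro: image_eqI[rotated])
        next
          case False
          then obtain z where "z \<in> set ys" "y = (\<lambda>n \<omega>. star_fmat (z n \<omega>))" using y by (auto simp: T_def)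
          then show ?thesis using y by (auto simp: T_def)
        qed
      qed
    qed
    then obtain x where x: "x \<in> T" "cmod (Tr (nprod (map ?f ys))) \<le> cmod (Tr (starpow (Suc k) (x n \<omega>)))"
      by auto
    have "cmod (Tr (X n \<omega>)) \<le> C x * real n"
      using x(2) C[OF x(1) n w] pad[of "2 ^ Suc k - length xs"] by (simp add: X ys_def del: starpow.simps)
    also have "\<dots> \<le> Max (C ` T) * real n"
      using T x by (intro mult_right_mono Max_ge) auto
    finally show ?thesis .
  qed
  then show ?thesis by blast
qed

lemma products_rmat: assumes "X \<in> products" "n \<ge> d" shows "random_matrix.rmat (\<Omega> n) n (X n)"
proof -
  interpret haar_family "\<Omega> n" n I "blk n" "\<lambda>i. U i n" by (rule haar[OF assms(2)])
  obtain xs where xs: "xs \<noteq> []" "set xs \<subseteq> atoms" and X: "X = (\<lambda>n \<omega>. nprod (map (\<lambda>x. x n \<omega>) xs))"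
    using assms by (auto simp: products_def)
  have "rmat (\<lambda>\<omega>. nprod (map (\<lambda>x. x n \<omega>) xs))"
    using xs
  proof (induction xs)
    case (Cons x xs)
    have x: "rmat (x n)" using atoms_rmat[OF _ assms(2)] Cons.prems by simp
    then show ?case using Cons by (cases "xs = []") (auto simp: nprod_Cons intro!: rmat_mult)
  qed simp
  then show ?thesis by (simp add: X)
qed

lemma products_bdd: assumes "X \<in> products" shows "bdd (ntr X)"
proof -
  obtain C where C: "\<And>n \<omega>. n \<ge> d \<Longrightarrow> \<omega> \<in> good_event n \<Longrightarrow> cmod (Tr (X n \<omega>)) \<le> C * real n"
    using products_bound[OF assms] by blast
  show ?thesis
  proof (rule bddI[where C = C])
    fix n assume n: "d \<le> n"
    interpret haar_family "\<Omega> n" n I "blk n" "\<lambda>i. U i n" by (rule haar[OF n])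
    show "ntr X n \<in> borel_measurable (\<Omega> n)"
      unfolding ntr_def using rmat_Tr[OF products_rmat[OF assms n]] by simp
    show "AE \<omega> in \<Omega> n. cmod (ntr X n \<omega>) \<le> C"
      using AE_good
    proof eventually_elim
      case (elim \<omega>)
      then show ?case using C[OF n, of \<omega>] n d_pos by (simp add: ntr_def norm_divide divide_le_eq)
    qed
  qed
qed

subsection \<open>Reduced words have vanishing traces\<close>

text \<open>The coefficient standing between the two letters is stored with the left one. The
  condition bites only if the letters are mutually inverse, and then concerns the trace on their
  common block.\<close>

definition reduced_at :: "('i letter \<times> (nat \<Rightarrow> fmat)) \<Rightarrow> ('i letter \<times> (nat \<Rightarrow> fmat)) \<Rightarrow> bool" where
  "reduced_at x y \<longleftrightarrow> (fst y = flip (fst x) \<longrightarrow>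
     (\<lambda>n. Tr (snd x n * dproj (blk n (fst (fst x)))) / of_nat n) \<longlonglongrightarrow> 0)"

definition reduced :: "('i letter \<times> (nat \<Rightarrow> fmat)) list \<Rightarrow> bool" where
  "reduced w \<longleftrightarrow> (\<forall>m. Suc m < length w \<longrightarrow> reduced_at (w ! m) (w ! Suc m))"

lemma reduced_take: "reduced w \<Longrightarrow> reduced (take m w)"
  and reduced_tl: "reduced (x # w) \<Longrightarrow> reduced w"
  by (auto simp: reduced_def)

text \<open>The last coefficient does not stand between two letters; it will absorb the leading
  coefficient after a cyclic rotation.\<close>

lemma reduced_change_last:
  assumes "reduced (u @ [(v, c)])" shows "reduced (u @ [(v, c')])"
  unfolding reduced_def
proof (intro allI impI)
  fix m assume m: "Suc m < length (u @ [(v, c')])"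
  have "reduced_at ((u @ [(v, c)]) ! m) ((u @ [(v, c)]) ! Suc m)"
    using assms m by (auto simp: reduced_def)
  moreover have "(u @ [(v, c')]) ! m = (u @ [(v, c)]) ! m" using m by (auto simp: nth_append)
  moreover have "fst ((u @ [(v, c')]) ! Suc m) = fst ((u @ [(v, c)]) ! Suc m)"
    using m by (auto simp: nth_append less_Suc_eq)
  ultimately show "reduced_at ((u @ [(v, c')]) ! m) ((u @ [(v, c')]) ! Suc m)"
    by (simp add: reduced_at_def)
qed

abbreviation "blkP i \<equiv> (\<lambda>n. dproj (blk n i))"

lemma null_ntr_cong:
  assumes "null (ntr X)" "Y \<in> products" "\<And>n \<omega>. n \<ge> d \<Longrightarrow> \<omega> \<in> good_event n \<Longrightarrow> Tr (X n \<omega>) = Tr (Y n \<omega>)"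
  shows "null (ntr Y)"
proof (rule null_cong[OF assms(1)])
  fix n assume n: "d \<le> n"
  interpret haar_family "\<Omega> n" n I "blk n" "\<lambda>i. U i n" by (rule haar[OF n])
  show "ntr Y n \<in> borel_measurable (\<Omega> n)"
    using products_bdd[OF assms(2)] n by (auto simp: bdd_def)
  show "AE \<omega> in \<Omega> n. ntr X n \<omega> = ntr Y n \<omega>"
    using AE_good by eventually_elim (simp add: ntr_def assms(3)[OF n])
qed

lemma card_blk_pos: "i \<in> I \<Longrightarrow> \<forall>\<^sub>F n in sequentially. card (blk n i) \<noteq> 0"
  using tendsto_imp_eventually_ne[OF ratio ratio_nonzero, of i] by (auto elim!: eventually_mono)

text \<open>In the equation for the word and its adjoint, divided by n^3, position 0 contributes q/n
  times the second moment of the normalized trace, with q the block size. Every other split term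
  contains a factor that is null by \<open>IH\<close> or by reducedness, times bounded ones, and the
  merge terms are of order n^{-2}. As q/n has a nonzero limit, the second moment tends to 0.\<close>

lemma reduced_null_aux:
  assumes IH: "\<And>u b. length u < length w \<Longrightarrow> u \<noteq> [] \<Longrightarrow> sword u \<Longrightarrow> reduced u \<Longrightarrow> b \<in> Dt \<Longrightarrow> null (ntr (WV b u))"
    and w: "w = (v0, c0) # r" "sword w" "reduced w"
  shows "null (ntr (WV (blkP (fst v0)) w))"
proof -
  let ?i = "fst v0" let ?P = "blkP (fst v0)"
  have i: "?i \<in> I" using w by simp
  note P = Dt_proj[OF i]
  obtain b' w' where b': "b' \<in> Dt" "sword w'"
    and star: "\<And>n \<omega>. star_fmat (WV ?P w n \<omega>) = WV b' w' n \<omega>"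
    using WV_star[OF P w(2)] by blast
  have nthI: "fst (fst (u ! m)) \<in> I" "snd (u ! m) \<in> Dt" if "sword u" "m < length u" for u m
    using that by auto
  have subw: "sword (take m u)" "sword (drop m u)" if "sword u" for m u
    using that by (meson in_set_takeD in_set_dropD)+
  define S where "S m n \<omega> = (let v = fst (w ! m); c = snd (w ! m) in
     if v = v0 then Tr (WV ?P (take m w) n \<omega>) * Tr (WV ?P (drop m w) n \<omega>)
     else if v = flip v0 then
       - Tr (WV ?P (take m w) n \<omega> * LUs n \<omega> v) * Tr (WV (\<lambda>n. ?P n * c n) (drop (Suc m) w) n \<omega>)
     else 0)" for m n \<omega>
  define G where "G m n \<omega> = (let v = fst (w' ! m); c = snd (w' ! m) in
     if v = v0 then
       Tr (WV ?P w n \<omega> * ?P n * (LUs n \<omega> v * WV c (drop (Suc m) w') n \<omega> * WV b' (take m w') n \<omega>))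
     else if v = flip v0 then
       - Tr (WV ?P w n \<omega> * ?P n * (WV c (drop (Suc m) w') n \<omega> * WV b' (take m w') n \<omega> * LUs n \<omega> v))
     else 0)" for m n \<omega>
  have sd: "(\<integral>\<omega>. (\<Sum>m<length w. S m n \<omega>) * Tr (WV b' w' n \<omega>) + (\<Sum>m<length w'. G m n \<omega>) \<partial>\<Omega> n) = 0"
    if n: "n \<ge> d" for n
  proof -
    interpret haar_family "\<Omega> n" n I "blk n" "\<lambda>i. U i n" by (rule haar[OF n])
    have wI: "wordI (evl n u)" if "sword u" for u
      using that Dt_dim n by (auto simp: evl_def)
    have "split_term v0 (evl n w) \<omega> m = S m n \<omega>" if "m < length w" for m \<omega>
      using that by (simp add: split_term_def S_def Let_def evl_nth WV_def)
    moreover have "merge_term v0 (evl n w) (b' n) (evl n w') \<omega> m = G m n \<omega>" if "m < length w'" for m \<omega>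
      using that by (simp add: merge_term_def G_def Let_def evl_nth WV_def)
    ultimately show ?thesis
      using schwinger_dyson[OF i Dt_dim[OF b'(1) n] wI[OF w(2)] wI[OF b'(2)]] by (simp add: WV_def)
  qed
  have b3: "bdd (\<lambda>n \<omega>. Tr (WV b' w' n \<omega>) / of_nat n)"
    using products_bdd[OF products_WV[OF b']] by (simp add: ntr_def[abs_def])
  have S_null: "null (\<lambda>n \<omega>. S m n \<omega> / (of_nat n)\<^sup>2)" if m: "0 < m" "m < length w" for m
  proof -
    let ?v = "fst (w ! m)" and ?c = "snd (w ! m)"
    have tk: "take m w \<noteq> []" "length (take m w) < length w" using m w by auto
    consider "?v = v0" | "?v = flip v0" | "?v \<noteq> v0" "?v \<noteq> flip v0" by blast
    then show ?thesis
    proof cases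
      case 1
      \<comment> \<open>The prefix is nonempty because m > 0, shorter than \<open>w\<close>, and
        reduced.\<close>
      have "null (\<lambda>n \<omega>. ntr (WV ?P (take m w)) n \<omega> * ntr (WV ?P (drop m w)) n \<omega>)"
        by (intro null_mult IH products_bdd products_WV P tk subw w reduced_take)
      then show ?thesis using 1 by (simp add: S_def ntr_def power2_eq_square)
    next
      case 2
      \<comment> \<open>The left factor begins with \<open>v0\<close> and ends with its inverse. By
        cyclicity these cancel, leaving the letters strictly between them behind the coefficient
        \<open>c0\<close>.\<close>
      obtain m' where m': "m = Suc m'" using m by (cases m) auto
      have "null (ntr (\<lambda>n \<omega>. WV ?P (take m w) n \<omega> * LUs n \<omega> ?v))"
      proof (rule null_ntr_cong)
        show "(\<lambda>n \<omega>. WV ?P (take m w) n \<omega> * LUs n \<omega> ?v) \<in> products"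
          by (intro products_mult products_WV P subw w products_letter nthI m)
        show "Tr (WV (\<lambda>n. ?P n * c0 n) (take m' r) n \<omega>) = Tr (WV ?P (take m w) n \<omega> * LUs n \<omega> ?v)"
          if n: "n \<ge> d" and g: "\<omega> \<in> good_event n" for n \<omega>
        proof -
          interpret haar_family "\<Omega> n" n I "blk n" "\<lambda>i. U i n" by (rule haar[OF n])
          have rm: "fst (r ! m') = flip v0" using 2 by (simp add: w(1) m')
          have "Tr (WV ?P (take m w) n \<omega> * LUs n \<omega> ?v) =
              Tr (LUs n \<omega> (flip v0) * (?P n * LUs n \<omega> v0 * WV c0 (take m' r) n \<omega>))"
            using Tr_commute rm by (simp add: w(1) m' WV_Cons)
          also have "LUs n \<omega> (flip v0) * (?P n * LUs n \<omega> v0 * WV c0 (take m' r) n \<omega>) = 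
              ?P n * WV c0 (take m' r) n \<omega>"
            using goodD(2)[OF g, of "flip v0"] goodD(3)[OF g, of v0] i by (simp add: mult.assoc[symmetric])
          finally show ?thesis by (simp add: WV_mult_left)
        qed
        show "null (ntr (WV (\<lambda>n. ?P n * c0 n) (take m' r)))"
        \<comment> \<open>If the two letters are adjacent, no word is left, and reducedness itself
          makes the trace of \<open>c0\<close> on the block vanish asymptotically.\<close>
        proof (cases "m' = 0")
          case True
          have "reduced_at (w ! 0) (w ! Suc 0)" using w(3) m m' by (auto simp: reduced_def)
          then have "(\<lambda>n. Tr (c0 n * ?P n) / of_nat n) \<longlonglongrightarrow> 0"
            using 2 m' True by (simp add: reduced_at_def w(1))
          from null_const[OF this] show ?thesis
            using True by (simp add: ntr_def[abs_def] Tr_commute)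
        next
          case False
          show ?thesis
          proof (rule IH)
            show "take m' r \<noteq> []" "length (take m' r) < length w" using m m' False w(1) by auto
            show "sword (take m' r)" by (rule subw(1)) (use w(1,2) in auto)
            show "reduced (take m' r)" using reduced_tl w reduced_take by blast
            show "(\<lambda>n. ?P n * c0 n) \<in> Dt" using P w by (intro Dt_mult) auto
          qed
        qed
      qed
      then have "null (\<lambda>n \<omega>. (- 1) * (ntr (\<lambda>n \<omega>. WV ?P (take m w) n \<omega> * LUs n \<omega> ?v) n \<omega> *
          ntr (WV (\<lambda>n. ?P n * ?c n) (drop (Suc m) w)) n \<omega>))"
        by (intro null_const_mult null_mult products_bdd products_WV Dt_mult P subw w nthI m)
      then show ?thesis using 2 by (simp add: S_def ntr_def power2_eq_square)
    next
      case 3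
      then show ?thesis using null_const[of "\<lambda>_. 0"] by (simp add: S_def)
    qed
  qed
  have G_null: "null (\<lambda>n \<omega>. G m n \<omega> / (of_nat n) ^ 3)" if m: "m < length w'" for m
  proof -
    let ?v = "fst (w' ! m)" and ?c = "snd (w' ! m)"
    \<comment> \<open>A merge term is one trace, hence of order n, and is divided by n^3; this
      factor is the surplus.\<close>
    have z: "(\<lambda>n. 1 / (of_nat n)\<^sup>2 :: complex) \<longlonglongrightarrow> 0"
      using tendsto_power[OF lim_1_over_n[where 'a = complex], of 2] by (simp add: power_divide)
    consider "?v = v0" | "?v = flip v0" | "?v \<noteq> v0" "?v \<noteq> flip v0" by blast
    then show ?thesis
    proof cases
      case 1
      have "null (\<lambda>n \<omega>. (1 / (of_nat n)\<^sup>2) * ntr (\<lambda>n \<omega>. WV ?P w n \<omega> * ?P n *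
          (LUs n \<omega> ?v * WV ?c (drop (Suc m) w') n \<omega> * WV b' (take m w') n \<omega>)) n \<omega>)"
        by (intro null_mult null_const z products_bdd products_mult products_WV products_Dt products_letter
           P w b' subw nthI m)
      then show ?thesis using 1 by (simp add: G_def ntr_def power2_eq_square power3_eq_cube)
    next
      case 2
      have "null (\<lambda>n \<omega>. (- 1) * ((1 / (of_nat n)\<^sup>2) * ntr (\<lambda>n \<omega>. WV ?P w n \<omega> * ?P n *
          (WV ?c (drop (Suc m) w') n \<omega> * WV b' (take m w') n \<omega> * LUs n \<omega> ?v)) n \<omega>))"
        by (intro null_const_mult null_mult null_const z products_bdd products_mult products_WV products_Dt products_letter
           P w b' subw nthI m)
      then show ?thesis using 2 by (simp add: G_def ntr_def power2_eq_square power3_eq_cube)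
    next
      case 3
      then show ?thesis using null_const[of "\<lambda>_. 0"] by (simp add: G_def)
    qed
  qed
  let ?l = "length r"
  define R where "R n \<omega> = (\<Sum>m<?l. S (Suc m) n \<omega> / (of_nat n)\<^sup>2) * (Tr (WV b' w' n \<omega>) / of_nat n) +
     (\<Sum>m<length w'. G m n \<omega> / (of_nat n) ^ 3)" for n \<omega>
  have R: "null R"
    unfolding R_def[abs_def] by (intro null_add null_mult null_sum S_null G_null b3) (auto simp: w(1))
  have X: "WV ?P w \<in> products" by (intro products_WV P w)
  show ?thesis
  proof (rule null_square[OF products_bdd[OF X]])
    \<comment> \<open>The equation solved for the second moment: minus the mean of the remainder
      \<open>R\<close>, divided by q/n.\<close>
    have "(\<lambda>n. - ((\<integral>\<omega>. R n \<omega> \<partial>\<Omega> n) / (of_nat (card (blk n ?i)) / of_nat n))) \<longlonglongrightarrow> - (0 / \<rho> ?i)"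
      by (intro tendsto_minus tendsto_divide null_integral R ratio i ratio_nonzero)
    then have lim: "(\<lambda>n. - ((\<integral>\<omega>. R n \<omega> \<partial>\<Omega> n) / (of_nat (card (blk n ?i)) / of_nat n))) \<longlonglongrightarrow> 0" by simp
    show "(\<lambda>n. \<integral>\<omega>. ntr (WV ?P w) n \<omega> * cnj (ntr (WV ?P w) n \<omega>) \<partial>\<Omega> n) \<longlonglongrightarrow> 0"
    proof (rule Lim_transform_eventually[OF lim])
      show "\<forall>\<^sub>F n in sequentially. - ((\<integral>\<omega>. R n \<omega> \<partial>\<Omega> n) / (of_nat (card (blk n ?i)) / of_nat n)) =
         (\<integral>\<omega>. ntr (WV ?P w) n \<omega> * cnj (ntr (WV ?P w) n \<omega>) \<partial>\<Omega> n)"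
        using eventually_ge_at_top[of d] card_blk_pos[OF i]
      proof eventually_elim
        case (elim n)
        have n0: "(of_nat n :: complex) \<noteq> 0" using elim d_pos by simp
        let ?q = "of_nat (card (blk n ?i)) :: complex"
        let ?t = "\<lambda>\<omega>. ntr (WV ?P w) n \<omega> * cnj (ntr (WV ?P w) n \<omega>)"
        have cn: "cnj (Tr (WV ?P w n \<omega>) / of_nat n) = Tr (WV b' w' n \<omega>) / of_nat n" for \<omega>
          by (simp add: Tr_star[symmetric] star)
        have lw: "length w = Suc ?l" using w(1) by simp
        have S0: "S 0 n \<omega> = ?q * Tr (WV ?P w n \<omega>)" for \<omega>
          by (simp add: S_def w(1) Tr_dproj)
        have alg: "((?q * T + A) * W + H) / of_nat n ^ 3 = ?q / of_nat n * (T / of_nat n * (W / of_nat n)) +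
            (A / (of_nat n)\<^sup>2 * (W / of_nat n) + H / of_nat n ^ 3)" for T A W H :: complex
          by (simp add: add_divide_distrib distrib_right power2_eq_square power3_eq_cube) (simp add: mult.assoc)
        have "((\<Sum>m<length w. S m n \<omega>) * Tr (WV b' w' n \<omega>) + (\<Sum>m<length w'. G m n \<omega>)) / (of_nat n) ^ 3
            = (?q / of_nat n) * ?t \<omega> + R n \<omega>" for \<omega>
          unfolding lw sum.lessThan_Suc_shift S0 R_def ntr_def cn sum_divide_distrib[symmetric]
          by (rule alg)
        then have "0 = (\<integral>\<omega>. (?q / of_nat n) * ?t \<omega> + R n \<omega> \<partial>\<Omega> n)"
          using sd[OF elim(1)] integral_divide_zero[of "\<Omega> n"
            "\<lambda>\<omega>. (\<Sum>m<length w. S m n \<omega>) * Tr (WV b' w' n \<omega>) + (\<Sum>m<length w'. G m n \<omega>)" "(of_nat n) ^ 3"]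
          by simp
        also have "\<dots> = (?q / of_nat n) * (\<integral>\<omega>. ?t \<omega> \<partial>\<Omega> n) + (\<integral>\<omega>. R n \<omega> \<partial>\<Omega> n)"
          using bdd_integrable[OF null_bdd[OF R] elim(1)]
            bdd_integrable[OF bdd_mult[OF products_bdd[OF X] bdd_cnj[OF products_bdd[OF X]]] elim(1)]
          by (subst Bochner_Integration.integral_add) auto
        finally have eq: "0 = (?q / of_nat n) * (\<integral>\<omega>. ?t \<omega> \<partial>\<Omega> n) + (\<integral>\<omega>. R n \<omega> \<partial>\<Omega> n)" .
        have alg2: "- (x / c) = t" if "0 = c * t + x" "c \<noteq> 0" for x c t :: complex
        proof -
          have "x = - (c * t)" using that(1) by (simp add: eq_neg_iff_add_eq_0 add.commute)
          then show ?thesis using that(2) by simp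
        qed
        have c0: "?q / of_nat n \<noteq> 0" using elim(2) n0 by (simp only: divide_eq_0_iff of_nat_eq_0_iff) simp
        show ?case by (rule alg2[OF eq c0])
      qed
    qed
  qed
qed

text \<open>By cyclicity the leading coefficient moves into the last one, which reducedness does not
  see. In front the unit remains and may be replaced by the projection that fixes the first
  letter.\<close>

theorem reduced_null:
  "w \<noteq> [] \<Longrightarrow> sword w \<Longrightarrow> reduced w \<Longrightarrow> b \<in> Dt \<Longrightarrow> null (ntr (WV b w))"
proof (induction "length w" arbitrary: w b rule: less_induct)
  case less
  obtain u v c where w: "w = u @ [(v, c)]"
    using less.prems(1) by (cases w rule: rev_cases) auto
  define w2 where "w2 = u @ [(v, \<lambda>n. c n * b n)]"
  obtain v0 c0 r where w2: "w2 = (v0, c0) # r" by (cases w2) (auto simp: w2_def)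
  have sw2: "sword w2" using less.prems Dt_mult by (auto simp: w2_def w)
  have r2: "reduced w2" using less.prems reduced_change_last by (simp add: w2_def w)
  have len: "length w2 = length w" by (simp add: w2_def w)
  have "null (ntr (WV (blkP (fst v0)) w2))"
    by (rule reduced_null_aux[OF _ w2 sw2 r2]) (use less.hyps len in auto)
  then show ?case
  proof (rule null_ntr_cong)
    show "WV b w \<in> products" using less.prems by (intro products_WV)
    fix n \<omega> assume n: "d \<le> n" and g: "\<omega> \<in> good_event n"
    interpret haar_family "\<Omega> n" n I "blk n" "\<lambda>i. U i n" by (rule haar[OF n])
    have v0: "fst v0 \<in> I" using sw2 w2 by simp
    let ?E = "\<lambda>n. dproj {..<n}"
    have b: "b n = b n * ?E n" by (simp add: dproj_mult_id Dt_dim[OF less.prems(4) n])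
    have EP: "dproj {..<n} * LUs n \<omega> v0 = LUs n \<omega> v0"
      using goodD(1)[OF g v0] by (simp add: dproj_mult_id)
    have "Tr (WV b w n \<omega>) = Tr (b n * WV ?E w n \<omega>)"
      using b WV_mult_left[of b ?E w n \<omega>] by (simp add: WV_def)
    also have "\<dots> = Tr (WV ?E w n \<omega> * b n)" by (rule Tr_commute)
    also have "WV ?E w n \<omega> * b n = WV ?E w2 n \<omega>" by (simp add: w w2_def WV_append mult.assoc)
    also have "\<dots> = WV (blkP (fst v0)) w2 n \<omega>"
      using EP goodD(3)[OF g v0] by (simp add: w2 WV_Cons)
    finally show "Tr (WV (blkP (fst v0)) w2 n \<omega>) = Tr (WV b w n \<omega>)" by simp
  qed
qed

subsection \<open>Convergence\<close>

lemma converges_ntr_cong: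
  assumes "converges_to (ntr X) c" "Y \<in> products" "\<And>n \<omega>. n \<ge> d \<Longrightarrow> \<omega> \<in> good_event n \<Longrightarrow> Tr (X n \<omega>) = Tr (Y n \<omega>)"
  shows "converges_to (ntr Y) c"
proof (rule converges_to_cong[OF assms(1)])
  fix n assume n: "d \<le> n"
  interpret haar_family "\<Omega> n" n I "blk n" "\<lambda>i. U i n" by (rule haar[OF n])
  show "ntr Y n \<in> borel_measurable (\<Omega> n)"
    using products_bdd[OF assms(2)] n by (auto simp: bdd_def)
  show "AE \<omega> in \<Omega> n. ntr X n \<omega> = ntr Y n \<omega>"
    using AE_good by eventually_elim (simp add: ntr_def assms(3)[OF n])
qed

text \<open>A letter and its inverse with exactly the block projection between them multiply to that
  projection. It is absorbed into the preceding coefficient, or into the leading one if no letter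
  precedes, and two letters disappear.\<close>

lemma WV_delete_pair:
  assumes "b \<in> Dt" "sword (u @ (v, c) # (flip v, c') # z)"
  shows "\<exists>b'\<in>Dt. \<exists>z'. sword z' \<and> length z' = length u + length z \<and>
    (\<forall>n\<ge>d. \<forall>\<omega>\<in>good_event n. WV b (u @ (v, blkP (fst v)) # (flip v, c') # z) n \<omega> = WV b' z' n \<omega>)"
proof -
  have v: "fst v \<in> I" and c': "c' \<in> Dt" and u: "sword u" and z: "sword z" using assms by auto
  have eq: "WV b (u @ (v, blkP (fst v)) # (flip v, c') # z) n \<omega> = WV b u n \<omega> * blkP (fst v) n * WV c' z n \<omega>"
    if n: "n \<ge> d" and g: "\<omega> \<in> good_event n" for n \<omega>
  proof -
    interpret haar_family "\<Omega> n" n I "blk n" "\<lambda>i. U i n" by (rule haar[OF n])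
    have "LUs n \<omega> v * (dproj (blk n (fst v)) * LUs n \<omega> (flip v)) = dproj (blk n (fst v))"
      using goodD(2)[OF g v] goodD(3)[OF g, of "flip v"] v by simp
    then show ?thesis by (simp add: WV_append WV_Cons mult.assoc) (simp add: mult.assoc[symmetric])
  qed
  show ?thesis
  proof (cases u rule: rev_cases)
    case Nil
    have "WV b u n \<omega> * blkP (fst v) n * WV c' z n \<omega> = WV (\<lambda>n. b n * blkP (fst v) n * c' n) z n \<omega>" for n \<omega>
      using WV_mult_left[of "\<lambda>n. b n * blkP (fst v) n" c'] by (simp add: Nil)
    moreover have "(\<lambda>n. b n * blkP (fst v) n * c' n) \<in> Dt"
      by (intro Dt_mult Dt_proj v c' assms)
    ultimately show ?thesis using eq z Nil by (intro bexI exI[of _ z]) auto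
  next
    case (snoc u1 x)
    obtain v1 c1 where x: "x = (v1, c1)" by (cases x)
    have "WV b u n \<omega> * blkP (fst v) n * WV c' z n \<omega> = WV b (u1 @ (v1, \<lambda>n. c1 n * blkP (fst v) n * c' n) # z) n \<omega>" for n \<omega>
      using WV_mult_left[of "\<lambda>n. c1 n * blkP (fst v) n" c'] by (simp add: snoc x WV_append mult.assoc)
    moreover have "sword (u1 @ (v1, \<lambda>n. c1 n * blkP (fst v) n * c' n) # z)"
      using u z snoc x Dt_mult[OF Dt_mult[OF _ Dt_proj[OF v]] c'] by auto
    ultimately show ?thesis using eq assms(1) snoc
      by (intro bexI[of _ b] exI[of _ "u1 @ (v1, \<lambda>n. c1 n * blkP (fst v) n * c' n) # z"]) auto
  qed
qed

definition bad_positions :: "('i letter \<times> (nat \<Rightarrow> fmat)) list \<Rightarrow> nat set" where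
  "bad_positions w = {m. Suc m < length w \<and> \<not> reduced_at (w ! m) (w ! Suc m)}"

lemma finite_bad_positions: "finite (bad_positions w)"
  by (rule finite_subset[of _ "{..<length w}"]) (auto simp: bad_positions_def)

text \<open>A coefficient \<open>c\<close> between mutually inverse letters is split into \<open>c - \<lambda>P\<close>, with asymptotically
  vanishing trace on the block, and a part for which the two letters cancel.\<close>

theorem WV_converges:
  "sword w \<Longrightarrow> b \<in> Dt \<Longrightarrow> \<exists>c. converges_to (ntr (WV b w)) c"
proof (induction "length w" arbitrary: w b rule: less_induct)
  case (less w b)
  note IH = less.hyps
  \<comment> \<open>Inner induction at fixed length on the number of bad positions: centering one
    coefficient lowers it, while the part split off leads to a shorter word and to
    \<open>IH\<close>.\<close>
  have "\<exists>c. converges_to (ntr (WV b u)) c" if "sword u" "length u = length w" for u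
    using that
  proof (induction "card (bad_positions u)" arbitrary: u rule: less_induct)
    case (less u)
    show ?case
    proof (cases "u = []")
      case True
      obtain l where "(\<lambda>n. Tr (b n) / of_nat n) \<longlonglongrightarrow> l"
        using Dt_conv[OF \<open>b \<in> Dt\<close>] by (auto simp: convergent_def)
      from converges_to_const[OF this] show ?thesis
        using True by (auto simp: ntr_def[abs_def])
    next
      case u0: False
      show ?thesis
      proof (cases "reduced u")
        case True
        show ?thesis
          using null_converges_to[OF reduced_null[OF u0 less.prems(1) True \<open>b \<in> Dt\<close>]] by blast
      next
        case False
        then obtain m where m: "Suc m < length u" and nr: "\<not> reduced_at (u ! m) (u ! Suc m)"
          by (auto simp: reduced_def)
        obtain v c where um: "u ! m = (v, c)" by (cases "u ! m")
        obtain v2 c2 where um2: "u ! Suc m = (v2, c2)" by (cases "u ! Suc m")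
        have v2: "v2 = flip v" using nr um um2 by (auto simp: reduced_at_def)
        define u1 where "u1 = take m u"
        define z where "z = drop (Suc (Suc m)) u"
        have u: "u = u1 @ (v, c) # (flip v, c2) # z"
          using m um um2 v2 unfolding u1_def z_def
          by (metis Cons_nth_drop_Suc Suc_lessD append_take_drop_id)
        have lu1: "length u1 = m" using m by (simp add: u1_def)
        have vI: "fst v \<in> I" and c: "c \<in> Dt" and c2: "c2 \<in> Dt" and s: "sword u1" "sword z"
          using less.prems(1) u by auto
        let ?P = "blkP (fst v)"
        have P: "?P \<in> Dt" by (rule Dt_proj[OF vI])
        obtain l where l: "(\<lambda>n. Tr (c n * ?P n) / of_nat n) \<longlonglongrightarrow> l"
          using Dt_conv[OF Dt_mult[OF c P]] by (auto simp: convergent_def)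
        \<comment> \<open>The normalized trace of the block projection tends to \<rho>, so this
          multiple cancels the limiting trace of \<open>c\<close> on the block.\<close>
        define lam where "lam = l / \<rho> (fst v)"
        define c' where "c' = (\<lambda>n. c n + sc (- lam) (?P n))"
        have c': "c' \<in> Dt" unfolding c'_def by (intro Dt_add Dt_sc c P)
        define u' where "u' = u1 @ (v, c') # (flip v, c2) # z"
        define u'' where "u'' = u1 @ (v, ?P) # (flip v, c2) # z"
        have su': "sword u'" "sword u''" using s vI c' c2 P by (auto simp: u'_def u''_def)
        have lim: "(\<lambda>n. Tr (c' n * ?P n) / of_nat n) \<longlonglongrightarrow> 0"
        proof -
          have "(\<lambda>n. Tr (c n * ?P n) / of_nat n - lam * (of_nat (card (blk n (fst v))) / of_nat n))
              \<longlonglongrightarrow> l - lam * \<rho> (fst v)"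
            by (intro tendsto_diff tendsto_mult tendsto_const l ratio vI)
          then have "(\<lambda>n. Tr (c n * ?P n) / of_nat n - lam * (of_nat (card (blk n (fst v))) / of_nat n)) \<longlonglongrightarrow> 0"
            using ratio_nonzero[OF vI] by (simp add: lam_def)
          then show ?thesis
          proof (rule Lim_transform_eventually)
            show "\<forall>\<^sub>F n in sequentially. Tr (c n * ?P n) / of_nat n - lam * (of_nat (card (blk n (fst v))) / of_nat n)
                = Tr (c' n * ?P n) / of_nat n"
              using eventually_ge_at_top[of d]
            proof eventually_elim
              case (elim n)
              have "finite (blk n (fst v))" 
                using haar_family.finite_blk[OF haar[OF elim] vI] .
              then have "Tr (c' n * ?P n) = Tr (c n * ?P n) - lam * of_nat (card (blk n (fst v)))"
                by (simp add: c'_def distrib_right Tr_add sc_mult_left Tr_sc dproj_dproj Tr_dproj)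
              then show ?case by (simp add: diff_divide_distrib)
            qed
          qed
        qed
        \<comment> \<open>Whether a pair is reduced depends on its two letters and its left
          coefficient, so the new coefficient affects position \<open>m\<close> alone.\<close>
        have "bad_positions u' \<subseteq> bad_positions u - {m}"
        proof
          fix k assume k: "k \<in> bad_positions u'"
          have len: "length u' = length u" by (simp add: u u'_def)
          have "u' ! m = (v, c')" "u' ! Suc m = (flip v, c2)"
            using lu1 by (auto simp: u'_def nth_append)
          then have "reduced_at (u' ! m) (u' ! Suc m)" using lim by (simp add: reduced_at_def)
          then have km: "k \<noteq> m" using k by (auto simp: bad_positions_def)
          have "u' ! k = u ! k" "fst (u' ! Suc k) = fst (u ! Suc k)"
            using km lu1 by (auto simp: u u'_def nth_append nth_Cons')
          then show "k \<in> bad_positions u - {m}"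
            using k km len by (auto simp: bad_positions_def reduced_at_def)
        qed
        moreover have "m \<in> bad_positions u" using m nr by (simp add: bad_positions_def)
        ultimately have "card (bad_positions u') < card (bad_positions u)"
          using finite_bad_positions by (metis card_Diff1_less card_mono finite_Diff le_less_trans)
        moreover have "length u' = length w" using less.prems(2) by (simp add: u u'_def)
        ultimately obtain a where a: "converges_to (ntr (WV b u')) a"
          using less.hyps su'(1) by blast
        obtain b' z' where b': "b' \<in> Dt" "sword z'" "length z' = length u1 + length z"
          and del: "\<And>n \<omega>. n \<ge> d \<Longrightarrow> \<omega> \<in> good_event n \<Longrightarrow> WV b u'' n \<omega> = WV b' z' n \<omega>"
          using WV_delete_pair[OF \<open>b \<in> Dt\<close>, of u1 v c c2 z] less.prems(1) unfolding u u''_def by blast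
        have "length z' < length w" using b'(3) less.prems(2) by (simp add: u)
        then obtain e where "converges_to (ntr (WV b' z')) e" using IH b' by blast
        then have e: "converges_to (ntr (WV b u'')) e"
          by (rule converges_ntr_cong) (use del products_WV[OF \<open>b \<in> Dt\<close> su'(2)] in auto)
        have "ntr (WV b u) n \<omega> = ntr (WV b u') n \<omega> + lam * ntr (WV b u'') n \<omega>" for n \<omega>
        proof -
          have "WV b u n \<omega> = WV b u' n \<omega> + sc lam (WV b u'' n \<omega>)"
            by (rule fmat_eqI)
               (simp add: u u'_def u''_def WV_append WV_Cons c'_def distrib_left distrib_right
                  sc_mult_left sc_mult_right)
          then show ?thesis by (simp add: ntr_def Tr_add Tr_sc add_divide_distrib)
        qed
        then have "ntr (WV b u) = (\<lambda>n \<omega>. ntr (WV b u') n \<omega> + lam * ntr (WV b u'') n \<omega>)" by blast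
        then show ?thesis
          using converges_to_add[OF a converges_to_const_mult[OF e, of lam]] by auto
      qed
    qed
  qed
  then show ?case using less.prems by blast
qed

end

section \<open>The algebra of a tracial functional\<close>

text \<open>Common axioms for sequences of constant matrices and for sequences of random matrices,
  both with pointwise operations and without a unit.\<close>

locale star_ops =
  fixes st :: "'x::ring \<Rightarrow> 'x" and scl :: "complex \<Rightarrow> 'x \<Rightarrow> 'x"
  assumes scl_add_right: "scl c (a + b) = scl c a + scl c b"
    and scl_add_left: "scl (c + e) a = scl c a + scl e a"
    and scl_scl: "scl c (scl e a) = scl (c * e) a"
    and scl_one: "scl 1 a = a"
    and scl_mult_left: "scl c a * b = scl c (a * b)"
    and scl_mult_right: "a * scl c b = scl c (a * b)"
    and st_st: "st (st a) = a"
    and st_add: "st (a + b) = st a + st b"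
    and st_scl: "st (scl c a) = scl (cnj c) (st a)"
    and st_mult: "st (a * b) = st b * st a"
begin

lemma scl_zero: "scl 0 a = 0"
  using scl_add_left[of 0 0 a] by simp

lemma scl_minus: "scl (- 1) a = - a"
  using scl_add_left[of "- 1" 1 a] by (simp add: scl_zero scl_one eq_neg_iff_add_eq_0)

lemma scl_zero_right: "scl c 0 = 0"
  using scl_add_right[of c 0 0] by simp

lemma st_zero: "st 0 = 0"
  using st_add[of 0 0] by simp

lemma st_nprod: "u \<noteq> [] \<Longrightarrow> st (nprod u) = nprod (rev (map st u))"
proof (induction u)
  case (Cons x u)
  then show ?case by (cases "u = []") (auto simp: nprod_append nprod_Cons st_mult)
qed simp

text \<open>Linear span, enlarged by one multiple of a generator at a time, so that inductions treat
  one generator and a remainder.\<close>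

inductive_set lin :: "'x set \<Rightarrow> 'x set" for S where
  lin_zero: "0 \<in> lin S"
| lin_step: "a \<in> S \<Longrightarrow> x \<in> lin S \<Longrightarrow> scl c a + x \<in> lin S"

lemma lin_base: "a \<in> S \<Longrightarrow> a \<in> lin S"
  using lin_step[OF _ lin_zero, of a S 1] by (simp add: scl_one)

lemma lin_add: "x \<in> lin S \<Longrightarrow> z \<in> lin S \<Longrightarrow> x + z \<in> lin S"
  by (induction x rule: lin.induct) (auto simp: add.assoc intro: lin_step)

lemma lin_scl: "x \<in> lin S \<Longrightarrow> scl c x \<in> lin S"
  by (induction x rule: lin.induct) (auto simp: scl_zero_right scl_add_right scl_scl intro: lin.intros)

lemma lin_mult:
  assumes "\<And>a b. a \<in> S \<Longrightarrow> b \<in> S \<Longrightarrow> a * b \<in> S" "x \<in> lin S" "z \<in> lin S"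
  shows "x * z \<in> lin S"
proof -
  have *: "a * z \<in> lin S" if a: "a \<in> S" for a
    using assms(3)
    by (induction z rule: lin.induct) (auto simp: distrib_left scl_mult_right intro: lin.intros assms(1)[OF a])
  show ?thesis
    using assms(2)
    by (induction x rule: lin.induct) (auto simp: distrib_right scl_mult_left intro: lin_zero lin_add lin_scl *)
qed

lemma lin_st: "x \<in> lin S \<Longrightarrow> (\<And>a. a \<in> S \<Longrightarrow> st a \<in> S) \<Longrightarrow> st x \<in> lin S"
  by (induction x rule: lin.induct) (auto simp: st_zero st_add st_scl intro: lin.intros)

lemma lin_subset:
  assumes "S \<subseteq> T" "0 \<in> T" "\<And>a b. a \<in> T \<Longrightarrow> b \<in> T \<Longrightarrow> a + b \<in> T" "\<And>a c. a \<in> T \<Longrightarrow> scl c a \<in> T"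
  shows "lin S \<subseteq> T"
proof
  fix x assume "x \<in> lin S"
  then show "x \<in> T" by (induction x rule: lin.induct) (use assms in auto)
qed

end

text \<open>An algebra \<open>X\<close> of noncommutative random variables with a tracial positive functional \<open>\<tau>\<close> is
  divided by the kernel of the trace form. With \<open>y\<close> enumerating a spanning set, the class of \<open>x\<close> is
  encoded by the sequence of the values $\tau(y_m x)$.\<close>

locale trace_quotient = star_ops st scl
  for st :: "'x::ring \<Rightarrow> 'x" and scl :: "complex \<Rightarrow> 'x \<Rightarrow> 'x" +
  fixes X :: "'x set" and \<tau> :: "'x \<Rightarrow> complex" and y :: "nat \<Rightarrow> 'x" and d :: nat and pr :: "nat \<Rightarrow> 'x"
  assumes X_zero: "0 \<in> X"
    and X_add: "a \<in> X \<Longrightarrow> b \<in> X \<Longrightarrow> a + b \<in> X"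
    and X_mult: "a \<in> X \<Longrightarrow> b \<in> X \<Longrightarrow> a * b \<in> X"
    and X_scl: "a \<in> X \<Longrightarrow> scl c a \<in> X"
    and X_st: "a \<in> X \<Longrightarrow> st a \<in> X"
    and X_pr: "k \<in> {1..d} \<Longrightarrow> pr k \<in> X"
    and st_pr: "k \<in> {1..d} \<Longrightarrow> st (pr k) = pr k"
    and pr_mult: "k \<in> {1..d} \<Longrightarrow> l \<in> {1..d} \<Longrightarrow> pr k * pr l = (if k = l then pr k else 0)"
    and \<tau>_add: "a \<in> X \<Longrightarrow> b \<in> X \<Longrightarrow> \<tau> (a + b) = \<tau> a + \<tau> b"
    and \<tau>_scl: "a \<in> X \<Longrightarrow> \<tau> (scl c a) = c * \<tau> a"
    and \<tau>_comm: "a \<in> X \<Longrightarrow> b \<in> X \<Longrightarrow> \<tau> (a * b) = \<tau> (b * a)"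
    and \<tau>_st: "a \<in> X \<Longrightarrow> \<tau> (st a) = cnj (\<tau> a)"
    and \<tau>_pos: "a \<in> X \<Longrightarrow> \<tau> (st a * a) \<in> \<real> \<and> 0 \<le> Re (\<tau> (st a * a))"
    and \<tau>_unit: "a \<in> X \<Longrightarrow> \<tau> ((\<Sum>k=1..d. pr k) * a) = \<tau> a"
    and \<tau>_one: "\<tau> (\<Sum>k=1..d. pr k) = 1"
    and \<tau>_pr: "k \<in> {1..d} \<Longrightarrow> \<tau> (pr k) \<noteq> 0"
    and y_X: "y m \<in> X"
    and y_span: "a \<in> X \<Longrightarrow> (\<And>m. \<tau> (y m * a) = 0) \<Longrightarrow> z \<in> X \<Longrightarrow> \<tau> (z * a) = 0"
begin

definition cls :: "'x \<Rightarrow> nat \<Rightarrow> complex" where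
  "cls a = (\<lambda>m. \<tau> (y m * a))"

text \<open>Operations on the quotient are computed on chosen representatives; for each of them
  independence of the choice has to be shown.\<close>

definition rep :: "(nat \<Rightarrow> complex) \<Rightarrow> 'x" where
  "rep f = (SOME a. a \<in> X \<and> cls a = f)"

definition e :: 'x where "e = (\<Sum>k=1..d. pr k)"

definition Q :: "(nat \<Rightarrow> complex) star_algebra" where
  "Q = \<lparr>carrier = cls ` X, mult = (\<lambda>f g. cls (rep f * rep g)), one = cls e, zero = cls 0,
     add = (\<lambda>f g. cls (rep f + rep g)), smult = (\<lambda>c f. cls (scl c (rep f))),
     star = (\<lambda>f. cls (st (rep f)))\<rparr>"

definition \<phi>Q :: "(nat \<Rightarrow> complex) \<Rightarrow> complex" where "\<phi>Q f = \<tau> (rep f)"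

lemma X_sum: "(\<And>k. k \<in> S \<Longrightarrow> f k \<in> X) \<Longrightarrow> sum f S \<in> X"
  by (induction S rule: infinite_finite_induct) (auto intro: X_zero X_add)

lemma e_X: "e \<in> X"
  unfolding e_def by (intro X_sum X_pr)

lemma X_diff: "a \<in> X \<Longrightarrow> b \<in> X \<Longrightarrow> a - b \<in> X"
  using X_add[OF _ X_scl[of b "- 1"], of a] by (simp add: scl_minus)

lemma \<tau>_zero: "\<tau> 0 = 0"
  using \<tau>_scl[OF X_zero, of 0] by (simp add: scl_zero)

lemma \<tau>_diff: "a \<in> X \<Longrightarrow> b \<in> X \<Longrightarrow> \<tau> (a - b) = \<tau> a - \<tau> b"
  using \<tau>_add[OF _ X_scl[of b "- 1"], of a] \<tau>_scl[of b "- 1"] by (simp add: scl_minus)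

lemma cls_eqD:
  assumes "a \<in> X" "b \<in> X" "cls a = cls b" "z \<in> X"
  shows "\<tau> (z * a) = \<tau> (z * b)"
proof -
  have "\<tau> (y m * (a - b)) = 0" for m
    using fun_cong[OF assms(3), of m] assms(1,2) y_X
    by (simp add: cls_def right_diff_distrib \<tau>_diff X_mult)
  then have "\<tau> (z * (a - b)) = 0" using y_span[OF X_diff[OF assms(1,2)] _ assms(4)] by blast
  then show ?thesis using assms by (simp add: right_diff_distrib \<tau>_diff X_mult)
qed

lemma cls_eqI:
  assumes "\<And>z. z \<in> X \<Longrightarrow> \<tau> (z * a) = \<tau> (z * b)" shows "cls a = cls b"
  unfolding cls_def using assms y_X by blast

lemma rep:
  assumes "a \<in> X" shows "rep (cls a) \<in> X" "cls (rep (cls a)) = cls a"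
proof -
  have "rep (cls a) \<in> X \<and> cls (rep (cls a)) = cls a"
    unfolding rep_def by (rule someI[of _ a]) (use assms in auto)
  then show "rep (cls a) \<in> X" "cls (rep (cls a)) = cls a" by auto
qed

lemma repD: "a \<in> X \<Longrightarrow> z \<in> X \<Longrightarrow> \<tau> (z * rep (cls a)) = \<tau> (z * a)"
  by (intro cls_eqD rep)

lemma repD': "a \<in> X \<Longrightarrow> z \<in> X \<Longrightarrow> \<tau> (rep (cls a) * z) = \<tau> (a * z)"
  using repD \<tau>_comm rep by metis

text \<open>The kernel of the trace form is a two-sided ideal: the right factor can be replaced at
  once, the left one after the trace property has moved \<open>b\<close> to the front.\<close>

lemma Q_mult: 
  assumes "a \<in> X" "b \<in> X" shows "cls a \<otimes>\<^bsub>Q\<^esub> cls b = cls (a * b)"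
proof -
  have "cls (rep (cls a) * rep (cls b)) = cls (a * b)"
  proof (rule cls_eqI)
    fix z assume z: "z \<in> X"
    note r = rep[OF assms(1)] rep[OF assms(2)]
    have "\<tau> (z * (rep (cls a) * rep (cls b))) = \<tau> (z * rep (cls a) * b)"
      using repD[OF assms(2), of "z * rep (cls a)"] z r by (simp add: X_mult mult.assoc)
    also have "\<dots> = \<tau> (b * z * rep (cls a))"
      using \<tau>_comm[of "z * rep (cls a)" b] z r assms by (simp add: X_mult mult.assoc)
    also have "\<dots> = \<tau> (b * z * a)" using assms z by (simp add: repD X_mult)
    also have "\<dots> = \<tau> (z * (a * b))"
      using \<tau>_comm[of b "z * a"] z assms by (simp add: X_mult mult.assoc)
    finally show "\<tau> (z * (rep (cls a) * rep (cls b))) = \<tau> (z * (a * b))" .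
  qed
  then show ?thesis by (simp add: Q_def)
qed

lemma Q_add:
  assumes "a \<in> X" "b \<in> X" shows "cls a \<oplus>\<^bsub>Q\<^esub> cls b = cls (a + b)"
proof -
  have "cls (rep (cls a) + rep (cls b)) = cls (a + b)"
    by (rule cls_eqI) (simp add: distrib_left \<tau>_add X_mult assms rep repD)
  then show ?thesis by (simp add: Q_def)
qed

lemma Q_smult:
  assumes "a \<in> X" shows "c \<odot>\<^bsub>Q\<^esub> cls a = cls (scl c a)"
proof -
  have "cls (scl c (rep (cls a))) = cls (scl c a)"
    by (rule cls_eqI) (simp add: scl_mult_right \<tau>_scl X_mult assms rep repD)
  then show ?thesis by (simp add: Q_def)
qed

text \<open>The kernel is stable under the involution because \<tau>(z st(u)) is the conjugate of
  \<tau>(u st(z)).\<close>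

lemma Q_star:
  assumes "a \<in> X" shows "star Q (cls a) = cls (st a)"
proof -
  have "cls (st (rep (cls a))) = cls (st a)"
  proof (rule cls_eqI)
    fix z assume z: "z \<in> X"
    have *: "\<tau> (z * st u) = cnj (\<tau> (u * st z))" if "u \<in> X" for u
      using \<tau>_st[of "u * st z"] that z by (simp add: X_mult X_st st_mult st_st)
    show "\<tau> (z * st (rep (cls a))) = \<tau> (z * st a)"
      using assms z rep by (simp add: * repD' X_st)
  qed
  then show ?thesis by (simp add: Q_def)
qed

lemma Q_simps: "carrier Q = cls ` X" "\<one>\<^bsub>Q\<^esub> = cls e" "\<zero>\<^bsub>Q\<^esub> = cls 0"
  by (simp_all add: Q_def)

lemma \<phi>Q_cls: assumes "a \<in> X" shows "\<phi>Q (cls a) = \<tau> a"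
  using repD[OF assms e_X] \<tau>_unit[OF assms] \<tau>_unit[OF rep(1)[OF assms]] by (simp add: \<phi>Q_def e_def)

text \<open>In \<open>X\<close> itself \<open>e\<close> need not be a unit, only under the trace.
  That suffices for the quotient, since the trace property brings \<open>e\<close> next to either
  side of a product.\<close>

lemma cls_e_mult: assumes "a \<in> X" shows "cls (e * a) = cls a" "cls (a * e) = cls a"
proof -
  have t: "\<tau> (e * u) = \<tau> u" "\<tau> (u * e) = \<tau> u" if "u \<in> X" for u
    using \<tau>_unit[OF that] \<tau>_comm[OF that e_X] by (simp_all add: e_def)
  show "cls (e * a) = cls a"
  proof (rule cls_eqI)
    fix z assume "z \<in> X"
    then show "\<tau> (z * (e * a)) = \<tau> (z * a)"
      using \<tau>_comm[of z "e * a"] \<tau>_comm[of z a] t(1)[of "a * z"] assms e_X by (simp add: X_mult mult.assoc)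
  qed
  show "cls (a * e) = cls a"
    by (rule cls_eqI) (use t(2)[OF X_mult] assms in \<open>simp add: mult.assoc\<close>)
qed

lemma abelian_group_Q: "abelian_group Q"
proof (rule abelian_groupI)
  show "\<zero>\<^bsub>Q\<^esub> \<in> carrier Q" by (simp add: Q_simps X_zero)
  fix f assume "f \<in> carrier Q"
  then obtain a where a: "a \<in> X" "f = cls a" by (auto simp: Q_simps)
  show "\<zero>\<^bsub>Q\<^esub> \<oplus>\<^bsub>Q\<^esub> f = f" using a by (simp add: Q_simps Q_add X_zero)
  show "\<exists>g\<in>carrier Q. g \<oplus>\<^bsub>Q\<^esub> f = \<zero>\<^bsub>Q\<^esub>"
    using a X_scl[of a "- 1"] Q_add[of "- a" a] by (auto simp: Q_simps scl_minus)
  fix g assume "g \<in> carrier Q"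
  then obtain b where b: "b \<in> X" "g = cls b" by (auto simp: Q_simps)
  show "f \<oplus>\<^bsub>Q\<^esub> g \<in> carrier Q" using a b by (simp add: Q_simps Q_add X_add)
  show "f \<oplus>\<^bsub>Q\<^esub> g = g \<oplus>\<^bsub>Q\<^esub> f" using a b by (simp add: Q_add add.commute)
  fix k assume "k \<in> carrier Q"
  then obtain c where c: "c \<in> X" "k = cls c" by (auto simp: Q_simps)
  show "f \<oplus>\<^bsub>Q\<^esub> g \<oplus>\<^bsub>Q\<^esub> k = f \<oplus>\<^bsub>Q\<^esub> (g \<oplus>\<^bsub>Q\<^esub> k)"
    using a b c by (simp add: Q_add X_add add.assoc)
qed

lemma ring_Q: "ring Q"
proof (rule ringI[OF abelian_group_Q])
  show "Group.monoid Q"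
  proof (rule monoidI)
    show "\<one>\<^bsub>Q\<^esub> \<in> carrier Q" by (simp add: Q_simps e_X)
    fix f assume "f \<in> carrier Q"
    then obtain a where a: "a \<in> X" "f = cls a" by (auto simp: Q_simps)
    show "\<one>\<^bsub>Q\<^esub> \<otimes>\<^bsub>Q\<^esub> f = f" "f \<otimes>\<^bsub>Q\<^esub> \<one>\<^bsub>Q\<^esub> = f"
      using a e_X by (simp_all add: Q_simps Q_mult cls_e_mult)
    fix g assume "g \<in> carrier Q"
    then obtain b where b: "b \<in> X" "g = cls b" by (auto simp: Q_simps)
    show "f \<otimes>\<^bsub>Q\<^esub> g \<in> carrier Q" using a b by (simp add: Q_simps Q_mult X_mult)
    fix k assume "k \<in> carrier Q"
    then obtain c where c: "c \<in> X" "k = cls c" by (auto simp: Q_simps)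
    show "f \<otimes>\<^bsub>Q\<^esub> g \<otimes>\<^bsub>Q\<^esub> k = f \<otimes>\<^bsub>Q\<^esub> (g \<otimes>\<^bsub>Q\<^esub> k)"
      using a b c by (simp add: Q_mult X_mult mult.assoc)
  qed
  fix f g k assume "f \<in> carrier Q" "g \<in> carrier Q" "k \<in> carrier Q"
  then obtain a b c where "a \<in> X" "f = cls a" "b \<in> X" "g = cls b" "c \<in> X" "k = cls c"
    by (auto simp: Q_simps)
  then show "(f \<oplus>\<^bsub>Q\<^esub> g) \<otimes>\<^bsub>Q\<^esub> k = f \<otimes>\<^bsub>Q\<^esub> k \<oplus>\<^bsub>Q\<^esub> g \<otimes>\<^bsub>Q\<^esub> k"
    "k \<otimes>\<^bsub>Q\<^esub> (f \<oplus>\<^bsub>Q\<^esub> g) = k \<otimes>\<^bsub>Q\<^esub> f \<oplus>\<^bsub>Q\<^esub> k \<otimes>\<^bsub>Q\<^esub> g"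
    by (simp_all add: Q_mult Q_add X_mult X_add distrib_left distrib_right)
qed

lemma module_Q: "Module.module (class_ring :: complex ring) Q"
proof (rule moduleI[OF _ abelian_group_Q])
  show "cring (class_ring :: complex ring)"
    by unfold_locales
       (auto simp: distrib_left distrib_right Units_def intro: exI[of _ "- _"])
  fix c c' :: complex and f g assume "f \<in> carrier Q" "g \<in> carrier Q"
  then obtain a b where ab: "a \<in> X" "f = cls a" "b \<in> X" "g = cls b"
    by (auto simp: Q_simps)
  show "c \<odot>\<^bsub>Q\<^esub> f \<in> carrier Q" using ab by (simp add: Q_simps Q_smult X_scl)
  show "c \<odot>\<^bsub>Q\<^esub> (f \<oplus>\<^bsub>Q\<^esub> g) = c \<odot>\<^bsub>Q\<^esub> f \<oplus>\<^bsub>Q\<^esub> c \<odot>\<^bsub>Q\<^esub> g"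
    using ab by (simp add: Q_smult Q_add X_scl X_add scl_add_right)
  show "(c \<oplus>\<^bsub>class_ring\<^esub> c') \<odot>\<^bsub>Q\<^esub> f = c \<odot>\<^bsub>Q\<^esub> f \<oplus>\<^bsub>Q\<^esub> c' \<odot>\<^bsub>Q\<^esub> f"
    using ab by (simp add: Q_smult Q_add X_scl scl_add_left)
  show "(c \<otimes>\<^bsub>class_ring\<^esub> c') \<odot>\<^bsub>Q\<^esub> f = c \<odot>\<^bsub>Q\<^esub> (c' \<odot>\<^bsub>Q\<^esub> f)"
    using ab by (simp add: Q_smult X_scl scl_scl)
  show "\<one>\<^bsub>class_ring\<^esub> \<odot>\<^bsub>Q\<^esub> f = f" using ab by (simp add: Q_smult scl_one)
qed

lemma tracial_ncps_Q: "tracial_ncps Q \<phi>Q"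
proof (intro tracial_ncps.intro ring_Q module_Q tracial_ncps_axioms.intro)
  fix f g and c :: complex
  {
    assume "f \<in> carrier Q"
    then obtain a where a: "a \<in> X" "f = cls a" by (auto simp: Q_simps)
    show "star Q f \<in> carrier Q" "star Q (star Q f) = f" "star Q (c \<odot>\<^bsub>Q\<^esub> f) = cnj c \<odot>\<^bsub>Q\<^esub> star Q f"
      "\<phi>Q (c \<odot>\<^bsub>Q\<^esub> f) = c * \<phi>Q f" "\<phi>Q (star Q f \<otimes>\<^bsub>Q\<^esub> f) \<in> \<real> \<and> 0 \<le> Re (\<phi>Q (star Q f \<otimes>\<^bsub>Q\<^esub> f))"
      using a \<tau>_pos[OF a(1)] 
      by (simp_all add: Q_simps Q_star Q_mult Q_smult X_st X_scl X_mult st_st st_scl \<phi>Q_cls \<tau>_scl)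
  }
  assume "f \<in> carrier Q" "g \<in> carrier Q"
  then obtain a b where ab: "a \<in> X" "f = cls a" "b \<in> X" "g = cls b"
    by (auto simp: Q_simps)
  show "(c \<odot>\<^bsub>Q\<^esub> f) \<otimes>\<^bsub>Q\<^esub> g = c \<odot>\<^bsub>Q\<^esub> (f \<otimes>\<^bsub>Q\<^esub> g)" "f \<otimes>\<^bsub>Q\<^esub> (c \<odot>\<^bsub>Q\<^esub> g) = c \<odot>\<^bsub>Q\<^esub> (f \<otimes>\<^bsub>Q\<^esub> g)"
    "star Q (f \<oplus>\<^bsub>Q\<^esub> g) = star Q f \<oplus>\<^bsub>Q\<^esub> star Q g" "star Q (f \<otimes>\<^bsub>Q\<^esub> g) = star Q g \<otimes>\<^bsub>Q\<^esub> star Q f"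
    "\<phi>Q (f \<oplus>\<^bsub>Q\<^esub> g) = \<phi>Q f + \<phi>Q g" "\<phi>Q (f \<otimes>\<^bsub>Q\<^esub> g) = \<phi>Q (g \<otimes>\<^bsub>Q\<^esub> f)"
    using ab \<tau>_comm[OF ab(1,3)]
    by (simp_all add: Q_mult Q_add Q_smult Q_star X_mult X_add X_scl X_st scl_mult_left scl_mult_right
        st_add st_mult \<phi>Q_cls \<tau>_add)
next
  show "\<phi>Q \<one>\<^bsub>Q\<^esub> = 1" using \<tau>_one e_X by (simp add: Q_simps \<phi>Q_cls e_def)
qed

lemma finsum_Q:
  assumes "finite S" "\<And>k. k \<in> S \<Longrightarrow> f k \<in> X"
  shows "(\<Oplus>\<^bsub>Q\<^esub>k\<in>S. cls (f k)) = cls (\<Sum>k\<in>S. f k)"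
  using assms
proof (induction S rule: finite_induct)
  case empty
  then show ?case
    using abelian_monoid.finsum_empty[of Q] abelian_group_Q by (simp add: abelian_group_def Q_simps)
next
  case (insert x F)
  have am: "abelian_monoid Q" using abelian_group_Q by (simp add: abelian_group_def)
  have "(\<Oplus>\<^bsub>Q\<^esub>k\<in>insert x F. cls (f k)) = cls (f x) \<oplus>\<^bsub>Q\<^esub> (\<Oplus>\<^bsub>Q\<^esub>k\<in>F. cls (f k))"
    using insert by (intro abelian_monoid.finsum_insert[OF am]) (auto simp: Q_simps)
  then show ?case using insert by (simp add: Q_add X_sum)
qed

abbreviation "pQ \<equiv> \<lambda>k. cls (pr k)"

lemma tracial_ncps_over_Q: "tracial_ncps_over Q \<phi>Q d pQ"
proof (intro tracial_ncps_over.intro tracial_ncps_Q tracial_ncps_over_axioms.intro)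
  fix k assume k: "k \<in> {1..d}"
  note p = X_pr[OF k]
  show "cls (pr k) \<in> carrier Q" using p by (simp add: Q_simps)
  show "\<phi>Q (cls (pr k)) \<noteq> 0" using \<tau>_pr[OF k] p by (simp add: \<phi>Q_cls)
  then show "cls (pr k) \<noteq> \<zero>\<^bsub>Q\<^esub>" using \<phi>Q_cls[OF X_zero] by (auto simp: Q_simps \<tau>_zero)
  show "star Q (cls (pr k)) = cls (pr k)" using p k by (simp add: Q_star st_pr)
  show "cls (pr k) \<otimes>\<^bsub>Q\<^esub> cls (pr k) = cls (pr k)" using p k by (simp add: Q_mult pr_mult)
  fix l assume "l \<in> {1..d}" "k \<noteq> l"
  then show "cls (pr k) \<otimes>\<^bsub>Q\<^esub> cls (pr l) = \<zero>\<^bsub>Q\<^esub>" using k by (simp add: Q_mult pr_mult X_pr Q_simps)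
next
  show "(\<Oplus>\<^bsub>Q\<^esub>k\<in>{1..d}. cls (pr k)) = \<one>\<^bsub>Q\<^esub>"
    using finsum_Q[of "{1..d}" pr] X_pr by (simp add: Q_simps e_def)
qed

section \<open>The diagonal subalgebra and the conditional expectation in the quotient\<close>

definition diag :: "(nat \<Rightarrow> complex) \<Rightarrow> 'x" where
  "diag c = (\<Sum>k=1..d. scl (c k) (pr k))"

lemma diag_X: "diag c \<in> X"
  unfolding diag_def by (intro X_sum X_scl X_pr)

lemma D_elem_Q: "D_elem Q d pQ c = cls (diag c)"
proof -
  interpret tracial_ncps_over Q \<phi>Q d pQ by (rule tracial_ncps_over_Q)
  have "(\<Oplus>\<^bsub>Q\<^esub>k\<in>{1..d}. c k \<odot>\<^bsub>Q\<^esub> cls (pr k)) = (\<Oplus>\<^bsub>Q\<^esub>k\<in>{1..d}. cls (scl (c k) (pr k)))"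
    by (rule finsum_cong') (auto simp: Q_smult X_pr Q_simps X_scl)
  then show ?thesis
    using finsum_Q[of "{1..d}" "\<lambda>k. scl (c k) (pr k)"] X_scl X_pr by (simp add: D_elem_def diag_def)
qed

lemma E_coord_Q:
  assumes "a \<in> X" "k \<in> {1..d}" shows "E_coord Q \<phi>Q pQ (cls a) k = \<tau> (pr k * a) / \<tau> (pr k)"
proof -
  have "\<tau> (pr k * a * pr k) = \<tau> (pr k * (pr k * a))"
    using \<tau>_comm[of "pr k * a" "pr k"] assms by (simp add: X_mult X_pr)
  also have "\<dots> = \<tau> (pr k * a)" using assms pr_mult[of k k] by (simp add: mult.assoc[symmetric])
  finally show ?thesis using assms by (simp add: E_coord_def Q_mult X_mult X_pr \<phi>Q_cls)
qed

text \<open>Centeredness becomes the vanishing of d traces, which can be tested before passing to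
  the quotient. A diagonal element is recovered from its traces against the projections because
  those have nonzero trace.\<close>

lemma cond_exp_Q:
  assumes "a \<in> X" shows "cond_exp_D Q \<phi>Q d pQ (cls a) = \<zero>\<^bsub>Q\<^esub> \<longleftrightarrow> (\<forall>k\<in>{1..d}. \<tau> (pr k * a) = 0)"
proof -
  let ?c = "E_coord Q \<phi>Q pQ (cls a)"
  have "\<tau> (pr l * diag ?c) = \<tau> (pr l * a)" if l: "l \<in> {1..d}" for l
  proof -
    have "pr l * diag ?c = (\<Sum>k=1..d. if k = l then scl (?c k) (pr k) else 0)"
      unfolding diag_def sum_distrib_left
      by (rule sum.cong) (use l in \<open>auto simp: scl_mult_right pr_mult scl_add_right[of _ 0 0, simplified]\<close>)
    also have "\<dots> = scl (?c l) (pr l)" using l by simp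
    finally show ?thesis using l assms \<tau>_pr[OF l] by (simp add: \<tau>_scl X_pr E_coord_Q)
  qed
  moreover have "cls (diag ?c) = cls 0 \<longleftrightarrow> (\<forall>l\<in>{1..d}. \<tau> (pr l * diag ?c) = 0)"
  proof
    assume "cls (diag ?c) = cls 0"
    then show "\<forall>l\<in>{1..d}. \<tau> (pr l * diag ?c) = 0"
      using cls_eqD[OF diag_X X_zero _ X_pr] by (simp add: \<tau>_zero)
  next
    assume "\<forall>l\<in>{1..d}. \<tau> (pr l * diag ?c) = 0"
    then have "?c l = 0" if "l \<in> {1..d}" for l
      using that calculation assms by (simp add: E_coord_Q)
    then have "diag ?c = 0" unfolding diag_def by (simp add: scl_zero)
    then show "cls (diag ?c) = cls 0" by simp
  qed
  ultimately show ?thesis by (simp add: cond_exp_D_def D_elem_Q Q_simps)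
qed

text \<open>Products and adjoints have to return to \<open>Y\<close> only modulo the kernel:
  cancellations between powers of a unitary hold almost surely, not identically.\<close>

lemma star_subalgebra_Q:
  assumes "Y \<subseteq> X" "\<And>k. k \<in> {1..d} \<Longrightarrow> pr k \<in> Y" "0 \<in> Y"
    "\<And>a b. a \<in> Y \<Longrightarrow> b \<in> Y \<Longrightarrow> a + b \<in> Y" "\<And>a b. a \<in> Y \<Longrightarrow> b \<in> Y \<Longrightarrow> cls (a * b) \<in> cls ` Y"
    "\<And>a c. a \<in> Y \<Longrightarrow> scl c a \<in> Y" "\<And>a. a \<in> Y \<Longrightarrow> cls (st a) \<in> cls ` Y"
  shows "star_subalgebra_over_D Q d pQ (cls ` Y)"
proof -
  have sumY: "sum f S \<in> Y" if "\<And>k. k \<in> S \<Longrightarrow> f k \<in> Y" for f :: "nat \<Rightarrow> 'x" and S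
    using that assms(3,4) by (induction S rule: infinite_finite_induct) auto
  have "diag c \<in> Y" for c
    unfolding diag_def by (rule sumY) (intro assms)
  then show ?thesis
    unfolding star_subalgebra_over_D_def
    using assms by (auto simp: D_elem_Q Q_add Q_mult Q_star Q_smult Q_simps subset_iff)
qed

lemma foldr_Q:
  "set xs \<subseteq> X \<Longrightarrow> foldr (*) xs e \<in> X \<and> foldr (\<otimes>\<^bsub>Q\<^esub>) (map cls xs) \<one>\<^bsub>Q\<^esub> = cls (foldr (*) xs e)"
  by (induction xs) (auto simp: Q_simps e_X Q_mult X_mult)

end

section \<open>Passing from matrices with carriers to finitely supported ones\<close>

definition emb :: "complex mat \<Rightarrow> fmat" where
  "emb X = fm (max (dim_row X) (dim_col X)) (\<lambda>i j. if i < dim_row X \<and> j < dim_col X then X $$ (i, j) else 0)"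

lemma ent_emb: "X \<in> carrier_mat n n \<Longrightarrow> ent (emb X) i j = (if i < n \<and> j < n then X $$ (i, j) else 0)"
  by (auto simp: emb_def)

lemma dimb_emb: "X \<in> carrier_mat n n \<Longrightarrow> dimb n (emb X)"
  by (rule dimbI) (auto simp: ent_emb)

lemma emb_mult:
  assumes "X \<in> carrier_mat n n" "Y \<in> carrier_mat n n" shows "emb (X * Y) = emb X * emb Y"
proof (rule fmat_eqI)
  fix i j
  have XY: "X * Y \<in> carrier_mat n n" using assms by simp
  show "ent (emb (X * Y)) i j = ent (emb X * emb Y) i j"
    unfolding ent_mult_left[OF dimb_emb[OF assms(1)]] ent_emb[OF XY] ent_emb[OF assms(1)] ent_emb[OF assms(2)]
    using assms by (auto simp: scalar_prod_def lessThan_atLeast0 intro!: sum.cong)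
qed

lemma mat_adjoint_carrier: "X \<in> carrier_mat n n \<Longrightarrow> mat_adjoint X \<in> carrier_mat n n"
  by (auto simp: mat_adjoint_def)

lemma mat_adjoint_index:
  assumes "X \<in> carrier_mat n n" "i < n" "j < n" shows "mat_adjoint X $$ (i, j) = cnj (X $$ (j, i))"
  using assms by (auto simp: mat_adjoint_def mat_of_rows_index)

lemma emb_adjoint: "X \<in> carrier_mat n n \<Longrightarrow> emb (mat_adjoint X) = star_fmat (emb X)"
  by (rule fmat_eqI) (auto simp: ent_emb ent_emb[OF mat_adjoint_carrier] mat_adjoint_index)

lemma emb_one: "emb (1\<^sub>m n) = dproj {..<n}"
  by (rule fmat_eqI) (auto simp: ent_emb[OF one_carrier_mat] ent_dproj)

lemma mat_trace_emb: "X \<in> carrier_mat n n \<Longrightarrow> mat_trace X = Tr (emb X)"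
  by (auto simp: mat_trace_def Tr_eq[OF dimb_emb] ent_emb intro!: sum.cong)

lemma emb_inject:
  assumes "X \<in> carrier_mat n n" "Y \<in> carrier_mat n n" "emb X = emb Y" shows "X = Y"
proof (rule eq_matI)
  fix i j assume "i < dim_row Y" "j < dim_col Y"
  then show "X $$ (i, j) = Y $$ (i, j)"
    using arg_cong[OF assms(3), of "\<lambda>A. ent A i j"] assms(1,2) by (auto simp: ent_emb)
qed (use assms in auto)

definition unemb :: "nat \<Rightarrow> fmat \<Rightarrow> complex mat" where
  "unemb n A = mat n n (\<lambda>(i, j). ent A i j)"

lemma unemb_carrier [simp]: "unemb n A \<in> carrier_mat n n"
  by (simp add: unemb_def)

lemma emb_unemb: "dimb n A \<Longrightarrow> emb (unemb n A) = A"
  by (rule fmat_eqI) (simp only: ent_emb[OF unemb_carrier], auto simp: unemb_def dimb_zero)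

subsection \<open>Blocks\<close>

text \<open>Label of the diagonal block containing an index when the blocks are laid out in the
  order of the list; the value 0 of the empty list is not reached within the total size.\<close>

fun block_of :: "(nat \<Rightarrow> nat) \<Rightarrow> nat list \<Rightarrow> nat \<Rightarrow> nat" where
  "block_of q [] i = 0"
| "block_of q (k # ks) i = (if i < q k then k else block_of q ks (i - q k))"

lemma diag_block_index:
  fixes c :: "nat \<Rightarrow> complex" and q :: "nat \<Rightarrow> nat"
  defines "D \<equiv> \<lambda>ks. diag_block_mat (map (\<lambda>k. c k \<cdot>\<^sub>m 1\<^sub>m (q k)) ks)"
  shows "D ks \<in> carrier_mat (sum_list (map q ks)) (sum_list (map q ks)) \<and>
    (\<forall>i j. i < sum_list (map q ks) \<longrightarrow> j < sum_list (map q ks) \<longrightarrow>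
      D ks $$ (i, j) = (if i = j then c (block_of q ks i) else 0))"
proof (induction ks)
  case (Cons k ks)
  have eq: "D (k # ks) = four_block_mat (c k \<cdot>\<^sub>m 1\<^sub>m (q k)) (0\<^sub>m (q k) (dim_col (D ks)))
      (0\<^sub>m (dim_row (D ks)) (q k)) (D ks)"
    by (simp add: D_def Let_def)
  show ?case using Cons unfolding eq by auto
qed (simp add: D_def)

lemma block_of_in: "i < sum_list (map q ks) \<Longrightarrow> block_of q ks i \<in> set ks"
  by (induction ks arbitrary: i) auto

lemma card_block_of:
  "distinct ks \<Longrightarrow> card {i. i < sum_list (map q ks) \<and> block_of q ks i = k} = (if k \<in> set ks then q k else 0)"
proof (induction ks)
  case (Cons l ks)
  let ?N = "sum_list (map q ks)"
  have "{i. i < sum_list (map q (l # ks)) \<and> block_of q (l # ks) i = k} =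
     (if k = l then {..<q l} else {}) \<union> (\<lambda>i. i + q l) ` {i. i < ?N \<and> block_of q ks i = k}" (is "?A = ?B")
  proof (intro equalityI subsetI)
    fix i assume i: "i \<in> ?A"
    show "i \<in> ?B"
    proof (cases "i < q l")
      case False
      then have "i = (i - q l) + q l" "i - q l < ?N" "block_of q ks (i - q l) = k" using i by auto
      then show ?thesis by blast
    qed (use i in auto)
  qed (auto split: if_splits)
  moreover have "card ?B = (if k = l then q l else 0) + card {i. i < ?N \<and> block_of q ks i = k}"
    by (subst card_Un_disjoint) (auto simp: card_image)
  ultimately show ?case using Cons by auto
qed simp

definition block :: "nat \<Rightarrow> (nat \<Rightarrow> nat) \<Rightarrow> nat \<Rightarrow> nat set" where
  "block d q k = {i. i < (\<Sum>l=1..d. q l) \<and> block_of q [1..<Suc d] i = k}"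

lemma sum_list_upt: "sum_list (map q [1..<Suc d]) = (\<Sum>l=1..d. q l)"
  by (simp add: interv_sum_list_conv_sum_set_nat atLeastLessThanSuc_atLeastAtMost del: upt_Suc)

lemma finite_block [simp]: "finite (block d q k)"
  by (simp add: block_def)

lemma block_subset: "block d q k \<subseteq> {..<(\<Sum>l=1..d. q l)}"
  by (auto simp: block_def)

lemma card_block: "k \<in> {1..d} \<Longrightarrow> card (block d q k) = q k"
  using card_block_of[of "[1..<Suc d]" q k] unfolding sum_list_upt block_def by (auto simp del: upt_Suc)

lemma block_disjoint: "k \<noteq> l \<Longrightarrow> block d q k \<inter> block d q l = {}"
  by (auto simp: block_def)

lemma block_of_range: "i < (\<Sum>l=1..d. q l) \<Longrightarrow> block_of q [1..<Suc d] i \<in> {1..d}"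
  using block_of_in[of i q "[1..<Suc d]"] unfolding sum_list_upt by (auto simp del: upt_Suc)

lemma D_mat_carrier: "D_mat d q c \<in> carrier_mat (\<Sum>l=1..d. q l) (\<Sum>l=1..d. q l)"
  and D_mat_index: "i < (\<Sum>l=1..d. q l) \<Longrightarrow> j < (\<Sum>l=1..d. q l) \<Longrightarrow>
    D_mat d q c $$ (i, j) = (if i = j then c (block_of q [1..<Suc d] i) else 0)"
  using diag_block_index[of c q "[1..<Suc d]"] unfolding sum_list_upt D_mat_def by blast+

lemma emb_D_mat: "emb (D_mat d q c) = (\<Sum>k=1..d. sc (c k) (dproj (block d q k)))"
proof (rule fmat_eqI)
  fix i j
  let ?n = "\<Sum>l=1..d. q l" and ?b = "block_of q [1..<Suc d] i"
  have "(\<Sum>k=1..d. c k * ent (dproj (block d q k)) i j) = 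
     (\<Sum>k=1..d. if k = ?b then if i = j \<and> i < ?n then c k else 0 else 0)"
    by (rule sum.cong) (auto simp: ent_dproj block_def simp del: upt_Suc)
  also have "\<dots> = (if i = j \<and> i < ?n then c ?b else 0)"
    using block_of_range[of i q d] by (auto simp: sum.delta simp del: upt_Suc)
  finally show "ent (emb (D_mat d q c)) i j = ent (\<Sum>k=1..d. sc (c k) (dproj (block d q k))) i j"
    by (auto simp: ent_emb[OF D_mat_carrier] D_mat_index simp del: upt_Suc)
qed

lemma emb_block_proj:
  assumes "k \<in> {1..d}" shows "emb (block_proj d q k) = dproj (block d q k)"
proof -
  have "(\<Sum>l=1..d. sc (if l = k then 1 else 0) (dproj (block d q l))) =
      (\<Sum>l=1..d. if l = k then dproj (block d q l) else 0)"
    by (rule sum.cong) auto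
  then show ?thesis using assms by (simp add: block_proj_def emb_D_mat)
qed

lemma block_proj_carrier: "block_proj d q k \<in> carrier_mat (\<Sum>l=1..d. q l) (\<Sum>l=1..d. q l)"
  unfolding block_proj_def by (rule D_mat_carrier)

lemma sum_dproj_block: "(\<Sum>k=1..d. dproj (block d q k)) = dproj {..<(\<Sum>l=1..d. q l)}"
proof -
  have "(\<Sum>k=1..d. dproj (block d q k)) = emb (D_mat d q (\<lambda>_. 1))"
    by (simp add: emb_D_mat)
  also have "\<dots> = dproj {..<(\<Sum>l=1..d. q l)}"
    by (rule fmat_eqI) (auto simp: ent_emb[OF D_mat_carrier] D_mat_index ent_dproj)
  finally show ?thesis .
qed

subsection \<open>Haar unitaries\<close>

lemma space_mat_borel: "space (mat_borel n) = carrier_mat n n"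
  unfolding mat_borel_def by (rule space_measure_of) auto

lemma mat_borel_entry:
  assumes "i < n" "j < n" shows "(\<lambda>X. X $$ (i, j)) \<in> borel_measurable (mat_borel n)"
proof (rule measurableI)
  fix S :: "complex set" assume "S \<in> sets borel"
  then have "{X \<in> carrier_mat n n. X $$ (i, j) \<in> S} \<in> sets (mat_borel n)"
    unfolding mat_borel_def using assms by (intro in_measure_of) blast+
  moreover have "(\<lambda>X. X $$ (i, j)) -` S \<inter> space (mat_borel n) = {X \<in> carrier_mat n n. X $$ (i, j) \<in> S}"
    by (auto simp: space_mat_borel)
  ultimately show "(\<lambda>X. X $$ (i, j)) -` S \<inter> space (mat_borel n) \<in> sets (mat_borel n)" by simp
qed simp

lemma measurable_mat_borelI:
  fixes f :: "'a \<Rightarrow> complex mat"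
  assumes "\<And>x. x \<in> space N \<Longrightarrow> f x \<in> carrier_mat n n"
    "\<And>i j. i < n \<Longrightarrow> j < n \<Longrightarrow> (\<lambda>x. f x $$ (i, j)) \<in> borel_measurable N"
  shows "f \<in> measurable N (mat_borel n)"
  unfolding mat_borel_def
proof (rule measurable_measure_of)
  fix T :: "complex mat set"
  assume "T \<in> {{X \<in> carrier_mat n n. X $$ (i, j) \<in> S} |i j S. i < n \<and> j < n \<and> S \<in> sets borel}"
  then obtain i j S where T: "T = {X \<in> carrier_mat n n. X $$ (i, j) \<in> S}" "i < n" "j < n" "S \<in> sets borel"
    by blast
  have "f -` T \<inter> space N = (\<lambda>x. f x $$ (i, j)) -` S \<inter> space N" using assms(1) T by auto
  then show "f -` T \<inter> space N \<in> sets N" using measurable_sets[OF assms(2)[OF T(2,3)] T(4)] by simp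
qed (use assms in auto)

lemma mat_borel_mult:
  assumes "W \<in> carrier_mat n n"
  shows "(\<lambda>X. W * X) \<in> measurable (mat_borel n) (mat_borel n)"
    and "(\<lambda>X. X * W) \<in> measurable (mat_borel n) (mat_borel n)"
proof -
  have "(\<lambda>X. (W * X) $$ (i, j)) \<in> borel_measurable (mat_borel n)" if "i < n" "j < n" for i j
  proof -
    have "(\<lambda>X. \<Sum>l<n. W $$ (i, l) * X $$ (l, j)) \<in> borel_measurable (mat_borel n)"
      using that by (intro borel_measurable_sum borel_measurable_times mat_borel_entry) auto
    then show ?thesis
      by (rule measurable_cong[THEN iffD1, rotated])
         (use assms that in \<open>auto simp: space_mat_borel scalar_prod_def lessThan_atLeast0 intro!: sum.cong\<close>)
  qed
  then show "(\<lambda>X. W * X) \<in> measurable (mat_borel n) (mat_borel n)"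
    using assms by (intro measurable_mat_borelI) (auto simp: space_mat_borel)
  have "(\<lambda>X. (X * W) $$ (i, j)) \<in> borel_measurable (mat_borel n)" if "i < n" "j < n" for i j
  proof -
    have "(\<lambda>X. \<Sum>l<n. X $$ (i, l) * W $$ (l, j)) \<in> borel_measurable (mat_borel n)"
      using that by (intro borel_measurable_sum borel_measurable_times mat_borel_entry) auto
    then show ?thesis
      by (rule measurable_cong[THEN iffD1, rotated])
         (use assms that in \<open>auto simp: space_mat_borel scalar_prod_def lessThan_atLeast0 intro!: sum.cong\<close>)
  qed
  then show "(\<lambda>X. X * W) \<in> measurable (mat_borel n) (mat_borel n)"
    using assms by (intro measurable_mat_borelI) (auto simp: space_mat_borel)
qed

lemma block_unitary_carrier: 
  assumes "U \<in> block_unitary d q (\<Sum>l=1..d. q l) k"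
  shows "U \<in> carrier_mat (\<Sum>l=1..d. q l) (\<Sum>l=1..d. q l)"
  using assms block_proj_carrier[of d q k] unfolding block_unitary_def by auto

lemma block_unitary_emb:
  assumes U: "U \<in> block_unitary d q n k" and n: "n = (\<Sum>l=1..d. q l)" and k: "k \<in> {1..d}"
  shows "emb U * star_fmat (emb U) = dproj (block d q k)" "star_fmat (emb U) * emb U = dproj (block d q k)"
    "dproj (block d q k) * emb U = emb U" "emb U * dproj (block d q k) = emb U"
proof -
  have c: "U \<in> carrier_mat n n" using block_unitary_carrier U n by blast
  have p: "block_proj d q k \<in> carrier_mat n n" unfolding n by (rule block_proj_carrier)
  note E = emb_block_proj[OF k]
  show "emb U * star_fmat (emb U) = dproj (block d q k)" "star_fmat (emb U) * emb U = dproj (block d q k)"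
  proof -
    have u: "U * mat_adjoint U = block_proj d q k" "mat_adjoint U * U = block_proj d q k"
      using U by (auto simp: block_unitary_def)
    note a = mat_adjoint_carrier[OF c]
    show "emb U * star_fmat (emb U) = dproj (block d q k)" "star_fmat (emb U) * emb U = dproj (block d q k)"
      unfolding E[symmetric] emb_adjoint[OF c, symmetric] emb_mult[OF c a, symmetric] emb_mult[OF a c, symmetric]
      by (simp_all only: u)
  qed
  obtain X where X: "X \<in> carrier_mat n n" "U = block_proj d q k * X * block_proj d q k"
    using U by (auto simp: block_unitary_def)
  have eU: "emb U = dproj (block d q k) * emb X * dproj (block d q k)"
    using X p by (simp add: emb_mult[of _ n] E mult.assoc)
  have PP: "dproj (block d q k) * dproj (block d q k) = dproj (block d q k)"
    by (simp add: dproj_dproj)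
  show "dproj (block d q k) * emb U = emb U"
    unfolding eU by (simp add: mult.assoc[symmetric] PP)
  show "emb U * dproj (block d q k) = emb U"
    unfolding eU by (simp add: mult.assoc PP)
qed

text \<open>Converse passage: a finitely supported unitary of the corner comes from the compact
  group, so that invariance of its Haar measure applies. The size bound follows from absorption of
  the projection on both sides.\<close>

lemma unemb_block_unitary:
  assumes W: "W * star_fmat W = dproj (block d q k)" "star_fmat W * W = dproj (block d q k)"
    "dproj (block d q k) * W = W" "W * dproj (block d q k) = W"
    and n: "n = (\<Sum>l=1..d. q l)" and k: "k \<in> {1..d}"
  shows "unemb n W \<in> block_unitary d q n k" "emb (unemb n W) = W"
proof -
  have "dimb n W"
  proof (rule dimbI)
    fix i j assume "\<not> (i < n \<and> j < n)"
    then have "i \<notin> block d q k \<or> j \<notin> block d q k" using block_subset[of d q k] n by auto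
    then show "ent W i j = 0"
      using arg_cong[OF W(3), of "\<lambda>A. ent A i j"] arg_cong[OF W(4), of "\<lambda>A. ent A i j"]
      by (auto simp: dproj_mult mult_dproj split: if_splits)
  qed
  then show e: "emb (unemb n W) = W" by (rule emb_unemb)
  have p: "block_proj d q k \<in> carrier_mat n n" unfolding n by (rule block_proj_carrier)
  note E = emb_block_proj[OF k]
  let ?W = "unemb n W"
  have c: "?W \<in> carrier_mat n n" by (rule unemb_carrier)
  note a = mat_adjoint_carrier[OF c]
  have "?W = block_proj d q k * ?W * block_proj d q k"
    by (rule emb_inject[OF c mult_carrier_mat[OF mult_carrier_mat[OF p c] p]])
       (simp only: emb_mult[OF mult_carrier_mat[OF p c] p] emb_mult[OF p c] E e W)
  moreover have "?W * mat_adjoint ?W = block_proj d q k"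
    by (rule emb_inject[OF mult_carrier_mat[OF c a] p])
       (simp only: emb_mult[OF c a] emb_adjoint[OF c] E e W)
  moreover have "mat_adjoint ?W * ?W = block_proj d q k"
    by (rule emb_inject[OF mult_carrier_mat[OF a c] p])
       (simp only: emb_mult[OF a c] emb_adjoint[OF c] E e W)
  ultimately show "?W \<in> block_unitary d q n k"
    unfolding block_unitary_def using unemb_carrier by blast
qed

lemma wv_cong: "(\<And>x. x \<in> set w \<Longrightarrow> L (fst x) = L' (fst x)) \<Longrightarrow> wv L b w = wv L' b w"
proof (induction w arbitrary: b)
  case (Cons x w)
  obtain v c where x: "x = (v, c)" by (cases x)
  have "wv L c w = wv L' c w" by (rule Cons.IH) (rule Cons.prems, simp)
  moreover have "L v = L' v" using Cons.prems[of x] x by simp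
  ultimately show ?case by (simp add: x)
qed simp

text \<open>By independence the joint law is the product of the marginals. Translating one member
  keeps both independence and its Haar marginal, hence the joint law and all means computed from
  it.\<close>

lemma haar_family_blocks:
  fixes V :: "nat \<Rightarrow> nat \<Rightarrow> 'w \<Rightarrow> complex mat"
  assumes M: "prob_space M" and n: "n = (\<Sum>l=1..d. q l)"
    and indep: "prob_space.indep_vars M (\<lambda>_. mat_borel n) (\<lambda>(s, k). V s k) (UNIV \<times> {1..d})"
    and unif: "\<And>s k. k \<in> {1..d} \<Longrightarrow> uniform_on M n (block_unitary d q n k) (V s k)"
  shows "haar_family M n (UNIV \<times> {1..d}) (\<lambda>i. block d q (snd i)) (\<lambda>i \<omega>. emb (V (fst i) (snd i) \<omega>))"
proof -
  interpret prob_space M by (rule M)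
  let ?I = "UNIV \<times> {1..d} :: (nat \<times> nat) set" and ?MB = "mat_borel n"
  define Vp where "Vp i = V (fst i) (snd i)" for i
  have Vp: "Vp = (\<lambda>(s, k). V s k)" by (auto simp: Vp_def fun_eq_iff)
  have meas: "Vp i \<in> measurable M ?MB" if "i \<in> ?I" for i
    using unif[of "snd i" "fst i"] that by (auto simp: uniform_on_def Vp_def)
  have carr: "Vp i \<omega> \<in> carrier_mat n n" if "i \<in> ?I" "\<omega> \<in> space M" for i \<omega>
    using measurable_space[OF meas[OF that(1)] that(2)] by (simp add: space_mat_borel)
  have entm: "(\<lambda>X. ent (emb X) a b) \<in> borel_measurable ?MB" for a b
  proof -
    have "(\<lambda>X. if a < n \<and> b < n then X $$ (a, b) else 0) \<in> borel_measurable ?MB"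
      using mat_borel_entry by (cases "a < n \<and> b < n") auto
    then show ?thesis
      by (rule measurable_cong[THEN iffD1, rotated]) (auto simp: space_mat_borel ent_emb)
  qed
  show ?thesis
  proof (unfold_locales)
    fix i :: "nat \<times> nat" assume i: "i \<in> ?I"
    show "block d q (snd i) \<subseteq> {..<n}" unfolding n by (rule block_subset)
    show "(\<lambda>\<omega>. ent (emb (V (fst i) (snd i) \<omega>)) a b) \<in> borel_measurable M" for a b
      using measurable_compose[OF meas[OF i] entm] by (simp add: Vp_def)
    show "dimb n (emb (V (fst i) (snd i) \<omega>))" if "\<omega> \<in> space M" for \<omega>
      using carr[OF i that] by (simp add: Vp_def dimb_emb)
  next
    have "AE \<omega> in M. Vp i \<omega> \<in> block_unitary d q n (snd i)" if i: "i \<in> ?I" for i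
    proof -
      have "AE U in distr M ?MB (Vp i). U \<in> block_unitary d q n (snd i)"
      proof -
        have "uniform_on M n (block_unitary d q n (snd i)) (Vp i)"
          unfolding Vp_def by (rule unif) (use i in auto)
        then show ?thesis unfolding uniform_on_def haar_prob_def by blast
      qed
      then show ?thesis by (rule AE_distrD[OF meas[OF i]])
    qed
    \<comment> \<open>The exceptional null sets can be united because there are countably many
      indices.\<close>
    then have "AE \<omega> in M. \<forall>i\<in>?I. Vp i \<omega> \<in> block_unitary d q n (snd i)"
      by (subst AE_ball_countable) auto
    then show "AE \<omega> in M. \<forall>i\<in>?I.
       emb (V (fst i) (snd i) \<omega>) * star_fmat (emb (V (fst i) (snd i) \<omega>)) = dproj (block d q (snd i)) \<and>
       star_fmat (emb (V (fst i) (snd i) \<omega>)) * emb (V (fst i) (snd i) \<omega>) = dproj (block d q (snd i)) \<and>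
       dproj (block d q (snd i)) * emb (V (fst i) (snd i) \<omega>) = emb (V (fst i) (snd i) \<omega>) \<and>
       emb (V (fst i) (snd i) \<omega>) * dproj (block d q (snd i)) = emb (V (fst i) (snd i) \<omega>)"
      by (rule eventually_mono) (use block_unitary_emb[OF _ n] in \<open>auto simp: Vp_def\<close>)
  next
    fix v :: "(nat \<times> nat) letter" and W b b' and w w' :: "((nat \<times> nat) letter \<times> fmat) list"
    assume v: "fst v \<in> ?I" and W: "W * star_fmat W = dproj (block d q (snd (fst v)))"
      "star_fmat W * W = dproj (block d q (snd (fst v)))"
      "dproj (block d q (snd (fst v))) * W = W" "W * dproj (block d q (snd (fst v))) = W"
      and b: "dimb n b" "dimb n b'" and w: "\<forall>x\<in>set w \<union> set w'. fst (fst x) \<in> ?I \<and> dimb n (snd x)"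
    obtain i0 adj where v0: "v = (i0, adj)" by (cases v)
    have k: "snd i0 \<in> {1..d}" and i0: "i0 \<in> ?I" using v v0 by auto
    \<comment> \<open>Translating an adjoint letter multiplies the underlying matrix by the adjoint
      of W from the right, translating a plain one by W from the left. \<open>Z\<close> is this
      factor and \<open>f\<close> below the resulting map.\<close>
    define Z where "Z = unemb n (if adj then star_fmat W else W)"
    have Z: "Z \<in> block_unitary d q n (snd i0)" "emb Z = (if adj then star_fmat W else W)"
    proof -
      let ?P = "dproj (block d q (snd i0))"
      have P: "star_fmat ?P = ?P" by (simp add: star_dproj)
      have "star_fmat (?P * W) = star_fmat W * ?P" "star_fmat (W * ?P) = ?P * star_fmat W"
        by (simp_all add: star_mult_fmat P)
      then have "?P * star_fmat W = star_fmat W" "star_fmat W * ?P = star_fmat W"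
        using W v0 by simp_all
      then show "Z \<in> block_unitary d q n (snd i0)" "emb Z = (if adj then star_fmat W else W)"
        using unemb_block_unitary[of "if adj then star_fmat W else W" d q "snd i0", OF _ _ _ _ n k] W v0
        by (auto simp: Z_def)
    qed
    have Zc: "Z \<in> carrier_mat n n" by (simp add: Z_def)
    define f where "f = (if adj then (\<lambda>X. X * Z) else (\<lambda>X. Z * X))"
    have f: "f \<in> measurable ?MB ?MB" using mat_borel_mult[OF Zc] by (simp add: f_def)
    define Y where "Y i = (if i = i0 then f else (\<lambda>X. X))" for i
    have Y: "Y i \<in> measurable ?MB ?MB" for i using f by (simp add: Y_def)
    define V' where "V' i \<omega> = Y i (Vp i \<omega>)" for i \<omega>
    have V'm: "V' i \<in> measurable M ?MB" if "i \<in> ?I" for i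
      unfolding V'_def using measurable_compose[OF meas[OF that] Y] .
    have ind: "indep_vars (\<lambda>_. ?MB) Vp ?I" using indep by (simp add: Vp)
    have ind': "indep_vars (\<lambda>_. ?MB) V' ?I"
      unfolding V'_def by (rule indep_vars_compose2[OF ind Y])
    have same: "distr M ?MB (V' i) = distr M ?MB (Vp i)" if i: "i \<in> ?I" for i
    proof (cases "i = i0")
      case True
      have "distr M ?MB (V' i) = distr (distr M ?MB (Vp i)) ?MB f"
        using distr_distr[OF f meas[OF i]] True by (simp add: V'_def[abs_def] Y_def comp_def)
      also have "\<dots> = distr M ?MB (Vp i)"
        using unif[OF k, of "fst i0"] Z(1) True
        by (auto simp: uniform_on_def haar_prob_def f_def Vp_def)
      finally show ?thesis .
    qed (simp add: V'_def[abs_def] Y_def)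
    have ne: "?I \<noteq> {}" using i0 by blast
    let ?PM = "Pi\<^sub>M ?I (\<lambda>_. ?MB)"
    have joint: "distr M ?PM (\<lambda>\<omega>. \<lambda>i\<in>?I. V' i \<omega>) = distr M ?PM (\<lambda>\<omega>. \<lambda>i\<in>?I. Vp i \<omega>)"
    proof -
      have "distr M ?PM (\<lambda>\<omega>. \<lambda>i\<in>?I. V' i \<omega>) = Pi\<^sub>M ?I (\<lambda>i. distr M ?MB (V' i))"
        using indep_vars_iff_distr_eq_PiM'[OF ne, of V' "\<lambda>_. ?MB"] V'm ind' by blast
      also have "\<dots> = Pi\<^sub>M ?I (\<lambda>i. distr M ?MB (Vp i))"
        by (rule PiM_cong) (use same in auto)
      also have "\<dots> = distr M ?PM (\<lambda>\<omega>. \<lambda>i\<in>?I. Vp i \<omega>)"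
        using indep_vars_iff_distr_eq_PiM'[OF ne, of Vp "\<lambda>_. ?MB"] meas ind by simp
      finally show ?thesis .
    qed
    \<comment> \<open>The product of traces as a function on the product space: both means are
      integrals of \<open>F\<close> against the same joint law.\<close>
    define F where "F x = Tr (wv (lett (\<lambda>i. emb (x i))) b w) * Tr (wv (lett (\<lambda>i. emb (x i))) b' w')" for x
    interpret PM: random_matrix ?PM n .
    have rm: "PM.rmat (\<lambda>x. lett (\<lambda>i. emb (x i)) v)" if "fst v \<in> ?I" for v
    proof (rule PM.rmat_lett[OF _ that])
      fix i assume i: "i \<in> ?I"
      show "PM.rmat (\<lambda>x. emb (x i))"
        unfolding PM.rmat_def
      proof (intro conjI allI ballI)
        show "(\<lambda>x. ent (emb (x i)) a b) \<in> borel_measurable ?PM" for a b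
          by (rule measurable_compose[OF measurable_component_singleton[OF i] entm])
        show "dimb n (emb (x i))" if "x \<in> space ?PM" for x
        proof -
          have "x i \<in> space ?MB" using that i by (auto simp: space_PiM)
          then show ?thesis by (simp add: space_mat_borel dimb_emb)
        qed
      qed
    qed
    have Fm: "F \<in> borel_measurable ?PM"
      unfolding F_def
      by (intro borel_measurable_times PM.rmat_Tr PM.rmat_wv[where I = ?I] rm b) (use w in blast)+
    have int: "(\<integral>\<omega>. F (\<lambda>i\<in>?I. X i \<omega>) \<partial>M) = (\<integral>x. F x \<partial>distr M ?PM (\<lambda>\<omega>. \<lambda>i\<in>?I. X i \<omega>))"
      if "\<And>i. i \<in> ?I \<Longrightarrow> X i \<in> measurable M ?MB" for X
      by (rule integral_distr[symmetric, OF _ Fm]) (rule measurable_restrict, rule that)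
    have letters: "lett (\<lambda>i. emb ((\<lambda>i\<in>?I. V' i \<omega>) i)) x = lett (translate v W (\<lambda>i. emb (V (fst i) (snd i) \<omega>))) x"
      if \<omega>: "\<omega> \<in> space M" and x: "fst x \<in> ?I" for \<omega> x
    proof -
      have "emb (V' i \<omega>) = translate v W (\<lambda>i. emb (V (fst i) (snd i) \<omega>)) i" if i: "i \<in> ?I" for i
        using carr[OF i \<omega>] Zc Z(2)
        by (auto simp: V'_def Y_def f_def v0 emb_mult[of _ n] Vp_def)
      then show ?thesis using x by (cases x) auto
    qed
    have "(\<integral>\<omega>. Tr (wv (lett (translate v W (\<lambda>i. emb (V (fst i) (snd i) \<omega>)))) b w) *
        Tr (wv (lett (translate v W (\<lambda>i. emb (V (fst i) (snd i) \<omega>)))) b' w') \<partial>M) =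
        (\<integral>\<omega>. F (\<lambda>i\<in>?I. V' i \<omega>) \<partial>M)"
    proof (rule Bochner_Integration.integral_cong[OF refl])
      fix \<omega> assume \<omega>: "\<omega> \<in> space M"
      have "wv (lett (\<lambda>i. emb ((\<lambda>i\<in>?I. V' i \<omega>) i))) b w = wv (lett (translate v W (\<lambda>i. emb (V (fst i) (snd i) \<omega>)))) b w"
        "wv (lett (\<lambda>i. emb ((\<lambda>i\<in>?I. V' i \<omega>) i))) b' w' = wv (lett (translate v W (\<lambda>i. emb (V (fst i) (snd i) \<omega>)))) b' w'"
        by (rule wv_cong, rule letters[OF \<omega>], use w in blast)+
      then show "Tr (wv (lett (translate v W (\<lambda>i. emb (V (fst i) (snd i) \<omega>)))) b w) *
        Tr (wv (lett (translate v W (\<lambda>i. emb (V (fst i) (snd i) \<omega>)))) b' w') = F (\<lambda>i\<in>?I. V' i \<omega>)"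
        unfolding F_def by (simp only:)
    qed
    also have "\<dots> = (\<integral>x. F x \<partial>distr M ?PM (\<lambda>\<omega>. \<lambda>i\<in>?I. V' i \<omega>))"
      by (rule int) (rule V'm)
    also have "\<dots> = (\<integral>x. F x \<partial>distr M ?PM (\<lambda>\<omega>. \<lambda>i\<in>?I. Vp i \<omega>))"
      by (simp only: joint)
    also have "\<dots> = (\<integral>\<omega>. F (\<lambda>i\<in>?I. Vp i \<omega>) \<partial>M)"
      by (rule int[symmetric]) (rule meas)
    also have "\<dots> = (\<integral>\<omega>. Tr (wv (lett (\<lambda>i. emb (V (fst i) (snd i) \<omega>))) b w) *
        Tr (wv (lett (\<lambda>i. emb (V (fst i) (snd i) \<omega>))) b' w') \<partial>M)"
    proof (rule Bochner_Integration.integral_cong[OF refl])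
      fix \<omega> assume \<omega>: "\<omega> \<in> space M"
      have l: "lett (\<lambda>i. emb ((\<lambda>i\<in>?I. Vp i \<omega>) i)) x = lett (\<lambda>i. emb (V (fst i) (snd i) \<omega>)) x" if "fst x \<in> ?I" for x
        using that by (cases x) (auto simp: Vp_def)
      have "wv (lett (\<lambda>i. emb ((\<lambda>i\<in>?I. Vp i \<omega>) i))) b w = wv (lett (\<lambda>i. emb (V (fst i) (snd i) \<omega>))) b w"
        "wv (lett (\<lambda>i. emb ((\<lambda>i\<in>?I. Vp i \<omega>) i))) b' w' = wv (lett (\<lambda>i. emb (V (fst i) (snd i) \<omega>))) b' w'"
        by (rule wv_cong, rule l, use w in blast)+
      then show "F (\<lambda>i\<in>?I. Vp i \<omega>) = Tr (wv (lett (\<lambda>i. emb (V (fst i) (snd i) \<omega>))) b w) *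
        Tr (wv (lett (\<lambda>i. emb (V (fst i) (snd i) \<omega>))) b' w')"
        unfolding F_def by (simp only:)
    qed
    finally show "(\<integral>\<omega>. Tr (wv (lett (translate v W (\<lambda>i. emb (V (fst i) (snd i) \<omega>)))) b w) *
        Tr (wv (lett (translate v W (\<lambda>i. emb (V (fst i) (snd i) \<omega>)))) b' w') \<partial>M) =
      (\<integral>\<omega>. Tr (wv (lett (\<lambda>i. emb (V (fst i) (snd i) \<omega>))) b w) *
        Tr (wv (lett (\<lambda>i. emb (V (fst i) (snd i) \<omega>))) b' w') \<partial>M)" .
  qed
qed

section \<open>The limit algebra\<close>

instance mat_index :: countable
  by countable_datatype

lemma mat_alg_simps: "mult (mat_alg n) = (*)" "one (mat_alg n) = 1\<^sub>m n" "star (mat_alg n) = mat_adjoint"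
  by (simp_all add: mat_alg_def)

lemma word_val_carrier:
  assumes "\<And>i. i \<in> fst ` set w \<Longrightarrow> a i \<in> carrier_mat n n" "n = (\<Sum>l=1..d. q l)"
  shows "word_val (mat_alg n) (D_mat d q) a w \<in> carrier_mat n n"
  using assms(1)
proof (induction w)
  case (Cons x w)
  obtain i adj c where x: "x = (i, adj, c)" by (cases x)
  have a: "a i \<in> carrier_mat n n" and w: "word_val (mat_alg n) (D_mat d q) a w \<in> carrier_mat n n"
    using Cons x by auto
  have D: "D_mat d q c \<in> carrier_mat n n" unfolding assms(2) by (rule D_mat_carrier)
  have "(if adj then mat_adjoint (a i) else a i) \<in> carrier_mat n n"
    using a by (simp add: mat_adjoint_carrier)
  from mult_carrier_mat[OF mult_carrier_mat[OF this D] w] show ?case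
    by (simp only: x word_val.simps mat_alg_simps)
qed (simp add: mat_alg_simps)

lemma emb_word_val_Cons:
  assumes "\<And>i'. i' \<in> fst ` set ((i, adj, c) # w) \<Longrightarrow> a i' \<in> carrier_mat n n" "n = (\<Sum>l=1..d. q l)"
  shows "emb (word_val (mat_alg n) (D_mat d q) a ((i, adj, c) # w)) =
    (if adj then star_fmat (emb (a i)) else emb (a i)) * emb (D_mat d q c) * emb (word_val (mat_alg n) (D_mat d q) a w)"
proof -
  have a: "a i \<in> carrier_mat n n" using assms by simp
  have w: "word_val (mat_alg n) (D_mat d q) a w \<in> carrier_mat n n"
    using assms by (intro word_val_carrier) auto
  have D: "D_mat d q c \<in> carrier_mat n n" unfolding assms(2) by (rule D_mat_carrier)
  let ?x = "if adj then mat_adjoint (a i) else a i"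
  have x: "?x \<in> carrier_mat n n" using a by (simp add: mat_adjoint_carrier)
  have "emb (?x * D_mat d q c * word_val (mat_alg n) (D_mat d q) a w) =
     emb ?x * emb (D_mat d q c) * emb (word_val (mat_alg n) (D_mat d q) a w)"
    by (simp only: emb_mult[OF mult_carrier_mat[OF x D] w] emb_mult[OF x D])
  moreover have "emb ?x = (if adj then star_fmat (emb (a i)) else emb (a i))"
    using a by (simp add: emb_adjoint)
  ultimately show ?thesis by (simp only: word_val.simps mat_alg_simps)
qed

lemma emb_one_mat_alg: "emb (one (mat_alg n)) = dproj {..<n}"
  by (simp add: mat_alg_simps emb_one)

lemma E_mat_emb:
  assumes "n = (\<Sum>l=1..d. q l)" "k \<in> {1..d}" "\<And>\<omega>. \<omega> \<in> space M \<Longrightarrow> X \<omega> \<in> carrier_mat n n"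
  shows "E_mat M d q X k = (\<integral>\<omega>. Tr (dproj (block d q k) * emb (X \<omega>)) \<partial>M) / of_nat (q k)"
proof -
  have p: "block_proj d q k \<in> carrier_mat n n" unfolding assms(1) by (rule block_proj_carrier)
  note E = emb_block_proj[OF assms(2)]
  have "mat_trace (block_proj d q k * X \<omega> * block_proj d q k) = Tr (dproj (block d q k) * emb (X \<omega>))"
    if "\<omega> \<in> space M" for \<omega>
  proof -
    note x = assms(3)[OF that]
    have "mat_trace (block_proj d q k * X \<omega> * block_proj d q k)
        = Tr (dproj (block d q k) * emb (X \<omega>) * dproj (block d q k))"
      by (simp only: mat_trace_emb[OF mult_carrier_mat[OF mult_carrier_mat[OF p x] p]]
          emb_mult[OF mult_carrier_mat[OF p x] p] emb_mult[OF p x] E)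
    also have "\<dots> = Tr (dproj (block d q k) * emb (X \<omega>))"
      using Tr_commute[of "dproj (block d q k) * emb (X \<omega>)" "dproj (block d q k)"]
      by (simp add: mult.assoc[symmetric] dproj_dproj)
    finally show ?thesis .
  qed
  then show ?thesis by (simp add: E_mat_def cong: Bochner_Integration.integral_cong)
qed

locale haar_and_constant_matrices =
  fixes A :: "'a star_algebra" and \<phi> :: "'a \<Rightarrow> complex" and d :: nat and p :: "nat \<Rightarrow> 'a"
    and q :: "nat \<Rightarrow> nat \<Rightarrow> nat" and \<Omega> :: "nat \<Rightarrow> 'w measure"
    and V :: "nat \<Rightarrow> nat \<Rightarrow> nat \<Rightarrow> 'w \<Rightarrow> complex mat" and B :: "nat \<Rightarrow> nat \<Rightarrow> complex mat" and b_lim :: "nat \<Rightarrow> 'a"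
  assumes space: "tracial_ncps_over A \<phi> d p"
    and q_sum: "\<And>n. n \<ge> d \<Longrightarrow> (\<Sum>k=1..d. q n k) = n"
    and q_lim: "\<And>k. k \<in> {1..d} \<Longrightarrow> (\<lambda>n. of_nat (q n k) / of_nat n) \<longlonglongrightarrow> \<phi> (p k)"
    and prob: "\<And>n. n \<ge> d \<Longrightarrow> prob_space (\<Omega> n)"
    and V_indep: "\<And>n. n \<ge> d \<Longrightarrow>
          prob_space.indep_vars (\<Omega> n) (\<lambda>_. mat_borel n) (\<lambda>(s, k). V s k n) (UNIV \<times> {1..d})"
    and V_uniform: "\<And>n s k. n \<ge> d \<Longrightarrow> k \<in> {1..d} \<Longrightarrow>
          uniform_on (\<Omega> n) n (block_unitary d (q n) n k) (V s k n)"
    and B_dim: "\<And>n j. n \<ge> d \<Longrightarrow> B j n \<in> carrier_mat n n"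
    and B_conv: "converges_in_D_distribution d q \<Omega> UNIV (\<lambda>j n _. B j n) A \<phi> p b_lim"
begin

text \<open>For d = 0 the empty sum of projections would be the unit, contradicting that \<phi>
  takes the value 1 there.\<close>

lemma d_pos: "d > 0"
proof (rule ccontr)
  assume "\<not> d > 0"
  then have d: "d = 0" by simp
  interpret tracial_ncps_over A \<phi> d p by (rule space)
  have "\<zero>\<^bsub>A\<^esub> = \<one>\<^bsub>A\<^esub>" using proj_sum d by simp
  moreover have "0 \<odot>\<^bsub>A\<^esub> \<one>\<^bsub>A\<^esub> = \<zero>\<^bsub>A\<^esub>"
    using smult_l_null[of "\<one>\<^bsub>A\<^esub>"] by simp
  ultimately have "\<phi> \<one>\<^bsub>A\<^esub> = 0 * \<phi> \<one>\<^bsub>A\<^esub>"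
    using state_smult[of "\<one>\<^bsub>A\<^esub>" 0] by simp
  then show False using state_one by simp
qed

lemma \<phi>_nonzero: "k \<in> {1..d} \<Longrightarrow> \<phi> (p k) \<noteq> 0"
  using tracial_ncps_over.state_proj[OF space] .

text \<open>Nothing is known about the block sizes \<open>q n\<close> for \<open>n < d\<close>, so they are replaced there.\<close>

definition q' :: "nat \<Rightarrow> nat \<Rightarrow> nat" where
  "q' n = (if n \<ge> d then q n else (\<lambda>k. if k = 1 then n else 0))"

lemma q'_eq: "n \<ge> d \<Longrightarrow> q' n = q n"
  by (simp add: q'_def)

lemma q'_sum: "(\<Sum>k=1..d. q' n k) = n"
proof (cases "n \<ge> d")
  case False
  have "(\<Sum>k=1..d. if k = 1 then n else 0) = n" using d_pos by (subst sum.delta) auto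
  then show ?thesis using False by (simp add: q'_def)
qed (simp add: q'_def q_sum[unfolded One_nat_def])

definition P :: "nat \<Rightarrow> nat \<Rightarrow> fmat" where
  "P k n = dproj (block d (q' n) k)"

lemma P_mult: "P k n * P l n = (if k = l then P k n else 0)"
  by (simp add: P_def dproj_dproj block_disjoint) (simp add: dproj_def)

lemma P_star [simp]: "star_fmat (P k n) = P k n"
  by (simp add: P_def star_dproj)

lemma P_dim: "dimb n (P k n)"
  unfolding P_def by (rule dimb_dproj) (use block_subset[of d "q' n" k] q'_sum in auto)

lemma P_sum: "(\<Sum>k=1..d. P k n) = dproj {..<n}"
  using sum_dproj_block[of d "q' n"] by (simp only: P_def q'_sum)

lemma Tr_P: "k \<in> {1..d} \<Longrightarrow> Tr (P k n) = of_nat (q' n k)"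
  by (simp add: P_def Tr_dproj card_block)

lemma ratio_P:
  assumes "k \<in> {1..d}" shows "(\<lambda>n. Tr (P k n) / of_nat n) \<longlonglongrightarrow> \<phi> (p k)"
proof (rule Lim_transform_eventually[OF q_lim[OF assms]])
  show "\<forall>\<^sub>F n in sequentially. of_nat (q n k) / of_nat n = Tr (P k n) / of_nat n"
    using eventually_ge_at_top[of d] by eventually_elim (simp add: Tr_P[OF assms] q'_eq)
qed

text \<open>\<open>Inl k\<close> encodes $p_k(n)$, and \<open>Inr (i, adj)\<close> the matrix with index \<open>i\<close> or its adjoint.\<close>

type_synonym gen = "nat + mat_index \<times> bool"

definition const_gen :: "gen \<Rightarrow> bool" where
  "const_gen g = (case g of Inl k \<Rightarrow> k \<in> {1..d} | Inr (B_index j, _) \<Rightarrow> True | Inr (V_index s k, _) \<Rightarrow> False)"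

definition valid_gen :: "gen \<Rightarrow> bool" where
  "valid_gen g = (case g of Inl k \<Rightarrow> k \<in> {1..d} | Inr (B_index j, _) \<Rightarrow> True | Inr (V_index s k, _) \<Rightarrow> k \<in> {1..d})"

fun flip_gen :: "gen \<Rightarrow> gen" where
  "flip_gen (Inl k) = Inl k"
| "flip_gen (Inr (i, adj)) = Inr (i, \<not> adj)"

text \<open>The value 0 at the unitaries is a placeholder; \<open>const_gen\<close> excludes
  them.\<close>

definition cval :: "gen \<Rightarrow> nat \<Rightarrow> fmat" where
  "cval g n = (case g of Inl k \<Rightarrow> P k n
     | Inr (i, adj) \<Rightarrow> (case i of B_index j \<Rightarrow> if adj then star_fmat (emb (B j n)) else emb (B j n) | V_index s k \<Rightarrow> 0))"

definition gval :: "gen \<Rightarrow> nat \<Rightarrow> 'w \<Rightarrow> fmat" where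
  "gval g n \<omega> = (case g of Inl k \<Rightarrow> P k n
     | Inr (i, adj) \<Rightarrow> if adj then star_fmat (emb (joint_family B V i n \<omega>)) else emb (joint_family B V i n \<omega>))"

lemma gval_const: "const_gen g \<Longrightarrow> gval g = (\<lambda>n \<omega>. cval g n)"
  by (auto simp: gval_def cval_def const_gen_def joint_family_def fun_eq_iff split: sum.splits mat_index.splits)

lemma flip_gen_valid: "valid_gen g \<Longrightarrow> valid_gen (flip_gen g)"
  and flip_gen_const: "const_gen g \<Longrightarrow> const_gen (flip_gen g)"
  by (cases g rule: flip_gen.cases; auto simp: valid_gen_def const_gen_def split: mat_index.splits)+

lemma flip_gen_gval: "star_fmat (gval g n \<omega>) = gval (flip_gen g) n \<omega>"
  by (cases g rule: flip_gen.cases) (auto simp: gval_def)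

lemma flip_gen_cval: "const_gen g \<Longrightarrow> star_fmat (cval g n) = cval (flip_gen g) n"
  by (cases g rule: flip_gen.cases) (auto simp: cval_def const_gen_def split: mat_index.splits)

lemma cval_dim: "const_gen g \<Longrightarrow> n \<ge> d \<Longrightarrow> dimb n (cval g n)"
  by (auto simp: cval_def const_gen_def P_dim dimb_emb B_dim split: sum.splits mat_index.splits)

subsection \<open>The deterministic algebra\<close>

definition stc :: "(nat \<Rightarrow> fmat) \<Rightarrow> nat \<Rightarrow> fmat" where "stc x = (\<lambda>n. star_fmat (x n))"
definition sclc :: "complex \<Rightarrow> (nat \<Rightarrow> fmat) \<Rightarrow> nat \<Rightarrow> fmat" where "sclc c x = (\<lambda>n. sc c (x n))"

sublocale C: star_ops stc sclc
  by unfold_locales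
     (auto simp: stc_def sclc_def fun_eq_iff sc_add_right sc_add_left sc_sc sc_mult_left sc_mult_right
        star_add_fmat star_sc star_mult_fmat)

definition Wc :: "(nat \<Rightarrow> fmat) set" where
  "Wc = {nprod (map cval gs) | gs. gs \<noteq> [] \<and> (\<forall>g\<in>set gs. const_gen g)}"

text \<open>Linear combinations of words in the projections, the constant matrices and their
  adjoints. Words of sequences are formed because the index l with B(i,n) B(j,n) = B(l,n) may vary
  with n, so that a product of two sequences need not be one of the given sequences.\<close>

definition Dt :: "(nat \<Rightarrow> fmat) set" where "Dt = C.lin Wc"

lemma Wc_gen: "const_gen g \<Longrightarrow> cval g \<in> Wc"
  unfolding Wc_def by (auto intro!: exI[of _ "[g]"])

lemma Wc_mult: "a \<in> Wc \<Longrightarrow> c \<in> Wc \<Longrightarrow> a * c \<in> Wc"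
proof -
  assume "a \<in> Wc" "c \<in> Wc"
  then obtain gs hs where "gs \<noteq> []" "\<forall>g\<in>set gs. const_gen g" "a = nprod (map cval gs)"
    "hs \<noteq> []" "\<forall>g\<in>set hs. const_gen g" "c = nprod (map cval hs)"
    by (auto simp: Wc_def)
  then show ?thesis unfolding Wc_def by (auto intro!: exI[of _ "gs @ hs"] simp: nprod_append)
qed

lemma Wc_star: "a \<in> Wc \<Longrightarrow> stc a \<in> Wc"
proof -
  assume "a \<in> Wc"
  then obtain gs where gs: "gs \<noteq> []" "\<forall>g\<in>set gs. const_gen g" "a = nprod (map cval gs)"
    by (auto simp: Wc_def)
  have "map stc (map cval gs) = map cval (map flip_gen gs)"
    using gs(2) by (auto simp: stc_def flip_gen_cval)
  then have "stc a = nprod (map cval (rev (map flip_gen gs)))"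
    using C.st_nprod[of "map cval gs"] gs(1,3) by (simp only: rev_map) simp
  then show ?thesis using gs unfolding Wc_def
    by (auto intro!: exI[of _ "rev (map flip_gen gs)"] simp: flip_gen_const)
qed

lemma Wc_dim: "a \<in> Wc \<Longrightarrow> n \<ge> d \<Longrightarrow> dimb n (a n)"
proof -
  assume "a \<in> Wc" "n \<ge> d"
  then obtain gs where gs: "gs \<noteq> []" "\<forall>g\<in>set gs. const_gen g" "a = nprod (map cval gs)"
    by (auto simp: Wc_def)
  have "dimb n (nprod (map cval gs) n)"
    using gs(1,2)
  proof (induction gs)
    case (Cons g gs)
    then show ?case
      using cval_dim[of g n] \<open>n \<ge> d\<close> by (cases "gs = []") (auto simp: nprod_Cons)
  qed simp
  then show ?thesis by (simp add: gs)
qed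

definition Dm :: "(nat \<Rightarrow> complex) \<Rightarrow> nat \<Rightarrow> fmat" where
  "Dm c n = (\<Sum>k=1..d. sc (c k) (P k n))"

lemma Dm_emb: "n \<ge> d \<Longrightarrow> emb (D_mat d (q n) c) = Dm c n"
  by (simp add: emb_D_mat Dm_def P_def q'_eq)

lemma P_Dm: 
  assumes "k \<in> {1..d}" shows "P k n * Dm c n = sc (c k) (P k n)" "Dm c n * P k n = sc (c k) (P k n)"
proof -
  have "(\<Sum>l=1..d. P k n * sc (c l) (P l n)) = (\<Sum>l=1..d. if l = k then sc (c l) (P l n) else 0)"
    by (rule sum.cong) (auto simp: sc_mult_right P_mult)
  then show "P k n * Dm c n = sc (c k) (P k n)" using assms by (simp add: Dm_def sum_distrib_left)
  have "(\<Sum>l=1..d. sc (c l) (P l n) * P k n) = (\<Sum>l=1..d. if l = k then sc (c l) (P l n) else 0)"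
    by (rule sum.cong) (auto simp: sc_mult_left P_mult)
  then show "Dm c n * P k n = sc (c k) (P k n)" using assms by (simp add: Dm_def sum_distrib_right)
qed

lemma Dm_one: "Dm (\<lambda>_. 1) n = dproj {..<n}"
  using P_sum[of n] by (simp add: Dm_def)

text \<open>A product of constant generators is, up to an element of $\mathcal D$ in front, a word to which
  the convergence assumption applies.\<close>

abbreviation "Bword w n \<equiv> emb (word_val (mat_alg n) (D_mat d (q n)) (\<lambda>j. B j n) w)"

lemma Bword_dim: "n \<ge> d \<Longrightarrow> dimb n (Bword w n)"
  by (intro dimb_emb word_val_carrier, erule B_dim, rule q_sum[symmetric])

lemma const_word_eq:
  "gs \<noteq> [] \<Longrightarrow> \<forall>g\<in>set gs. const_gen g \<Longrightarrow> \<exists>c w. \<forall>n\<ge>d. nprod (map cval gs) n = Dm c n * Bword w n"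
proof (induction gs)
  case (Cons g gs)
  have "\<exists>c w. \<forall>n\<ge>d. (if gs = [] then dproj {..<n} else nprod (map cval gs) n) = Dm c n * Bword w n"
  proof (cases "gs = []")
    case True
    have "dproj {..<n} = Dm (\<lambda>_. 1) n * Bword [] n" if "n \<ge> d" for n
      by (simp add: Dm_one emb_one_mat_alg dproj_dproj)
    then show ?thesis using True by metis
  qed (use Cons in auto)
  then obtain c w where cw: "\<And>n. n \<ge> d \<Longrightarrow> (if gs = [] then dproj {..<n} else nprod (map cval gs) n) = Dm c n * Bword w n"
    by blast
  have eq: "nprod (map cval (g # gs)) n = cval g n * (Dm c n * Bword w n)" if n: "n \<ge> d" for n
    using cval_dim[of g n] Cons.prems n
    by (cases "gs = []") (auto simp: nprod_Cons dproj_mult_id cw[OF n, symmetric])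
  show ?case
  proof (cases g)
    case (Inl k)
    then have k: "k \<in> {1..d}" using Cons.prems by (simp add: const_gen_def)
    have "nprod (map cval (g # gs)) n = Dm (\<lambda>l. if l = k then c k else 0) n * Bword w n" if n: "n \<ge> d" for n
    proof -
      have "Dm (\<lambda>l. if l = k then c k else 0) n = (\<Sum>l=1..d. if l = k then sc (c k) (P k n) else 0)"
        unfolding Dm_def by (rule sum.cong) auto
      then have "P k n * Dm c n = Dm (\<lambda>l. if l = k then c k else 0) n"
        using k by (simp add: P_Dm)
      then show ?thesis using eq[OF n] Inl by (simp add: cval_def mult.assoc[symmetric])
    qed
    then show ?thesis by blast
  next
    case (Inr x)
    obtain i adj where x: "x = (i, adj)" by (cases x)
    obtain j where j: "i = B_index j"
      using Cons.prems Inr x by (cases i) (auto simp: const_gen_def)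
    have "nprod (map cval (g # gs)) n = Dm (\<lambda>_. 1) n * Bword ((j, adj, c) # w) n" if n: "n \<ge> d" for n
    proof -
      have "Bword ((j, adj, c) # w) n = cval g n * Dm c n * Bword w n"
        by (subst emb_word_val_Cons) (simp_all add: n B_dim q_sum[unfolded One_nat_def] Dm_emb cval_def Inr x j)
      then show ?thesis
        using eq[OF n] Bword_dim[OF n, of "(j, adj, c) # w"]
        by (simp add: Dm_one dproj_mult_id mult.assoc)
    qed
    then show ?thesis by blast
  qed
qed simp

text \<open>Coordinates of E are traces divided by the block size; multiplication by the ratio of
  block size to n turns them into normalized traces. The empty word lies outside the convergence
  hypothesis and is settled by the ratios.\<close>

lemma Bword_convergent:
  assumes "k \<in> {1..d}" shows "convergent (\<lambda>n. Tr (P k n * Bword w n) / of_nat n)"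
proof (cases "w = []")
  case True
  have "(\<lambda>n. Tr (P k n * Bword w n) / of_nat n) = (\<lambda>n. Tr (P k n) / of_nat n)"
    by (simp add: True emb_one_mat_alg dproj_mult_id P_dim)
  then show ?thesis using ratio_P[OF assms] by (auto simp: convergent_def)
next
  case False
  let ?E = "\<lambda>n. E_mat (\<Omega> n) d (q n) (\<lambda>\<omega>. word_val (mat_alg n) (D_mat d (q n)) (\<lambda>i. B i n) w) k"
  obtain l where "?E \<longlonglongrightarrow> l"
    using B_conv False assms unfolding converges_in_D_distribution_def by blast
  then have "(\<lambda>n. ?E n * (Tr (P k n) / of_nat n)) \<longlonglongrightarrow> l * \<phi> (p k)"
    by (intro tendsto_mult ratio_P assms)
  moreover have "\<forall>\<^sub>F n in sequentially. ?E n * (Tr (P k n) / of_nat n) = Tr (P k n * Bword w n) / of_nat n"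
    using eventually_ge_at_top[of d] tendsto_imp_eventually_ne[OF ratio_P[OF assms] \<phi>_nonzero[OF assms]]
  proof eventually_elim
    case (elim n)
    interpret prob_space "\<Omega> n" by (rule prob[OF elim(1)])
    have "?E n = (\<integral>\<omega>. Tr (P k n * Bword w n) \<partial>\<Omega> n) / of_nat (q n k)"
      using E_mat_emb[where d = d and q = "q n" and M = "\<Omega> n" and
          X = "\<lambda>_. word_val (mat_alg n) (D_mat d (q n)) (\<lambda>i. B i n) w"]
      using word_val_carrier[where w = w and a = "\<lambda>j. B j n" and d = d and q = "q n"]
      using elim(1) q_sum[OF elim(1)] assms by (simp add: B_dim P_def q'_eq)
    then show ?case using elim assms by (simp add: prob_space Tr_P q'_eq)
  qed
  ultimately have "(\<lambda>n. Tr (P k n * Bword w n) / of_nat n) \<longlonglongrightarrow> l * \<phi> (p k)"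
    by (rule Lim_transform_eventually)
  then show ?thesis by (auto simp: convergent_def)
qed

lemma Wc_convergent: assumes "a \<in> Wc" shows "convergent (\<lambda>n. Tr (a n) / of_nat n)"
proof -
  obtain c w where eq: "\<And>n. n \<ge> d \<Longrightarrow> a n = Dm c n * Bword w n"
    using assms const_word_eq unfolding Wc_def by blast
  have "convergent (\<lambda>n. \<Sum>k=1..d. c k * (Tr (P k n * Bword w n) / of_nat n))"
    by (intro convergent_sum convergent_mult convergent_const Bword_convergent) auto
  then obtain l where l: "(\<lambda>n. \<Sum>k=1..d. c k * (Tr (P k n * Bword w n) / of_nat n)) \<longlonglongrightarrow> l"
    by (auto simp: convergent_def)
  have "(\<lambda>n. Tr (a n) / of_nat n) \<longlonglongrightarrow> l"
  proof (rule Lim_transform_eventually[OF l])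
    show "\<forall>\<^sub>F n in sequentially. (\<Sum>k=1..d. c k * (Tr (P k n * Bword w n) / of_nat n)) = Tr (a n) / of_nat n"
      using eventually_ge_at_top[of d]
      by eventually_elim
         (simp add: eq Dm_def sum_distrib_right Tr_sum sc_mult_left Tr_sc sum_divide_distrib)
  qed
  then show ?thesis by (auto simp: convergent_def)
qed

abbreviation "I \<equiv> UNIV \<times> {1..d} :: (nat \<times> nat) set"
abbreviation "blk n i \<equiv> block d (q' n) (snd i)"
abbreviation "U i n \<omega> \<equiv> emb (V (fst i) (snd i) n \<omega>)"

sublocale haar_sequence \<Omega> d I blk U "\<lambda>i. \<phi> (p (snd i))" Dt
proof (intro haar_sequence.intro prob_sequence.intro haar_sequence_axioms.intro)
  show "d > 0" by (rule d_pos)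
  show "prob_space (\<Omega> n)" if "n \<ge> d" for n by (rule prob[OF that])
  show "haar_family (\<Omega> n) n I (blk n) (\<lambda>i. U i n)" if n: "n \<ge> d" for n
    using haar_family_blocks[OF prob[OF n] q_sum[OF n, symmetric] V_indep[OF n] V_uniform[OF n]]
    by (simp add: q'_eq[OF n])
  fix x y :: "nat \<Rightarrow> fmat" and c :: complex
  assume x: "x \<in> Dt"
  show "dimb n (x n)" if "n \<ge> d" for n
    using x that unfolding Dt_def by (induction x rule: C.lin.induct) (auto simp: sclc_def Wc_dim)
  show "(\<lambda>n. sc c (x n)) \<in> Dt" using C.lin_scl x by (simp add: Dt_def sclc_def)
  show "(\<lambda>n. star_fmat (x n)) \<in> Dt" using C.lin_st[OF _ Wc_star] x by (simp add: Dt_def stc_def)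
  show "convergent (\<lambda>n. Tr (x n) / of_nat n)"
    using x unfolding Dt_def
  proof (induction x rule: C.lin.induct)
    case (lin_step a x c)
    have "convergent (\<lambda>n. c * (Tr (a n) / of_nat n) + Tr (x n) / of_nat n)"
      by (intro convergent_add convergent_mult convergent_const Wc_convergent lin_step)
    then show ?case by (simp add: sclc_def Tr_add Tr_sc add_divide_distrib)
  qed (simp add: convergent_const)
  assume y: "y \<in> Dt"
  show "(\<lambda>n. x n * y n) \<in> Dt"
    using C.lin_mult[OF Wc_mult x[unfolded Dt_def] y[unfolded Dt_def]] by (simp add: Dt_def times_fun_def)
  show "(\<lambda>n. x n + y n) \<in> Dt" using C.lin_add x y by (simp add: Dt_def plus_fun_def)
next
  fix i :: "nat \<times> nat" assume i: "i \<in> I"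
  show "(\<lambda>n. of_nat (card (blk n i)) / of_nat n) \<longlonglongrightarrow> \<phi> (p (snd i))"
    using ratio_P[of "snd i"] i by (auto simp: P_def Tr_dproj)
  show "\<phi> (p (snd i)) \<noteq> 0" using i \<phi>_nonzero by auto
  have "cval (Inl (snd i)) \<in> Wc" using i by (intro Wc_gen) (auto simp: const_gen_def)
  then show "(\<lambda>n. dproj (blk n i)) \<in> Dt"
    using C.lin_base[of "cval (Inl (snd i))" Wc] by (simp add: Dt_def cval_def[abs_def] P_def)
next
  have "(\<Sum>k\<in>S. cval (Inl k)) \<in> C.lin Wc" if "S \<subseteq> {1..d}" for S
    using finite_subset[OF that finite_atLeastAtMost] that
  proof (induction S rule: finite_induct)
    case empty
    show ?case unfolding sum.empty by (rule C.lin_zero)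
  next
    case (insert k S)
    have "cval (Inl k) \<in> C.lin Wc" using insert by (intro C.lin_base Wc_gen) (auto simp: const_gen_def)
    moreover have "(\<Sum>k\<in>S. cval (Inl k)) \<in> C.lin Wc" using insert by auto
    ultimately show ?case unfolding sum.insert[OF insert.hyps] by (rule C.lin_add)
  qed
  moreover have "(\<Sum>k\<in>{1..d}. cval (Inl k)) = (\<lambda>n. dproj {..<n})"
  proof -
    have "(\<Sum>k\<in>S. cval (Inl k)) n = (\<Sum>k\<in>S. P k n)" for S n
      by (induction S rule: infinite_finite_induct) (auto simp: cval_def)
    then show ?thesis using P_sum by (simp add: fun_eq_iff)
  qed
  ultimately show "(\<lambda>n. dproj {..<n}) \<in> Dt" by (simp add: Dt_def) (metis order_refl)
qed

end

context haar_and_constant_matrices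
begin

subsection \<open>The algebra of random matrices\<close>

definition str :: "(nat \<Rightarrow> 'w \<Rightarrow> fmat) \<Rightarrow> nat \<Rightarrow> 'w \<Rightarrow> fmat" where "str x = (\<lambda>n \<omega>. star_fmat (x n \<omega>))"
definition sclr :: "complex \<Rightarrow> (nat \<Rightarrow> 'w \<Rightarrow> fmat) \<Rightarrow> nat \<Rightarrow> 'w \<Rightarrow> fmat" where "sclr c x = (\<lambda>n \<omega>. sc c (x n \<omega>))"

sublocale R: star_ops str sclr
  by unfold_locales
     (auto simp: str_def sclr_def fun_eq_iff sc_add_right sc_add_left sc_sc sc_mult_left sc_mult_right
        star_add_fmat star_sc star_mult_fmat)

definition W :: "(nat \<Rightarrow> 'w \<Rightarrow> fmat) set" where
  "W = {nprod (map gval gs) | gs. gs \<noteq> [] \<and> (\<forall>g\<in>set gs. valid_gen g)}"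

definition X :: "(nat \<Rightarrow> 'w \<Rightarrow> fmat) set" where "X = R.lin W"

lemma W_gen: "valid_gen g \<Longrightarrow> gval g \<in> W"
  unfolding W_def by (auto intro!: exI[of _ "[g]"])

lemma W_mult: assumes "a \<in> W" "c \<in> W" shows "a * c \<in> W"
proof -
  obtain gs hs where g: "gs \<noteq> []" "\<forall>g\<in>set gs. valid_gen g" "a = nprod (map gval gs)"
    "hs \<noteq> []" "\<forall>g\<in>set hs. valid_gen g" "c = nprod (map gval hs)"
    using assms unfolding W_def by blast
  then have "a * c = nprod (map gval (gs @ hs))" by (simp only: map_append) (subst nprod_append, auto)
  then show ?thesis using g unfolding W_def by (auto intro!: exI[of _ "gs @ hs"])
qed

lemma W_star: assumes "a \<in> W" shows "str a \<in> W"
proof -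
  obtain gs where gs: "gs \<noteq> []" "\<forall>g\<in>set gs. valid_gen g" "a = nprod (map gval gs)"
    using assms unfolding W_def by blast
  have eq: "map str (map gval gs) = map gval (map flip_gen gs)"
    by (auto simp: str_def flip_gen_gval fun_eq_iff)
  have "str a = nprod (rev (map str (map gval gs)))"
    unfolding gs(3) by (rule R.st_nprod) (use gs in simp)
  also have "\<dots> = nprod (map gval (rev (map flip_gen gs)))" by (simp only: eq rev_map)
  finally show ?thesis using gs unfolding W_def
    by (auto intro!: exI[of _ "rev (map flip_gen gs)"] simp: flip_gen_valid)
qed

lemma X_W: "a \<in> W \<Longrightarrow> a \<in> X"
  unfolding X_def by (rule R.lin_base)

lemmas X_gen = X_W[OF W_gen]

lemma X_zero: "0 \<in> X" and X_add: "x \<in> X \<Longrightarrow> y \<in> X \<Longrightarrow> x + y \<in> X"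
  and X_scl: "x \<in> X \<Longrightarrow> sclr c x \<in> X" and X_mult: "x \<in> X \<Longrightarrow> y \<in> X \<Longrightarrow> x * y \<in> X"
  and X_st: "x \<in> X \<Longrightarrow> str x \<in> X"
  unfolding X_def
  by (rule R.lin_zero R.lin_add R.lin_scl R.lin_mult[OF W_mult] R.lin_st[OF _ W_star]; assumption)+

lemma cval_Dt: "const_gen g \<Longrightarrow> cval g \<in> Dt"
  unfolding Dt_def by (intro C.lin_base Wc_gen)

lemma gval_atoms: assumes "valid_gen g" shows "gval g \<in> atoms"
proof (cases "const_gen g")
  case True
  then show ?thesis using atoms_Dt[OF cval_Dt] by (simp add: gval_const)
next
  case False
  then obtain s k adj where g: "g = Inr (V_index s k, adj)" "k \<in> {1..d}"
    using assms by (auto simp: valid_gen_def const_gen_def split: sum.splits mat_index.splits)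
  have "gval g = (\<lambda>n \<omega>. LUs n \<omega> ((s, k), adj))"
    by (auto simp: g gval_def joint_family_def fun_eq_iff)
  then show ?thesis using atoms_letter[of "((s, k), adj)"] g by simp
qed

lemma nprod_apply: "xs \<noteq> [] \<Longrightarrow> nprod xs n \<omega> = nprod (map (\<lambda>x. x n \<omega>) xs)"
proof (induction xs)
  case (Cons x xs)
  then show ?case by (cases "xs = []") (auto simp: nprod_Cons)
qed simp

lemma W_products: assumes "a \<in> W" shows "a \<in> products"
proof -
  obtain gs where gs: "gs \<noteq> []" "\<forall>g\<in>set gs. valid_gen g" "a = nprod (map gval gs)"
    using assms unfolding W_def by blast
  have "a = (\<lambda>n \<omega>. nprod (map (\<lambda>x. x n \<omega>) (map gval gs)))"
    unfolding gs(3) using gs(1) by (intro ext nprod_apply) simp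
  moreover have "set (map gval gs) \<subseteq> atoms" using gs(2) gval_atoms by auto
  ultimately show ?thesis unfolding products_def using gs(1) by (intro CollectI exI[of _ "map gval gs"]) simp
qed

text \<open>An equality which \<tau> cannot distinguish from the strict one: it is required on
  events of full measure and for n \<ge> d. The unitary relations and the unit law of
  \<open>dproj {..<n}\<close> hold in this sense.\<close>

definition aeq :: "(nat \<Rightarrow> 'w \<Rightarrow> fmat) \<Rightarrow> (nat \<Rightarrow> 'w \<Rightarrow> fmat) \<Rightarrow> bool" where
  "aeq x y \<longleftrightarrow> (\<forall>n\<ge>d. \<forall>\<omega>\<in>good_event n. x n \<omega> = y n \<omega>)"

abbreviation "one_seq \<equiv> (\<lambda>n. dproj {..<n})"

lemma letter_one: "n \<ge> d \<Longrightarrow> \<omega> \<in> good_event n \<Longrightarrow> fst v \<in> I \<Longrightarrow> dproj {..<n} * LUs n \<omega> v = LUs n \<omega> v"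
  by (rule dproj_mult_id) (rule haar_family.goodD(1)[OF haar])

text \<open>Normal form of a product of generators: neighbouring constants are multiplied together,
  and the unit sequence fills the places without a constant.\<close>

lemma W_WV:
  assumes "a \<in> W" shows "\<exists>b\<in>Dt. \<exists>w. sword w \<and> aeq a (WV b w)"
proof -
  obtain gs where "gs \<noteq> []" "\<forall>g\<in>set gs. valid_gen g" and a: "a = nprod (map gval gs)"
    using assms unfolding W_def by blast
  then have "\<exists>b\<in>Dt. \<exists>w. sword w \<and> aeq (nprod (map gval gs)) (WV b w)"
  proof (induction gs arbitrary: a)
    case (Cons g gs)
    have "\<exists>b\<in>Dt. \<exists>w. sword w \<and> (\<forall>n\<ge>d. \<forall>\<omega>\<in>good_event n. nprod (map gval (g # gs)) n \<omega> = gval g n \<omega> * WV b w n \<omega>)"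
    proof (cases "gs = []")
      case True
      have "gval g n \<omega> = gval g n \<omega> * WV one_seq [] n \<omega>" if "n \<ge> d" "\<omega> \<in> good_event n" for n \<omega>
        using atoms_dim[OF gval_atoms that] Cons.prems by (simp add: dproj_mult_id)
      then show ?thesis using True Dt_one
        by (intro bexI[of _ one_seq] exI[of _ "[]"]) auto
    next
      case False
      then obtain b w where b: "b \<in> Dt" "sword w" "aeq (nprod (map gval gs)) (WV b w)"
        using Cons by auto
      then show ?thesis using False by (intro bexI[of _ b] exI[of _ w]) (auto simp: nprod_Cons aeq_def)
    qed
    then obtain b w where b: "b \<in> Dt" "sword w"
      and eq: "\<And>n \<omega>. n \<ge> d \<Longrightarrow> \<omega> \<in> good_event n \<Longrightarrow> nprod (map gval (g # gs)) n \<omega> = gval g n \<omega> * WV b w n \<omega>"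
      by blast
    show ?case
    proof (cases "const_gen g")
      case True
      have "gval g n \<omega> * WV b w n \<omega> = WV (\<lambda>n. cval g n * b n) w n \<omega>" for n \<omega>
        using WV_mult_left[of "cval g" b] True by (simp add: gval_const)
      then show ?thesis
        using eq b Dt_mult[OF cval_Dt[OF True] b(1)]
        by (intro bexI[of _ "\<lambda>n. cval g n * b n"] exI[of _ w]) (simp_all add: aeq_def)
    next
      case False
      then obtain s k adj where g: "g = Inr (V_index s k, adj)" "k \<in> {1..d}"
        using Cons.prems by (auto simp: valid_gen_def const_gen_def split: sum.splits mat_index.splits)
      have gv: "gval g n \<omega> = LUs n \<omega> ((s, k), adj)" for n \<omega>
        by (auto simp: g gval_def joint_family_def)
      have "gval g n \<omega> * WV b w n \<omega> = WV one_seq ((((s, k), adj), b) # w) n \<omega>" if "n \<ge> d" "\<omega> \<in> good_event n" for n \<omega>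
      proof -
        have lo: "dproj {..<n} * LUs n \<omega> ((s, k), adj) = LUs n \<omega> ((s, k), adj)"
          by (rule letter_one[OF that]) (use g in simp)
        show ?thesis by (simp only: gv WV_Cons lo)
      qed
      then show ?thesis
        using eq b g Dt_one
        by (intro bexI[of _ one_seq] exI[of _ "(((s, k), adj), b) # w"]) (simp_all add: aeq_def)
    qed
  qed simp
  then show ?thesis by (simp add: a)
qed

lemma W_converges: assumes "a \<in> W" shows "\<exists>c. converges_to (ntr a) c"
proof -
  obtain b w where b: "b \<in> Dt" "sword w" "aeq a (WV b w)" using W_WV[OF assms] by blast
  obtain c where "converges_to (ntr (WV b w)) c" using WV_converges[OF b(2,1)] by blast
  then have "converges_to (ntr a) c"
    by (rule converges_ntr_cong) (use b(3) W_products[OF assms] in \<open>auto simp: aeq_def\<close>)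
  then show ?thesis by blast
qed

lemma ntr_add: "ntr (x + y) = (\<lambda>n \<omega>. ntr x n \<omega> + ntr y n \<omega>)"
  and ntr_scl: "ntr (sclr c x) = (\<lambda>n \<omega>. c * ntr x n \<omega>)"
  and ntr_str: "ntr (str x) = (\<lambda>n \<omega>. cnj (ntr x n \<omega>))"
  and ntr_zero: "ntr 0 = (\<lambda>n \<omega>. 0)"
  and ntr_comm: "ntr (x * y) = ntr (y * x)"
  using Tr_commute
  by (auto simp: ntr_def fun_eq_iff Tr_add add_divide_distrib sclr_def Tr_sc str_def Tr_star)

lemma X_converges: "x \<in> X \<Longrightarrow> \<exists>c. converges_to (ntr x) c"
  unfolding X_def
proof (induction x rule: R.lin.induct)
  case lin_zero
  show ?case unfolding ntr_zero using converges_to_const[OF tendsto_const] by blast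
next
  case (lin_step a x c)
  then show ?case
    using W_converges converges_to_add converges_to_const_mult unfolding ntr_add ntr_scl by blast
qed

definition \<tau> :: "(nat \<Rightarrow> 'w \<Rightarrow> fmat) \<Rightarrow> complex" where
  "\<tau> x = (THE c. converges_to (ntr x) c)"

lemma \<tau>_eq: "converges_to (ntr x) c \<Longrightarrow> \<tau> x = c"
  unfolding \<tau>_def by (rule the_equality) (auto intro: converges_to_unique)

lemma \<tau>: "x \<in> X \<Longrightarrow> converges_to (ntr x) (\<tau> x)"
  using X_converges \<tau>_eq by metis

lemma \<tau>_aeq:
  assumes "x \<in> X" "y \<in> X" "aeq x y" shows "\<tau> x = \<tau> y"
proof -
  have "converges_to (ntr y) (\<tau> x)"
  proof (rule converges_to_cong[OF \<tau>[OF assms(1)]])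
    fix n assume n: "d \<le> n"
    interpret hf: haar_family "\<Omega> n" n I "blk n" "\<lambda>i. U i n" by (rule haar[OF n])
    show "ntr y n \<in> borel_measurable (\<Omega> n)"
      using converges_to_bdd[OF \<tau>[OF assms(2)]] n by (auto simp: bdd_def)
    show "AE \<omega> in \<Omega> n. ntr x n \<omega> = ntr y n \<omega>"
      using hf.AE_good by eventually_elim (use assms(3) n in \<open>simp add: ntr_def aeq_def\<close>)
  qed
  then show ?thesis using \<tau>_eq by simp
qed

lemma aeq_mult: "aeq x x' \<Longrightarrow> aeq y y' \<Longrightarrow> aeq (x * y) (x' * y')"
  and aeq_add: "aeq x x' \<Longrightarrow> aeq y y' \<Longrightarrow> aeq (x + y) (x' + y')"
  and aeq_scl: "aeq x x' \<Longrightarrow> aeq (sclr c x) (sclr c x')"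
  and aeq_refl: "aeq x x" and aeq_trans: "aeq x y \<Longrightarrow> aeq y z \<Longrightarrow> aeq x z"
  by (auto simp: aeq_def sclr_def)

lemma X_dim: "x \<in> X \<Longrightarrow> n \<ge> d \<Longrightarrow> \<omega> \<in> good_event n \<Longrightarrow> dimb n (x n \<omega>)"
  unfolding X_def
proof (induction x rule: R.lin.induct)
  case (lin_step a x c)
  obtain gs where gs: "gs \<noteq> []" "\<forall>g\<in>set gs. valid_gen g" "a = nprod (map gval gs)"
    using lin_step(1) unfolding W_def by blast
  have "dimb n (nprod (map gval gs) n \<omega>)"
    using gs(1,2)
  proof (induction gs)
    case (Cons g gs)
    then show ?case
      using atoms_dim[OF gval_atoms lin_step.prems] by (cases "gs = []") (auto simp: nprod_Cons)
  qed simp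
  then show ?case using lin_step by (simp add: gs(3) sclr_def)
qed simp

abbreviation "pr k \<equiv> gval (Inl k)"

lemma pr_apply: "pr k n \<omega> = P k n"
  by (simp add: gval_def)

lemma pr_sum: "(\<Sum>k=1..d. pr k) = (\<lambda>n \<omega>. dproj {..<n})"
proof -
  have "(\<Sum>k\<in>S. pr k) n \<omega> = (\<Sum>k\<in>S. P k n)" for S n \<omega>
    by (induction S rule: infinite_finite_induct) (auto simp: pr_apply)
  then show ?thesis using P_sum by (simp add: fun_eq_iff)
qed

lemma valid_pr: "k \<in> {1..d} \<Longrightarrow> valid_gen (Inl k)"
  by (simp add: valid_gen_def)

text \<open>Lists of generators are countable, so all words are enumerated; codes of inadmissible
  lists give 0. Vanishing of the pairings with words extends to \<open>X\<close> by linearity, as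
  the encoding of the quotient requires.\<close>

definition enum :: "nat \<Rightarrow> nat \<Rightarrow> 'w \<Rightarrow> fmat" where
  "enum m = (let gs = from_nat m in if gs \<noteq> [] \<and> (\<forall>g\<in>set gs. valid_gen g) then nprod (map gval gs) else 0)"

lemma enum_X: "enum m \<in> X"
  unfolding enum_def Let_def using X_zero X_W unfolding W_def by (auto split: if_splits)

lemma enum_W: assumes "a \<in> W" shows "\<exists>m. enum m = a"
proof -
  obtain gs where gs: "gs \<noteq> []" "\<forall>g\<in>set gs. valid_gen g" "a = nprod (map gval gs)"
    using assms unfolding W_def by blast
  then have "enum (to_nat gs) = a" by (simp add: enum_def)
  then show ?thesis by blast
qed

lemma \<tau>_add: "x \<in> X \<Longrightarrow> y \<in> X \<Longrightarrow> \<tau> (x + y) = \<tau> x + \<tau> y"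
  by (rule \<tau>_eq) (simp only: ntr_add, rule converges_to_add[OF \<tau> \<tau>])

lemma \<tau>_scl: "x \<in> X \<Longrightarrow> \<tau> (sclr c x) = c * \<tau> x"
  by (rule \<tau>_eq) (simp only: ntr_scl, rule converges_to_const_mult[OF \<tau>])

lemma \<tau>_zero: "\<tau> 0 = 0"
  using \<tau>_eq[of 0 0] converges_to_const[of "\<lambda>_. 0" 0] by (simp add: ntr_zero)

lemma \<tau>_pr: "k \<in> {1..d} \<Longrightarrow> \<tau> (pr k) = \<phi> (p k)"
  using converges_to_const[OF ratio_P, of k] by (intro \<tau>_eq) (simp add: ntr_def[abs_def] pr_apply)

text \<open>The normalized trace of x times its adjoint is a nonnegative real for every outcome;
  this survives integration and the limit.\<close>

lemma \<tau>_pos: assumes "x \<in> X" shows "\<tau> (str x * x) \<in> \<real> \<and> 0 \<le> Re (\<tau> (str x * x))"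
proof -
  define r where "r n \<omega> = Re (Tr (x n \<omega> * star_fmat (x n \<omega>))) / real n" for n \<omega>
  have eq: "ntr (x * str x) n \<omega> = of_real (r n \<omega>)" for n \<omega>
    using Tr_mult_star_nonneg(1)[of "x n \<omega>"] by (simp add: ntr_def str_def r_def)
  have "\<tau> (str x * x) = \<tau> (x * str x)" by (simp add: \<tau>_def ntr_comm[of x])
  moreover have "(\<lambda>n. \<integral>\<omega>. ntr (x * str x) n \<omega> \<partial>\<Omega> n) \<longlonglongrightarrow> \<tau> (x * str x)"
    using assms by (intro converges_to_integral \<tau> X_mult X_st)
  ultimately have lim: "(\<lambda>n. of_real (\<integral>\<omega>. r n \<omega> \<partial>\<Omega> n)) \<longlonglongrightarrow> \<tau> (str x * x)"
    by (simp add: eq)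
  have "0 \<le> r n \<omega>" for n \<omega> using Tr_mult_star_nonneg(2)[of "x n \<omega>"] by (simp add: r_def)
  then have nn: "0 \<le> (\<integral>\<omega>. r n \<omega> \<partial>\<Omega> n)" for n by simp
  have "Im (\<tau> (str x * x)) = 0"
    using LIMSEQ_unique[OF tendsto_Im[OF lim], of 0] by simp
  moreover have "0 \<le> Re (\<tau> (str x * x))"
    using tendsto_Re[OF lim] nn by (intro LIMSEQ_le_const[of _ _ 0]) auto
  ultimately show ?thesis by (simp add: complex_is_Real_iff)
qed

sublocale TQ: trace_quotient str sclr X \<tau> enum d pr
proof unfold_locales
  fix x y :: "nat \<Rightarrow> 'w \<Rightarrow> fmat" and c :: complex and k l :: nat
  show "0 \<in> X" by (rule X_zero)
  show "enum m \<in> X" for m by (rule enum_X)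
  show "\<tau> (\<Sum>k=1..d. pr k) = 1"
  proof (rule \<tau>_eq)
    have "(\<lambda>n. Tr (dproj {..<n}) / of_nat n :: complex) \<longlonglongrightarrow> 1"
      by (rule Lim_transform_eventually[OF tendsto_const])
         (use eventually_gt_at_top[of 0] in \<open>auto elim!: eventually_mono simp: Tr_dproj\<close>)
    from converges_to_const[OF this] show "converges_to (ntr (\<Sum>k=1..d. pr k)) 1"
      unfolding pr_sum ntr_def[abs_def] .
  qed
  show "pr k \<in> X" "str (pr k) = pr k" "\<tau> (pr k) \<noteq> 0" if k: "k \<in> {1..d}"
    using \<phi>_nonzero[OF k] \<tau>_pr[OF k] X_gen[OF valid_pr[OF k]]
    by (auto simp: str_def pr_apply fun_eq_iff)
  show "pr k * pr l = (if k = l then pr k else 0)"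
    by (auto simp: fun_eq_iff pr_apply P_mult)
  assume x: "x \<in> X"
  show "sclr c x \<in> X" "str x \<in> X" using x by (rule X_scl, rule X_st)
  show "\<tau> (sclr c x) = c * \<tau> x" by (rule \<tau>_scl[OF x])
  show "\<tau> (str x) = cnj (\<tau> x)"
    by (rule \<tau>_eq) (simp only: ntr_str, rule converges_to_cnj[OF \<tau>[OF x]])
  show "\<tau> (str x * x) \<in> \<real> \<and> 0 \<le> Re (\<tau> (str x * x))" by (rule \<tau>_pos[OF x])
  have prX: "(\<Sum>k=1..d. pr k) \<in> X"
  proof -
    have "(\<Sum>k\<in>S. pr k) \<in> X" if "S \<subseteq> {1..d}" for S
      using finite_subset[OF that finite_atLeastAtMost] that
    proof (induction S rule: finite_induct)
      case empty
      show ?case unfolding sum.empty by (rule X_zero)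
    next
      case (insert k S)
      then show ?case unfolding sum.insert[OF insert.hyps] by (intro X_add X_gen valid_pr) auto
    qed
    then show ?thesis by blast
  qed
  show "\<tau> ((\<Sum>k=1..d. pr k) * x) = \<tau> x"
    by (rule \<tau>_aeq[OF X_mult[OF prX x] x]) (use X_dim[OF x] in \<open>simp add: aeq_def pr_sum[unfolded One_nat_def] dproj_mult_id\<close>)
  show "\<tau> (z * x) = 0" if y: "\<And>m. \<tau> (enum m * x) = 0" and z: "z \<in> X" for z
    using z unfolding X_def
  proof (induction z rule: R.lin.induct)
    case lin_zero
    show ?case unfolding mult_zero_left by (rule \<tau>_zero)
  next
    case (lin_step a z c)
    obtain m where "enum m = a" using enum_W[OF lin_step(1)] by blast
    then have "\<tau> (a * x) = 0" using y by blast
    moreover have "a * x \<in> X" "z * x \<in> X"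
      using X_mult[OF _ x] X_W[OF lin_step(1)] lin_step(2) unfolding X_def[symmetric] by auto
    ultimately show ?case
      using lin_step(3) by (simp only: distrib_right R.scl_mult_left \<tau>_add \<tau>_scl X_scl) simp
  qed
  assume y: "y \<in> X"
  show "x + y \<in> X" "x * y \<in> X" using x y by (rule X_add, rule X_mult)
  show "\<tau> (x + y) = \<tau> x + \<tau> y" using x y by (rule \<tau>_add)
  show "\<tau> (x * y) = \<tau> (y * x)" by (simp only: \<tau>_def ntr_comm[of x])
qed

end

section \<open>Freeness\<close>

fun fpow :: "fmat \<Rightarrow> fmat \<Rightarrow> nat \<Rightarrow> fmat" where
  "fpow P L 0 = P"
| "fpow P L (Suc m) = L * fpow P L m"

lemma fpow_facts:
  assumes "P * P = P" "P * L = L" "L * P = L"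
  shows "P * fpow P L m = fpow P L m" "fpow P L m * P = fpow P L m"
    "fpow P L m * L = L * fpow P L m" "fpow P L m * fpow P L m' = fpow P L (m + m')"
proof -
  show l: "P * fpow P L m = fpow P L m" for m
    by (cases m) (simp_all add: assms mult.assoc[symmetric])
  show "fpow P L m * P = fpow P L m"
    by (induction m) (simp_all add: assms mult.assoc)
  show "fpow P L m * L = L * fpow P L m"
    by (induction m) (simp_all add: assms mult.assoc)
  show "fpow P L m * fpow P L m' = fpow P L (m + m')"
    by (induction m) (simp_all add: l mult.assoc)
qed

lemma fpow_cancel:
  assumes L: "P * P = P" "P * L = L" "L * P = L" "P * L' = L'" "L' * P = L'" and LL: "L * L' = P"
  shows "fpow P L m * fpow P L' m' = (if m' \<le> m then fpow P L (m - m') else fpow P L' (m' - m))"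
proof (induction m arbitrary: m')
  case 0
  then show ?case using fpow_facts(1)[OF L(1,4,5)] L(1) by auto
next
  case (Suc m)
  show ?case
  proof (cases m')
    case 0
    then show ?thesis using fpow_facts(2)[OF L(1-3), of "Suc m"] by simp
  next
    case (Suc k)
    have "fpow P L (Suc m) * fpow P L' (Suc k) = fpow P L m * (L * L') * fpow P L' k"
      using fpow_facts(3)[OF L(1-3), of m] by (simp add: mult.assoc[symmetric])
    also have "\<dots> = fpow P L m * fpow P L' k"
      using fpow_facts(1)[OF L(1,4,5)] by (simp add: LL mult.assoc)
    finally show ?thesis using Suc.IH[of k] Suc by simp
  qed
qed

lemma fpow_star:
  assumes "P * P = P" "P * star_fmat L = star_fmat L" "star_fmat L * P = star_fmat L" "star_fmat P = P"
  shows "star_fmat (fpow P L m) = fpow P (star_fmat L) m"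
  by (induction m) (simp_all add: star_mult_fmat fpow_facts[OF assms(1-3)] assms(4))

context haar_and_constant_matrices
begin

abbreviation "vg s k adj \<equiv> gval (Inr (V_index s k, adj))"

primrec vp :: "nat \<Rightarrow> nat \<Rightarrow> bool \<Rightarrow> nat \<Rightarrow> nat \<Rightarrow> 'w \<Rightarrow> fmat" where
  "vp s k adj 0 = pr k"
| "vp s k adj (Suc m) = vg s k adj * vp s k adj m"

lemma vg_apply: "vg s k adj n \<omega> = LUs n \<omega> ((s, k), adj)"
  by (auto simp: gval_def joint_family_def)

lemma vp_apply: "vp s k adj m n \<omega> = fpow (P k n) (LUs n \<omega> ((s, k), adj)) m"
  by (induction m) (simp_all add: pr_apply vg_apply del: lett.simps)

lemma good_letter:
  assumes "n \<ge> d" "\<omega> \<in> good_event n" "k \<in> {1..d}"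
  shows "P k n * LUs n \<omega> ((s, k), adj) = LUs n \<omega> ((s, k), adj)"
    "LUs n \<omega> ((s, k), adj) * P k n = LUs n \<omega> ((s, k), adj)"
    "LUs n \<omega> ((s, k), adj) * LUs n \<omega> ((s, k), \<not> adj) = P k n"
    "star_fmat (LUs n \<omega> ((s, k), adj)) = LUs n \<omega> ((s, k), \<not> adj)"
  using haar_family.goodD[OF haar[OF assms(1)] assms(2), of "((s, k), adj)"] assms(3)
    lett_flip[of "\<lambda>i. U i n \<omega>" "((s, k), adj)"]
  by (simp_all add: P_def del: lett.simps)

lemma valid_vg: "k \<in> {1..d} \<Longrightarrow> valid_gen (Inr (V_index s k, adj))"
  by (simp add: valid_gen_def)

lemma vp_X: "k \<in> {1..d} \<Longrightarrow> vp s k adj m \<in> X"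
  by (induction m) (auto intro!: X_mult X_gen valid_vg valid_pr simp del: One_nat_def)

lemma const_valid: "const_gen g \<Longrightarrow> valid_gen g"
  by (cases g) (auto simp: const_gen_def valid_gen_def split: mat_index.splits)

definition cst :: "(nat \<Rightarrow> fmat) \<Rightarrow> nat \<Rightarrow> 'w \<Rightarrow> fmat" where "cst x = (\<lambda>n \<omega>. x n)"

lemma cst_X: "x \<in> Dt \<Longrightarrow> cst x \<in> X"
  unfolding Dt_def
proof (induction x rule: C.lin.induct)
  case lin_zero
  have c0: "cst 0 = 0" by (auto simp: cst_def fun_eq_iff)
  show ?case unfolding c0 by (rule X_zero)
next
  case (lin_step a x c)
  obtain gs where gs: "gs \<noteq> []" "\<forall>g\<in>set gs. const_gen g" "a = nprod (map cval gs)"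
    using lin_step(1) unfolding Wc_def by blast
  have eq: "cst (nprod (map cval gs)) = nprod (map gval gs)"
    using gs(1,2)
  proof (induction gs)
    case (Cons g gs)
    then show ?case
      by (cases "gs = []") (auto simp: nprod_Cons cst_def gval_const fun_eq_iff)
  qed simp
  have "\<forall>g\<in>set gs. valid_gen g"
    using gs(2) const_valid by blast
  then have ca: "cst a \<in> X" unfolding gs(3) eq using gs(1) by (intro X_W) (auto simp: W_def)
  have sum: "cst (sclc c a + x) = sclr c (cst a) + cst x"
    by (auto simp: cst_def sclc_def sclr_def fun_eq_iff)
  show ?case unfolding sum by (intro X_add X_scl ca lin_step(3))
qed

subsection \<open>The subalgebras\<close>

text \<open>Laurent monomials in the unitary, together with the projections. On \<open>good\<close>
  a product of two of them is again one of them or 0, so they span a star-algebra modulo the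
  kernel.\<close>

definition Vgens :: "nat \<Rightarrow> nat \<Rightarrow> (nat \<Rightarrow> 'w \<Rightarrow> fmat) set" where
  "Vgens s k = pr ` {1..d} \<union> {vp s k adj m | adj m. True}"

definition Y :: "mat_group \<Rightarrow> (nat \<Rightarrow> 'w \<Rightarrow> fmat) set" where
  "Y g = (case g of B_group \<Rightarrow> cst ` Dt | V_group s k \<Rightarrow> R.lin (Vgens s k))"

definition groups :: "mat_group set" where
  "groups = insert B_group {V_group s k | s k. k \<in> {1..d}}"

lemma cls_aeq: "x \<in> X \<Longrightarrow> y \<in> X \<Longrightarrow> aeq x y \<Longrightarrow> TQ.cls x = TQ.cls y"
  by (rule TQ.cls_eqI) (intro \<tau>_aeq X_mult aeq_mult aeq_refl)

lemma Vgens_mult: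
  assumes k: "k \<in> {1..d}" and "a \<in> Vgens s k" "c \<in> Vgens s k"
  shows "\<exists>e\<in>R.lin (Vgens s k). aeq (a * c) e"
proof -
  have z: "0 \<in> R.lin (Vgens s k)" by (rule R.lin_zero)
  have v: "vp s k adj m \<in> R.lin (Vgens s k)" for adj m
    by (rule R.lin_base) (auto simp: Vgens_def)
  have prl: "pr l \<in> R.lin (Vgens s k)" if "l \<in> {1..d}" for l
    by (rule R.lin_base) (use that in \<open>auto simp: Vgens_def\<close>)
  have PL: "P l n * fpow (P k n) L m = (if l = k then fpow (P k n) L m else 0)"
      "fpow (P k n) L m * P l n = (if l = k then fpow (P k n) L m else 0)"
    if "P k n * L = L" "L * P k n = L" for l n L m
  proof -
    have f: "P k n * fpow (P k n) L m = fpow (P k n) L m" "fpow (P k n) L m * P k n = fpow (P k n) L m"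
      using fpow_facts[of "P k n" L] that P_mult[of k n k] by simp_all
    have "P l n * fpow (P k n) L m = P l n * P k n * fpow (P k n) L m"
      "fpow (P k n) L m * P l n = fpow (P k n) L m * (P k n * P l n)"
      by (simp add: mult.assoc f) (simp add: mult.assoc[symmetric] f)
    then show "P l n * fpow (P k n) L m = (if l = k then fpow (P k n) L m else 0)"
      "fpow (P k n) L m * P l n = (if l = k then fpow (P k n) L m else 0)"
      by (auto simp: P_mult f)
  qed
  note gl = good_letter[OF _ _ k]
  consider l l' where "l \<in> {1..d}" "l' \<in> {1..d}" "a = pr l" "c = pr l'"
    | l adj m where "a = pr l" "c = vp s k adj m"
    | l adj m where "a = vp s k adj m" "c = pr l"
    | adj m m' where "a = vp s k adj m" "c = vp s k adj m'"
    | adj m m' where "a = vp s k adj m" "c = vp s k (\<not> adj) m'"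
    using assms(2,3) unfolding Vgens_def by (smt (verit) UnE imageE mem_Collect_eq)
  then show ?thesis
  proof cases
    case 1
    have "aeq (a * c) (if l = l' then pr l else 0)" unfolding 1 aeq_def
      by (auto simp: pr_apply P_mult)
    moreover have "(if l = l' then pr l else 0) \<in> R.lin (Vgens s k)"
      by (cases "l = l'") (simp_all only: if_True if_False simp_thms prl[OF 1(1)] prl[OF 1(2)] z)
    ultimately show ?thesis by (rule bexI)
  next
    case 2
    have "aeq (a * c) (if l = k then vp s k adj m else 0)"
      unfolding 2 aeq_def by (auto simp: pr_apply vp_apply PL gl simp del: lett.simps)
    moreover have "(if l = k then vp s k adj m else 0) \<in> R.lin (Vgens s k)"
      by (cases "l = k") (simp_all only: if_True if_False simp_thms v z)
    ultimately show ?thesis by (rule bexI)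
  next
    case 3
    have "aeq (a * c) (if l = k then vp s k adj m else 0)"
      unfolding 3 aeq_def by (auto simp: pr_apply vp_apply PL gl simp del: lett.simps)
    moreover have "(if l = k then vp s k adj m else 0) \<in> R.lin (Vgens s k)"
      by (cases "l = k") (simp_all only: if_True if_False simp_thms v z)
    ultimately show ?thesis by (rule bexI)
  next
    case 4
    have "aeq (a * c) (vp s k adj (m + m'))"
      unfolding 4 aeq_def using fpow_facts(4)[OF _ gl(1,2)]
      by (auto simp: vp_apply P_mult simp del: lett.simps)
    then show ?thesis using v by (rule bexI)
  next
    case 5
    have "aeq (a * c) (if m' \<le> m then vp s k adj (m - m') else vp s k (\<not> adj) (m' - m))"
      unfolding aeq_def
    proof (intro allI impI ballI)
      fix n \<omega> assume g: "d \<le> n" "\<omega> \<in> good_event n"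
      have PP: "P k n * P k n = P k n" by (simp add: P_mult)
      note eq = fpow_cancel[OF PP gl(1)[OF g] gl(2)[OF g] gl(1)[OF g] gl(2)[OF g] gl(3)[OF g], of s adj m m']
      show "(a * c) n \<omega> = (if m' \<le> m then vp s k adj (m - m') else vp s k (\<not> adj) (m' - m)) n \<omega>"
        by (cases "m' \<le> m") (simp_all only: 5 times_fun_apply vp_apply if_True if_False eq)
    qed
    moreover have "(if m' \<le> m then vp s k adj (m - m') else vp s k (\<not> adj) (m' - m)) \<in> R.lin (Vgens s k)"
      by (cases "m' \<le> m") (simp_all only: if_True if_False simp_thms v)
    ultimately show ?thesis by (rule bexI)
  qed
qed

lemma Vgens_X: "k \<in> {1..d} \<Longrightarrow> Vgens s k \<subseteq> X"
  unfolding Vgens_def using vp_X X_gen valid_pr by blast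

lemma Y_X: "g \<in> groups \<Longrightarrow> Y g \<subseteq> X"
proof (cases g)
  case B_group
  then show ?thesis using cst_X by (auto simp: Y_def)
next
  case (V_group s k)
  assume "g \<in> groups"
  then show ?thesis using V_group R.lin_subset[OF Vgens_X X_zero X_add X_scl, of k s] by (auto simp: Y_def groups_def)
qed

lemma Y_mult:
  assumes "k \<in> {1..d}" "x \<in> R.lin (Vgens s k)" "y \<in> R.lin (Vgens s k)"
  shows "\<exists>e\<in>R.lin (Vgens s k). aeq (x * y) e"
proof -
  have *: "\<exists>e\<in>R.lin (Vgens s k). aeq (a * y) e" if a: "a \<in> Vgens s k" for a
    using assms(3)
  proof (induction y rule: R.lin.induct)
    case lin_zero
    show ?case unfolding mult_zero_right using R.lin_zero aeq_refl by blast
  next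
    case (lin_step c y t)
    obtain e where e: "e \<in> R.lin (Vgens s k)" "aeq (a * c) e"
      using Vgens_mult[OF assms(1) a lin_step(1)] by blast
    obtain f where f: "f \<in> R.lin (Vgens s k)" "aeq (a * y) f" using lin_step(3) by blast
    have "aeq (a * (sclr t c + y)) (sclr t e + f)"
      unfolding distrib_left R.scl_mult_right using e f by (intro aeq_add aeq_scl)
    then show ?case using R.lin_add[OF R.lin_scl[OF e(1)] f(1)] by blast
  qed
  show ?thesis
    using assms(2)
  proof (induction x rule: R.lin.induct)
    case lin_zero
    show ?case unfolding mult_zero_left using R.lin_zero aeq_refl by blast
  next
    case (lin_step a x t)
    obtain e where e: "e \<in> R.lin (Vgens s k)" "aeq (a * y) e" using *[OF lin_step(1)] by blast
    obtain f where f: "f \<in> R.lin (Vgens s k)" "aeq (x * y) f" using lin_step(3) by blast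
    have "aeq ((sclr t a + x) * y) (sclr t e + f)"
      unfolding distrib_right R.scl_mult_left using e f by (intro aeq_add aeq_scl)
    then show ?case using R.lin_add[OF R.lin_scl[OF e(1)] f(1)] by blast
  qed
qed

lemma Y_star:
  assumes "k \<in> {1..d}" "x \<in> R.lin (Vgens s k)"
  shows "\<exists>e\<in>R.lin (Vgens s k). aeq (str x) e"
  using assms(2)
proof (induction x rule: R.lin.induct)
  case lin_zero
  show ?case unfolding R.st_zero using R.lin_zero aeq_refl by blast
next
  case (lin_step a x t)
  have "\<exists>e\<in>Vgens s k. aeq (str a) e"
  proof -
    consider l where "l \<in> {1..d}" "a = pr l" | adj m where "a = vp s k adj m"
      using lin_step(1) unfolding Vgens_def by blast
    then show ?thesis
    proof cases
      case 1
      then have sa: "str a = pr l" by (auto simp: str_def pr_apply fun_eq_iff)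
      show ?thesis unfolding sa Vgens_def using 1(1) aeq_refl[of "pr l"] by blast
    next
      case 2
      have "aeq (str a) (vp s k (\<not> adj) m)"
        unfolding aeq_def
      proof (intro allI impI ballI)
        fix n \<omega> assume g: "d \<le> n" "\<omega> \<in> good_event n"
        note gl = good_letter[OF g assms(1)]
        have "star_fmat (fpow (P k n) (LUs n \<omega> ((s, k), adj)) m) = fpow (P k n) (star_fmat (LUs n \<omega> ((s, k), adj))) m"
          by (rule fpow_star) (simp_all only: P_star P_mult gl simp_thms if_True)
        then show "str a n \<omega> = vp s k (\<not> adj) m n \<omega>"
          by (simp only: 2 str_def vp_apply gl(4))
      qed
      then show ?thesis by (auto simp: Vgens_def)
    qed
  qed
  then obtain e where e: "e \<in> R.lin (Vgens s k)" "aeq (str a) e" using R.lin_base by blast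
  obtain f where f: "f \<in> R.lin (Vgens s k)" "aeq (str x) f" using lin_step(3) by blast
  have "aeq (str (sclr t a + x)) (sclr (cnj t) e + f)"
    unfolding R.st_add R.st_scl using e f by (intro aeq_add aeq_scl)
  then show ?case using R.lin_add[OF R.lin_scl[OF e(1)] f(1)] by blast
qed

lemma star_subalgebra_Y:
  assumes g: "g \<in> groups" shows "star_subalgebra_over_D TQ.Q d TQ.pQ (TQ.cls ` Y g)"
proof (cases g)
  case B_group
  then have Y: "Y g = cst ` Dt" by (simp add: Y_def)
  have c: "cst x + cst y = cst (\<lambda>n. x n + y n)" "cst x * cst y = cst (\<lambda>n. x n * y n)"
    "sclr t (cst x) = cst (\<lambda>n. sc t (x n))" "str (cst x) = cst (\<lambda>n. star_fmat (x n))" for x y t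
    by (auto simp: cst_def sclr_def str_def fun_eq_iff)
  show ?thesis
    unfolding Y
  proof (rule TQ.star_subalgebra_Q)
    show "cst ` Dt \<subseteq> X" using cst_X by blast
    show "pr k \<in> cst ` Dt" if "k \<in> {1..d}" for k
    proof -
      have "const_gen (Inl k)" using that by (simp add: const_gen_def)
      from cval_Dt[OF this] gval_const[OF this] show ?thesis by (auto simp: cst_def)
    qed
    have "0 \<in> Dt" unfolding Dt_def by (rule C.lin_zero)
    moreover have "0 = cst 0" by (auto simp: cst_def fun_eq_iff)
    ultimately show "0 \<in> cst ` Dt" by blast
  qed (use c Dt_add Dt_mult Dt_sc Dt_star in auto)
next
  case (V_group s k)
  then have k: "k \<in> {1..d}" and Y: "Y g = R.lin (Vgens s k)" using g by (auto simp: groups_def Y_def)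
  have YX: "R.lin (Vgens s k) \<subseteq> X" using Y_X[OF g] Y by simp
  show ?thesis
    unfolding Y
  proof (rule TQ.star_subalgebra_Q[OF YX])
    show "pr l \<in> R.lin (Vgens s k)" if "l \<in> {1..d}" for l
      by (rule R.lin_base) (use that in \<open>auto simp: Vgens_def\<close>)
    show "0 \<in> R.lin (Vgens s k)" by (rule R.lin_zero)
    fix x y t assume x: "x \<in> R.lin (Vgens s k)"
    show "sclr t x \<in> R.lin (Vgens s k)" by (rule R.lin_scl[OF x])
    show "TQ.cls (str x) \<in> TQ.cls ` R.lin (Vgens s k)"
      using Y_star[OF k x] cls_aeq X_st YX x by blast
    assume y: "y \<in> R.lin (Vgens s k)"
    show "x + y \<in> R.lin (Vgens s k)" by (rule R.lin_add[OF x y])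
    show "TQ.cls (x * y) \<in> TQ.cls ` R.lin (Vgens s k)"
      using Y_mult[OF k x y] cls_aeq X_mult YX x y by blast
  qed
qed

subsection \<open>Alternating products\<close>

text \<open>Spanning elements for the centered part of each algebra: centered constants, or
  nontrivial powers of the unitary. That the powers are centered is a consequence of the vanishing
  of reduced words.\<close>

definition basic :: "mat_group \<Rightarrow> (nat \<Rightarrow> 'w \<Rightarrow> fmat) \<Rightarrow> bool" where
  "basic g z = (case g of B_group \<Rightarrow> z \<in> cst ` Dt \<and> (\<forall>k\<in>{1..d}. \<tau> (pr k * z) = 0)
     | V_group s k \<Rightarrow> (\<exists>adj m. z = vp s k adj (Suc m)))"

lemma basic_X: "g \<in> groups \<Longrightarrow> basic g z \<Longrightarrow> z \<in> X"
  using cst_X vp_X by (auto simp: basic_def groups_def simp del: vp.simps split: mat_group.splits)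

text \<open>Invariant describing the left end of the word for the product built so far: after a
  constant the leading coefficient is centered on every block, after a unitary it is the unit and
  the first letter belongs to that unitary.\<close>

definition front :: "mat_group list \<Rightarrow> (nat \<Rightarrow> fmat) \<Rightarrow> ((nat \<times> nat) letter \<times> (nat \<Rightarrow> fmat)) list \<Rightarrow> bool" where
  "front gs b w = (case gs of [] \<Rightarrow> b = one_seq \<and> w = []
     | g # _ \<Rightarrow> (case g of B_group \<Rightarrow> \<forall>k\<in>{1..d}. (\<lambda>n. Tr (b n * P k n) / of_nat n) \<longlonglongrightarrow> 0
        | V_group s k \<Rightarrow> b = one_seq \<and> w \<noteq> [] \<and> fst (fst (hd w)) = (s, k)))"

lemma reduced_Cons: "reduced (x # w) \<longleftrightarrow> (w = [] \<or> reduced_at x (hd w)) \<and> reduced w"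
proof (cases w)
  case (Cons y u)
  have "reduced (x # y # u) \<longleftrightarrow> reduced_at x y \<and> reduced (y # u)"
    by (simp add: reduced_def All_less_Suc2)
  then show ?thesis using Cons by simp
qed (simp add: reduced_def)

text \<open>For constant matrices the convergence of means is ordinary convergence of
  numbers.\<close>

lemma cst_centered:
  assumes "x \<in> Dt" "k \<in> {1..d}" "\<tau> (pr k * cst x) = 0"
  shows "(\<lambda>n. Tr (x n * P k n) / of_nat n) \<longlonglongrightarrow> 0"
proof -
  have "converges_to (ntr (pr k * cst x)) 0"
    using \<tau>[OF X_mult[OF X_gen[OF valid_pr[OF assms(2)]] cst_X[OF assms(1)]]] assms(3) by simp
  from converges_to_integral[OF this]
  have "(\<lambda>n. \<integral>\<omega>. Tr (x n * P k n) / of_nat n \<partial>\<Omega> n) \<longlonglongrightarrow> 0"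
    by (simp add: ntr_def cst_def pr_apply Tr_commute[of "x _"])
  then show ?thesis
  proof (rule Lim_transform_eventually)
    show "\<forall>\<^sub>F n in sequentially. (\<integral>\<omega>. Tr (x n * P k n) / of_nat n \<partial>\<Omega> n) = Tr (x n * P k n) / of_nat n"
      using eventually_ge_at_top[of d]
      by eventually_elim (simp add: prob_space.prob_space[OF prob])
  qed
qed

abbreviation fprod :: "(nat \<Rightarrow> 'w \<Rightarrow> fmat) list \<Rightarrow> nat \<Rightarrow> 'w \<Rightarrow> fmat" where
  "fprod zs \<equiv> foldr (*) zs TQ.e"

lemma e_apply: "TQ.e n \<omega> = dproj {..<n}"
  unfolding TQ.e_def pr_sum ..

lemma one_WV: 
  assumes "n \<ge> d" "x \<in> Dt" shows "x n * WV one_seq w n \<omega> = WV x w n \<omega>"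
proof -
  have "x n * one_seq n = x n" by (rule dproj_mult_id(2)[OF Dt_dim[OF assms(2,1)]])
  then have "WV x w n \<omega> = WV (\<lambda>m. x m * one_seq m) w n \<omega>" unfolding WV_def by simp
  also have "\<dots> = x n * WV one_seq w n \<omega>" by (rule WV_mult_left)
  finally show ?thesis by simp
qed

lemma vp_WV:
  assumes "k \<in> {1..d}" "n \<ge> d" "\<omega> \<in> good_event n"
  shows "vp s k adj (Suc m) n \<omega> * WV b w n \<omega> =
    WV one_seq (replicate m (((s, k), adj), one_seq) @ (((s, k), adj), b) # w) n \<omega>"
proof (induction m)
  case 0
  note gl = good_letter[OF assms(2,3,1)]
  have lo: "dproj {..<n} * LUs n \<omega> ((s, k), adj) = LUs n \<omega> ((s, k), adj)"
    by (rule letter_one[OF assms(2,3)]) (use assms in simp)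
  show ?case
    by (simp add: WV_Cons vg_apply pr_apply lo gl del: lett.simps)
next
  case (Suc m)
  have lo: "dproj {..<n} * LUs n \<omega> ((s, k), adj) = LUs n \<omega> ((s, k), adj)"
    by (rule letter_one[OF assms(2,3)]) (use assms in simp)
  have "vp s k adj (Suc (Suc m)) n \<omega> * WV b w n \<omega> = LUs n \<omega> ((s, k), adj) * (vp s k adj (Suc m) n \<omega> * WV b w n \<omega>)"
    by (simp only: vp_apply fpow.simps mult.assoc)
  then show ?case unfolding Suc by (simp only: replicate_Suc append_Cons WV_Cons lo)
qed

text \<open>Alternation yields reducedness. Inside a power equal letters follow each other, and
  these are not mutually inverse. Letters of the same unitary from two different factors can become
  neighbours only across one centered constant.\<close>

lemma alternating_word:
  "list_all2 basic gs zs \<Longrightarrow> set gs \<subseteq> groups \<Longrightarrow> successively (\<noteq>) gs \<Longrightarrow>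
   \<exists>b\<in>Dt. \<exists>w. sword w \<and> reduced w \<and> aeq (fprod zs) (WV b w) \<and> front gs b w"
proof (induction gs zs rule: list_all2_induct)
  case Nil
  have "aeq (fprod []) (WV one_seq [])" by (simp add: aeq_def e_apply)
  then show ?case using Dt_one
    by (intro bexI[of _ one_seq] exI[of _ "[]"] conjI) (simp_all only: front_def reduced_def, simp_all)
next
  case (Cons g gs z zs)
  have suc: "successively (\<noteq>) gs" using Cons.prems by (cases gs) auto
  have gs: "set gs \<subseteq> groups" using Cons.prems by simp
  obtain b w where b: "b \<in> Dt" and w: "sword w" "reduced w" and eq: "aeq (fprod zs) (WV b w)" and fr: "front gs b w"
    using Cons.IH[OF gs suc] by blast
  have eqz: "aeq (fprod (z # zs)) (z * WV b w)"
    unfolding foldr.simps comp_apply by (rule aeq_mult[OF aeq_refl eq])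
  show ?case
  proof (cases g)
    case B_group
    obtain x where x: "x \<in> Dt" "z = cst x" "\<forall>k\<in>{1..d}. \<tau> (pr k * cst x) = 0"
      using Cons.hyps B_group by (auto simp: basic_def)
    \<comment> \<open>The next factor, if any, is not a constant, so the leading coefficient is
      still the unit; the new constant takes its place unchanged and hence centered.\<close>
    have one: "b = one_seq"
    proof (cases gs)
      case (Cons g' gs')
      then have "g' \<noteq> B_group" using Cons.prems B_group by (auto simp: successively_Cons)
      then show ?thesis using fr Cons by (cases g') (auto simp: front_def)
    qed (use fr in \<open>simp add: front_def\<close>)
    have "aeq (z * WV b w) (WV x w)"
      unfolding aeq_def x one using one_WV[OF _ x(1)] by (simp add: cst_def)
    moreover have "front (g # gs) x w"
      using x cst_centered by (simp add: front_def B_group)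
    ultimately show ?thesis using aeq_trans[OF eqz] x w by blast
  next
    case (V_group s k)
    have k: "k \<in> {1..d}" using Cons.prems V_group by (auto simp: groups_def)
    obtain adj m where z: "z = vp s k adj (Suc m)"
      using Cons.hyps V_group by (auto simp: basic_def)
    let ?v = "((s, k), adj)"
    let ?w = "\<lambda>m. replicate m (?v, one_seq) @ (?v, b) # w"
    have "aeq (z * WV b w) (WV one_seq (?w m))"
      unfolding aeq_def z using vp_WV[OF k] by simp
    moreover have "sword (?w m)" using w b k Dt_one by auto
    moreover have "reduced (?w m)" for m
    proof (induction m)
      case 0
      \<comment> \<open>Only the junction of this power with the rest is at stake: either
        \<open>b\<close> is centered, or the next letter belongs to another unitary.\<close>
      have "w = [] \<or> reduced_at (?v, b) (hd w)"
      proof (cases gs)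
        case Nil
        then show ?thesis using fr by (simp add: front_def)
      next
        case (Cons g' gs')
        have ne: "g' \<noteq> V_group s k" using Cons.prems V_group Cons by (auto simp: successively_Cons)
        show ?thesis
        proof (cases g')
          case B_group
          then show ?thesis using fr Cons k by (auto simp: front_def reduced_at_def P_def)
        next
          case (V_group s' k')
          then have "fst (fst (hd w)) \<noteq> (s, k)" using fr Cons ne by (auto simp: front_def)
          then show ?thesis by (auto simp: reduced_at_def)
        qed
      qed
      then show ?case using w by (simp add: reduced_Cons)
    next
      case (Suc m)
      have "reduced_at (?v, one_seq) (hd (?w m))" by (cases m) (auto simp: reduced_at_def)
      then show ?case using Suc by (simp add: reduced_Cons)
    qed
    moreover have "front (g # gs) one_seq (?w m)" by (cases m) (auto simp: front_def V_group)
    ultimately show ?thesis using aeq_trans[OF eqz] Dt_one by blast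
  qed
qed

lemma fprod_X: "set zs \<subseteq> X \<Longrightarrow> fprod zs \<in> X"
  by (induction zs) (auto intro: TQ.e_X X_mult)

lemma basic_list_X: "list_all2 basic gs zs \<Longrightarrow> set gs \<subseteq> groups \<Longrightarrow> set zs \<subseteq> X"
  by (induction gs zs rule: list_all2_induct) (auto intro: basic_X)

lemma basic_product_null:
  assumes "list_all2 basic gs zs" "set gs \<subseteq> groups" "successively (\<noteq>) gs" "gs \<noteq> []" "k \<in> {1..d}"
  shows "\<tau> (pr k * fprod zs) = 0"
proof -
  obtain b w where b: "b \<in> Dt" and w: "sword w" "reduced w" and eq: "aeq (fprod zs) (WV b w)" and fr: "front gs b w"
    using alternating_word[OF assms(1-3)] by blast
  have PD: "(\<lambda>n. P k n) \<in> Dt" using cval_Dt[of "Inl k"] assms(5) by (simp add: const_gen_def cval_def[abs_def])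
  let ?b = "\<lambda>n. P k n * b n"
  have bD: "?b \<in> Dt" by (rule Dt_mult[OF PD b])
  have eq': "aeq (pr k * fprod zs) (WV ?b w)"
    using eq by (auto simp: aeq_def pr_apply WV_mult_left)
  have X: "pr k * fprod zs \<in> X"
    using assms by (intro X_mult X_gen valid_pr fprod_X basic_list_X) auto
  have "null (ntr (WV ?b w))"
  \<comment> \<open>A word without letters arises only behind a leading constant factor, and then
    \<open>front\<close> makes its coefficient centered.\<close>
  proof (cases "w = []")
    case True
    then have "hd gs = B_group" using fr assms(4) by (cases gs) (auto simp: front_def split: mat_group.splits)
    then have "(\<lambda>n. Tr (b n * P k n) / of_nat n) \<longlonglongrightarrow> 0"
      using fr assms(4,5) by (cases gs) (auto simp: front_def)
    from null_const[OF this] show ?thesis using True by (simp add: ntr_def[abs_def] Tr_commute)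
  qed (use reduced_null[OF _ w bD] in blast)
  then have c0: "converges_to (ntr (WV ?b w)) 0" by (rule null_converges_to)
  have "converges_to (ntr (pr k * fprod zs)) 0"
  proof (rule converges_to_cong[OF c0])
    fix n assume n: "d \<le> n"
    interpret hf: haar_family "\<Omega> n" n I "blk n" "\<lambda>i. U i n" by (rule haar[OF n])
    show "ntr (pr k * fprod zs) n \<in> borel_measurable (\<Omega> n)"
      using converges_to_bdd[OF \<tau>[OF X]] n by (auto simp: bdd_def)
    show "AE \<omega> in \<Omega> n. ntr (WV ?b w) n \<omega> = ntr (pr k * fprod zs) n \<omega>"
      using hf.AE_good by eventually_elim (use eq' n in \<open>simp add: ntr_def aeq_def\<close>)
  qed
  then show ?thesis by (rule \<tau>_eq)
qed

text \<open>The factors are expanded one at a time from the left; \<open>c\<close> collects those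
  already expanded, which is why it varies in the induction.\<close>

lemma multilinear:
  assumes "list_all2 (\<lambda>g z. z \<in> R.lin (Collect (basic g))) gs zs" "set gs \<subseteq> groups" "c \<in> X"
    "\<And>us. list_all2 basic gs us \<Longrightarrow> \<tau> (c * fprod us) = 0"
  shows "\<tau> (c * fprod zs) = 0"
  using assms
proof (induction gs zs arbitrary: c rule: list_all2_induct)
  case Nil
  then show ?case by blast
next
  case (Cons g gs z zs)
  have g: "g \<in> groups" "set gs \<subseteq> groups" using Cons.prems by auto
  have linX: "R.lin (Collect (basic g)) \<subseteq> X" if "g \<in> groups" for g
    using basic_X[OF that] by (intro R.lin_subset X_zero X_add X_scl) auto
  have "set zs \<subseteq> X"
    using Cons.hyps(2) g(2) by (induction gs zs rule: list_all2_induct) (use linX in auto)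
  then have F: "fprod zs \<in> X" by (rule fprod_X)
  have step: "\<tau> (c * (a * fprod zs)) = 0" if a: "basic g a" for a
  proof -
    have "\<tau> (c * a * fprod zs) = 0"
    proof (rule Cons.IH[OF g(2)])
      show "c * a \<in> X" using Cons.prems(2) basic_X[OF g(1) a] by (rule X_mult)
      show "\<tau> (c * a * fprod us) = 0" if "list_all2 basic gs us" for us
      proof -
        have "\<tau> (c * fprod (a # us)) = 0" by (rule Cons.prems(3)) (use a that in simp)
        then show ?thesis by (simp only: foldr.simps comp_apply mult.assoc)
      qed
    qed
    then show ?thesis by (simp only: mult.assoc)
  qed
  have "\<tau> (c * (z * fprod zs)) = 0"
    using Cons.hyps(1)
  proof (induction z rule: R.lin.induct)
    case lin_zero
    show ?case unfolding mult_zero_left mult_zero_right by (rule \<tau>_zero)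
  next
    case (lin_step a z t)
    have "a \<in> X" "z \<in> X" using lin_step basic_X[OF g(1)] linX[OF g(1)] by auto
    then have "c * (a * fprod zs) \<in> X" "c * (z * fprod zs) \<in> X"
      using Cons.prems(2) F by (auto intro!: X_mult)
    moreover have "c * ((sclr t a + z) * fprod zs) = sclr t (c * (a * fprod zs)) + c * (z * fprod zs)"
      by (simp only: distrib_left distrib_right R.scl_mult_left R.scl_mult_right)
    ultimately show ?case using step lin_step by (simp only: \<tau>_add \<tau>_scl X_scl) simp
  qed
  then show ?case by (simp only: foldr.simps comp_apply)
qed

lemma diag_add: 
  assumes "l \<in> {1..d}" shows "sclr a (pr l) + TQ.diag c = TQ.diag (c(l := c l + a))"
proof -
  have d: "TQ.diag f = sclr (f l) (pr l) + (\<Sum>k\<in>{1..d} - {l}. sclr (f k) (pr k))" for f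
    unfolding TQ.diag_def by (rule sum.remove[OF finite_atLeastAtMost assms])
  have s: "(\<Sum>k\<in>{1..d} - {l}. sclr ((c(l := c l + a)) k) (pr k)) = (\<Sum>k\<in>{1..d} - {l}. sclr (c k) (pr k))"
    by (rule sum.cong) auto
  show ?thesis
    unfolding d[of c] d[of "c(l := c l + a)"] s by (simp only: fun_upd_same R.scl_add_left ac_simps)
qed

text \<open>An element of the algebra of one unitary is a diagonal part plus a combination of
  nontrivial powers. The latter is centered, so pairing with p_l leaves c_l \<phi>(p_l) = 0 and the
  diagonal part vanishes.\<close>

lemma centered_in_lin_basic:
  assumes g: "g \<in> groups" and z: "z \<in> Y g" "\<And>k. k \<in> {1..d} \<Longrightarrow> \<tau> (pr k * z) = 0"
  shows "z \<in> R.lin (Collect (basic g))"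
proof (cases g)
  case B_group
  then have "basic g z" using z by (auto simp: basic_def Y_def)
  then show ?thesis using R.lin_base by blast
next
  case (V_group s k)
  have k: "k \<in> {1..d}" using g V_group by (auto simp: groups_def)
  have "z \<in> R.lin (Vgens s k)" using z V_group by (simp add: Y_def)
  then have "\<exists>c. \<exists>u\<in>R.lin (Collect (basic g)). z = TQ.diag c + u"
  proof (induction z rule: R.lin.induct)
    case lin_zero
    have "0 = TQ.diag (\<lambda>_. 0) + 0" unfolding TQ.diag_def by (simp only: R.scl_zero sum.neutral_const add_0)
    then show ?case using R.lin_zero by blast
  next
    case (lin_step a x t)
    obtain c u where cu: "u \<in> R.lin (Collect (basic g))" "x = TQ.diag c + u" using lin_step(3) by blast
    consider l where "l \<in> {1..d}" "a = pr l" | adj m where "a = vp s k adj (Suc m)"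
    proof -
      consider l where "l \<in> {1..d}" "a = pr l" | adj m where "a = vp s k adj m"
        using lin_step(1) unfolding Vgens_def by blast
      then show ?thesis
      proof cases
        case (2 adj m)
        then show ?thesis using that k by (cases m) auto
      qed (use that in blast)
    qed
    then show ?case
    proof cases
      case 1
      have "sclr t a + x = TQ.diag (c(l := c l + t)) + u"
        unfolding cu 1(2) add.assoc[symmetric] diag_add[OF 1(1)] ..
      then show ?thesis using cu by blast
    next
      case 2
      have "sclr t a + x = TQ.diag c + (sclr t a + u)" unfolding cu by (simp only: ac_simps)
      moreover have "sclr t a + u \<in> R.lin (Collect (basic g))"
        by (rule R.lin_step[OF _ cu(1)]) (use 2 V_group in \<open>auto simp: basic_def\<close>)
      ultimately show ?thesis by blast
    qed
  qed
  then obtain c u where u: "u \<in> R.lin (Collect (basic g))" and zc: "z = TQ.diag c + u" by blast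
  have uX: "u \<in> X" using u basic_X[OF g] R.lin_subset[OF _ X_zero X_add X_scl, of "Collect (basic g)"] by blast
  have "c l = 0" if l: "l \<in> {1..d}" for l
  proof -
    have prX: "pr l \<in> X" by (rule X_gen[OF valid_pr[OF l]])
    \<comment> \<open>Centeredness of the powers is the one-factor case of the vanishing of
      alternating products.\<close>
    have "\<tau> (pr l * fprod [u]) = 0"
      by (rule multilinear[of "[g]"]) (use u g prX basic_product_null[of "[g]" _ l] l in auto)
    moreover have "aeq (pr l * fprod [u]) (pr l * u)"
      using X_dim[OF uX] by (auto simp: aeq_def e_apply dproj_mult_id)
    ultimately have "\<tau> (pr l * u) = 0"
      using \<tau>_aeq[of "pr l * fprod [u]" "pr l * u"] prX uX fprod_X[of "[u]"] X_mult by simp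
    moreover have "pr l * TQ.diag c = sclr (c l) (pr l)"
    proof -
      have "TQ.diag c n \<omega> = Dm c n" for n \<omega>
      proof -
        have "(\<Sum>k\<in>S. sclr (c k) (pr k)) n \<omega> = (\<Sum>k\<in>S. sc (c k) (P k n))" for S
          by (induction S rule: infinite_finite_induct) (auto simp: sclr_def pr_apply)
        then show ?thesis by (simp add: TQ.diag_def Dm_def)
      qed
      then show ?thesis using P_Dm(1)[OF l] by (auto simp: fun_eq_iff pr_apply sclr_def)
    qed
    moreover have "pr l * z = pr l * TQ.diag c + pr l * u" unfolding zc by (rule distrib_left)
    ultimately have "\<tau> (sclr (c l) (pr l)) + 0 = 0"
      using z(2)[OF l] \<tau>_add[OF X_scl[OF prX] X_mult[OF prX uX]] by simp
    then show ?thesis using \<tau>_scl[OF prX] \<tau>_pr[OF l] \<phi>_nonzero[OF l] by simp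
  qed
  then have "TQ.diag c = 0" unfolding TQ.diag_def by (intro sum.neutral ballI) (simp only: R.scl_zero)
  then show ?thesis using u zc by (simp only: add_0)
qed

text \<open>Centered classes are lifted to centered elements before the quotient. These are
  combinations of basic elements, and multilinearity reduces the claim to alternating products of
  basic ones.\<close>

lemma free_Y: "free_subalgebras_over_D TQ.Q TQ.\<phi>Q d TQ.pQ groups (\<lambda>g. TQ.cls ` Y g)"
  unfolding free_subalgebras_over_D_def
proof (intro allI impI, elim conjE)
  fix gs :: "mat_group list" and xs
  assume gs: "gs \<noteq> []" "set gs \<subseteq> groups" "successively (\<noteq>) gs"
    and xs: "list_all2 (\<lambda>g x. x \<in> TQ.cls ` Y g \<and> cond_exp_D TQ.Q TQ.\<phi>Q d TQ.pQ x = \<zero>\<^bsub>TQ.Q\<^esub>) gs xs"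
  have "\<exists>zs. xs = map TQ.cls zs \<and> list_all2 (\<lambda>g z. z \<in> R.lin (Collect (basic g))) gs zs \<and> set zs \<subseteq> X"
    using xs gs(2)
  proof (induction gs xs rule: list_all2_induct)
    case (Cons g gs x xs)
    obtain zs where zs: "xs = map TQ.cls zs" "list_all2 (\<lambda>g z. z \<in> R.lin (Collect (basic g))) gs zs" "set zs \<subseteq> X"
      using Cons by auto
    have g: "g \<in> groups" using Cons.prems by simp
    obtain z where z: "z \<in> Y g" "x = TQ.cls z" using Cons.hyps by auto
    have zX: "z \<in> X" using Y_X[OF g] z by blast
    have "\<forall>k\<in>{1..d}. \<tau> (pr k * z) = 0" using Cons.hyps z TQ.cond_exp_Q[OF zX] by simp
    then have "z \<in> R.lin (Collect (basic g))" by (intro centered_in_lin_basic g z) auto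
    then show ?case using zs z zX by (intro exI[of _ "z # zs"]) simp
  qed simp
  then obtain zs where zs: "xs = map TQ.cls zs" "list_all2 (\<lambda>g z. z \<in> R.lin (Collect (basic g))) gs zs" "set zs \<subseteq> X"
    by blast
  have "\<tau> (pr k * fprod zs) = 0" if k: "k \<in> {1..d}" for k
    by (rule multilinear[OF zs(2) gs(2)]) (use basic_product_null[OF _ gs(2,3,1) k] X_gen[OF valid_pr[OF k]] in auto)
  then show "cond_exp_D TQ.Q TQ.\<phi>Q d TQ.pQ (foldr (\<otimes>\<^bsub>TQ.Q\<^esub>) xs \<one>\<^bsub>TQ.Q\<^esub>) = \<zero>\<^bsub>TQ.Q\<^esub>"
    using TQ.foldr_Q[OF zs(3)] TQ.cond_exp_Q[OF fprod_X[OF zs(3)]] zs(1) by simp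
qed

subsection \<open>Convergence in \<open>\<D>\<close>-distribution\<close>

definition lim_elem :: "mat_index \<Rightarrow> nat \<Rightarrow> complex" where
  "lim_elem i = TQ.cls (gval (Inr (i, False)))"

text \<open>Lift of a word in the limit elements to random matrices, mediating between its value in
  the quotient and the matrix words.\<close>

fun word_seq :: "mat_index D_word \<Rightarrow> nat \<Rightarrow> 'w \<Rightarrow> fmat" where
  "word_seq [] = TQ.e"
| "word_seq ((i, adj, c) # w) = gval (Inr (i, adj)) * TQ.diag c * word_seq w"

abbreviation "indices \<equiv> \<Union> (group_indices ` groups)"

lemma valid_index: "i \<in> indices \<Longrightarrow> valid_gen (Inr (i, adj))"
  by (auto simp: groups_def group_indices_def valid_gen_def)

lemma word_seq_Q:
  "fst ` set w \<subseteq> indices \<Longrightarrow> word_seq w \<in> X \<and> word_val TQ.Q (D_elem TQ.Q d TQ.pQ) lim_elem w = TQ.cls (word_seq w)"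
proof (induction w)
  case Nil
  then show ?case using TQ.e_X by (simp add: TQ.Q_simps)
next
  case (Cons x w)
  obtain i adj c where x: "x = (i, adj, c)" by (cases x)
  have i: "i \<in> indices" and w: "word_seq w \<in> X" "word_val TQ.Q (D_elem TQ.Q d TQ.pQ) lim_elem w = TQ.cls (word_seq w)"
    using Cons x by auto
  have g: "gval (Inr (i, adj)) \<in> X" for adj by (rule X_gen[OF valid_index[OF i]])
  have "str (gval (Inr (i, False))) = gval (Inr (i, True))"
    unfolding str_def by (simp only: flip_gen_gval flip_gen.simps simp_thms)
  then have l: "(if adj then star TQ.Q (lim_elem i) else lim_elem i) = TQ.cls (gval (Inr (i, adj)))"
    using TQ.Q_star[OF g[of False]] by (simp add: lim_elem_def)
  have gd: "gval (Inr (i, adj)) * TQ.diag c \<in> X" by (rule X_mult[OF g TQ.diag_X])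
  show ?case
    unfolding x word_val.simps word_seq.simps l w(2)
    by (simp only: TQ.D_elem_Q TQ.Q_mult[OF g TQ.diag_X]
        TQ.Q_mult[OF gd w(1)] X_mult[OF gd w(1)] simp_thms)
qed

lemma diag_apply: "TQ.diag c n \<omega> = Dm c n"
proof -
  have "(\<Sum>k\<in>S. sclr (c k) (pr k)) n \<omega> = (\<Sum>k\<in>S. sc (c k) (P k n))" for S
    by (induction S rule: infinite_finite_induct) (auto simp: sclr_def pr_apply)
  then show ?thesis by (simp add: TQ.diag_def Dm_def)
qed

lemma joint_carrier:
  assumes "n \<ge> d" "\<omega> \<in> Sigma_Algebra.space (\<Omega> n)" "i \<in> indices"
  shows "joint_family B V i n \<omega> \<in> carrier_mat n n"
proof (cases i)
  case (V_index s k)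
  then have "k \<in> {1..d}" using assms(3) by (auto simp: groups_def group_indices_def)
  then have "V s k n \<in> measurable (\<Omega> n) (mat_borel n)"
    using V_uniform[OF assms(1)] by (auto simp: uniform_on_def)
  from measurable_space[OF this assms(2)] show ?thesis
    using V_index by (simp add: joint_family_def space_mat_borel)
qed (simp add: joint_family_def B_dim assms)

lemma word_seq_emb:
  assumes n: "n \<ge> d" and \<omega>: "\<omega> \<in> Sigma_Algebra.space (\<Omega> n)" and w: "fst ` set w \<subseteq> indices"
  shows "emb (word_val (mat_alg n) (D_mat d (q n)) (\<lambda>i. joint_family B V i n \<omega>) w) = word_seq w n \<omega>"
  using w
proof (induction w)
  case Nil
  then show ?case by (simp add: emb_one_mat_alg e_apply)
next
  case (Cons x w)
  obtain i adj c where x: "x = (i, adj, c)" by (cases x)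
  have j: "joint_family B V i' n \<omega> \<in> carrier_mat n n" if "i' \<in> fst ` set ((i, adj, c) # w)" for i'
    by (rule joint_carrier[OF n \<omega>]) (use that Cons.prems x in auto)
  have "emb (word_val (mat_alg n) (D_mat d (q n)) (\<lambda>i. joint_family B V i n \<omega>) ((i, adj, c) # w)) =
    (if adj then star_fmat (emb (joint_family B V i n \<omega>)) else emb (joint_family B V i n \<omega>)) *
      emb (D_mat d (q n) c) * emb (word_val (mat_alg n) (D_mat d (q n)) (\<lambda>i. joint_family B V i n \<omega>) w)"
    by (rule emb_word_val_Cons[where a = "\<lambda>i. joint_family B V i n \<omega>", OF _ q_sum[OF n, symmetric]]) (rule j)
  also have "\<dots> = word_seq ((i, adj, c) # w) n \<omega>"
    using Cons by (simp add: Dm_emb[OF n] diag_apply gval_def)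
  finally show ?case by (simp only: x)
qed

text \<open>A coordinate of E is the mean of the normalized trace against p_k(n), divided by that of
  p_k(n) itself; numerator and denominator converge to \<tau>(p_k x) and \<phi>(p_k).\<close>

lemma converges_Q:
  "converges_in_D_distribution d q \<Omega> indices (joint_family B V) TQ.Q TQ.\<phi>Q TQ.pQ lim_elem"
  unfolding converges_in_D_distribution_def
proof (intro allI impI ballI, elim conjE)
  fix w :: "mat_index D_word" and k
  assume w: "fst ` set w \<subseteq> indices" and k: "k \<in> {1..d}"
  let ?E = "\<lambda>n. E_mat (\<Omega> n) d (q n)
      (\<lambda>\<omega>. word_val (mat_alg n) (D_mat d (q n)) (\<lambda>i. joint_family B V i n \<omega>) w) k"
  have X: "word_seq w \<in> X" using word_seq_Q[OF w] by blast
  have lim: "(\<lambda>n. (\<integral>\<omega>. ntr (pr k * word_seq w) n \<omega> \<partial>\<Omega> n) / (Tr (P k n) / of_nat n))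
      \<longlonglongrightarrow> \<tau> (pr k * word_seq w) / \<phi> (p k)"
    by (intro tendsto_divide converges_to_integral \<tau> X_mult X X_gen valid_pr k ratio_P \<phi>_nonzero)
  have "?E \<longlonglongrightarrow> \<tau> (pr k * word_seq w) / \<phi> (p k)"
  proof (rule Lim_transform_eventually[OF lim])
    show "\<forall>\<^sub>F n in sequentially. (\<integral>\<omega>. ntr (pr k * word_seq w) n \<omega> \<partial>\<Omega> n) / (Tr (P k n) / of_nat n) = ?E n"
      using eventually_ge_at_top[of d]
    proof eventually_elim
      case (elim n)
      have n0: "(of_nat n :: complex) \<noteq> 0" using elim d_pos by simp
      have "?E n = (\<integral>\<omega>. Tr (dproj (block d (q n) k) *
         emb (word_val (mat_alg n) (D_mat d (q n)) (\<lambda>i. joint_family B V i n \<omega>) w)) \<partial>\<Omega> n) / of_nat (q n k)"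
      proof (rule E_mat_emb[OF q_sum[OF elim, symmetric] k])
        fix \<omega> assume "\<omega> \<in> Sigma_Algebra.space (\<Omega> n)"
        then show "word_val (mat_alg n) (D_mat d (q n)) (\<lambda>i. joint_family B V i n \<omega>) w \<in> carrier_mat n n"
          using w by (intro word_val_carrier joint_carrier elim q_sum[OF elim, symmetric]) auto
      qed
      also have "(\<integral>\<omega>. Tr (dproj (block d (q n) k) *
         emb (word_val (mat_alg n) (D_mat d (q n)) (\<lambda>i. joint_family B V i n \<omega>) w)) \<partial>\<Omega> n) =
         (\<integral>\<omega>. of_nat n * ntr (pr k * word_seq w) n \<omega> \<partial>\<Omega> n)"
        by (rule Bochner_Integration.integral_cong[OF refl])
           (use n0 elim in \<open>simp add: word_seq_emb[OF elim _ w] ntr_def pr_apply P_def q'_eq\<close>)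
      finally show ?case using n0 elim by (simp add: Tr_P[OF k] q'_eq)
    qed
  qed
  moreover have "E_coord TQ.Q TQ.\<phi>Q TQ.pQ (word_val TQ.Q (D_elem TQ.Q d TQ.pQ) lim_elem w) k
      = \<tau> (pr k * word_seq w) / \<phi> (p k)"
    using word_seq_Q[OF w] TQ.E_coord_Q[OF X k] \<tau>_pr[OF k] by simp
  ultimately show "?E \<longlonglongrightarrow> E_coord TQ.Q TQ.\<phi>Q TQ.pQ (word_val TQ.Q (D_elem TQ.Q d TQ.pQ) lim_elem w) k"
    by simp
qed

text \<open>The first power of a unitary carries the projection as a right factor and agrees with
  the unitary only on \<open>good\<close>; their classes coincide.\<close>

lemma lim_elem_Y:
  assumes "g \<in> groups" "i \<in> group_indices g" shows "lim_elem i \<in> TQ.cls ` Y g"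
proof (cases g)
  case B_group
  then obtain j where i: "i = B_index j" using assms by (auto simp: group_indices_def)
  have c: "const_gen (Inr (i, False))" by (simp add: i const_gen_def)
  show ?thesis unfolding lim_elem_def gval_const[OF c] using cval_Dt[OF c] B_group
    by (auto simp: Y_def cst_def)
next
  case (V_group s k)
  then have i: "i = V_index s k" and k: "k \<in> {1..d}" using assms by (auto simp: group_indices_def groups_def)
  have "aeq (vg s k False) (vp s k False 1)"
    unfolding aeq_def using good_letter[OF _ _ k]
    by (simp add: pr_apply vg_apply del: lett.simps)
  then have "lim_elem i = TQ.cls (vp s k False 1)"
    unfolding lim_elem_def i by (intro cls_aeq X_gen valid_vg vp_X k)
  moreover have "vp s k False 1 \<in> R.lin (Vgens s k)" by (rule R.lin_base) (unfold Vgens_def, blast)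
  ultimately show ?thesis using V_group by (simp add: Y_def)
qed

theorem asymptotically_free:
  "asymptotically_free_over_D d (\<lambda>k. \<phi> (p k)) q \<Omega> groups group_indices (joint_family B V)"
  unfolding asymptotically_free_over_D_def
proof (intro exI conjI)
  show "tracial_ncps_over TQ.Q TQ.\<phi>Q d TQ.pQ" by (rule TQ.tracial_ncps_over_Q)
  show "\<forall>k\<in>{1..d}. TQ.\<phi>Q (TQ.pQ k) = \<phi> (p k)"
    using TQ.\<phi>Q_cls[OF X_gen[OF valid_pr]] \<tau>_pr by simp
  show "\<forall>i\<in>indices. lim_elem i \<in> carrier TQ.Q"
    using X_gen[OF valid_index] by (auto simp: lim_elem_def TQ.Q_simps)
  show "converges_in_D_distribution d q \<Omega> indices (joint_family B V) TQ.Q TQ.\<phi>Q TQ.pQ lim_elem"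
    by (rule converges_Q)
  show "free_over_D TQ.Q TQ.\<phi>Q d TQ.pQ groups (\<lambda>g. lim_elem ` group_indices g)"
    unfolding free_over_D_def
    by (rule exI[of _ "\<lambda>g. TQ.cls ` Y g"]) (use star_subalgebra_Y lim_elem_Y free_Y in blast)
qed

end

theorem proposition4p4:
  fixes A :: "'a star_algebra" and \<phi> :: "'a \<Rightarrow> complex" and d :: nat and p :: "nat \<Rightarrow> 'a"
    and q :: "nat \<Rightarrow> nat \<Rightarrow> nat"
    and \<Omega> :: "nat \<Rightarrow> 'w measure"
    and V :: "nat \<Rightarrow> nat \<Rightarrow> nat \<Rightarrow> 'w \<Rightarrow> complex mat"
    and B :: "nat \<Rightarrow> nat \<Rightarrow> complex mat"
    and b :: "nat \<Rightarrow> 'a"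
  assumes space: "tracial_ncps_over A \<phi> d p"
    \<comment> \<open>positive block sizes with sum \<open>n\<close> only exist for \<open>n \<ge> d\<close>\<close>
    and q_pos: "\<And>n k. n \<ge> d \<Longrightarrow> k \<in> {1..d} \<Longrightarrow> q n k > 0"
    and q_sum: "\<And>n. n \<ge> d \<Longrightarrow> (\<Sum>k=1..d. q n k) = n"
    and q_lim: "\<And>k. k \<in> {1..d} \<Longrightarrow> (\<lambda>n. of_nat (q n k) / of_nat n) \<longlonglongrightarrow> \<phi> (p k)"
    and prob: "\<And>n. n \<ge> d \<Longrightarrow> prob_space (\<Omega> n)"
    and V_indep: "\<And>n. n \<ge> d \<Longrightarrow>
          prob_space.indep_vars (\<Omega> n) (\<lambda>_. mat_borel n) (\<lambda>(s, k). V s k n) (UNIV \<times> {1..d})"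
    and V_uniform: "\<And>n s k. n \<ge> d \<Longrightarrow> k \<in> {1..d} \<Longrightarrow>
          uniform_on (\<Omega> n) n (block_unitary d (q n) n k) (V s k n)"
    and B_dim: "\<And>n j. n \<ge> d \<Longrightarrow> B j n \<in> carrier_mat n n"
    and B_mult: "\<And>n i j. n \<ge> d \<Longrightarrow> \<exists>l. B i n * B j n = B l n"
    and B_adjoint: "\<And>n j. n \<ge> d \<Longrightarrow> \<exists>l. mat_adjoint (B j n) = B l n"
    and B_proj: "\<And>n k. n \<ge> d \<Longrightarrow> k \<in> {1..d} \<Longrightarrow> \<exists>j. B j n = block_proj d (q n) k"
    and B_bounded: "\<And>j. \<exists>K. \<forall>n\<ge>d.
          mat_opnorm (D_mat d (q n) (E_mat (\<Omega> n) d (q n) (\<lambda>_. B j n))) \<le> K"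
    and b_in: "\<And>j. b j \<in> carrier A"
    and B_conv: "converges_in_D_distribution d q \<Omega> UNIV (\<lambda>j n _. B j n) A \<phi> p b"
  shows "asymptotically_free_over_D d (\<lambda>k. \<phi> (p k)) q \<Omega>
           (insert B_group {V_group s k | s k. k \<in> {1..d}}) group_indices (joint_family B V)"
proof -
  interpret haar_and_constant_matrices A \<phi> d p q \<Omega> V B b
    by (rule haar_and_constant_matrices.intro) (fact space q_sum q_lim prob V_indep V_uniform B_dim B_conv)+
  show ?thesis unfolding groups_def[symmetric] by (rule asymptotically_free)
qed

end
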